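(* Let $A$ be a finite-dimensional semisimple real associative algebra with Wedderburn decomposition $A\cong\prod_r M_{n_r}(D_r)$, $D_r\in\{\mathbb R,\mathbb C,\mathbb H\}$, endowed with a Euclidean structure adapted to this decomposition. Then $S_0(A)=\prod_r S_0(M_{n_r}(D_r))$ is a finite union of products of compact Hermitian symmetric spaces; each factor $S_0(M_{n_r}(D_r))$ is identified, as a homogeneous space, with - $O(2m)/U(m)$ if $D_r=\mathbb R$ and $n_r=2m$ is even; - a disjoint union of Grassmannians $U(n_r)/(U(j)\times U(n_r-j))$, $0\le j\le n_r$, if $D_r=\mathbb C$; - $Sp(n_r)/U(n_r)$ if $D_r=\mathbb H$. Moreover, in each of these simple cases ($A=M_{2m}(\mathbb R)$, $M_n(\mathbb C)$ or $M_m(\mathbb H)$ with the Frobenius inner product), the zero variety $Z_0$ coincides with the locus $$\mathcal Z=\{w\in\mathbb C\otimes A:\ L_w^tL_w=0\},$$ i.e. with the set of $w=1\otimes a+i\otimes b$ ($a,b\in A$) satisfying $L_a^tL_a=L_b^tL_b$ and $L_a^tL_b+L_b^tL_a=0$, and it is the isotropic (determinantal) cone over the symmetric space $S_0(A)$ given by the union $\bigcup_{s\in S_0(A)}\mathcal W(L_s)$ of the linear subspaces $\mathcal W(L_s)=\{1\otimes v+i\otimes sv: v\in A\}$.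
   Context: $S(A)=\{a\in A:a^2=-1\}$; $L_a(x)=ax$. Given a Euclidean inner product on $A$, $L^t$ denotes the adjoint and $S_0(A)=\{s\in S(A): L_sL_s^t=I\}$. A Euclidean structure is adapted to the Wedderburn decomposition if it is an orthogonal product of Euclidean structures on the factors $M_{n_r}(D_r)$, each of which is the Frobenius (Hilbert–Schmidt) inner product determined by the standard inner product of $D_r$. The tensor product $\mathbb C\otimes A$ is over $\mathbb R$; for $w\in\mathbb C\otimes A$, $L_w$ is left multiplication by $w$ on $\mathbb C\otimes A$ and $L_w^t$ its transpose with respect to the $\mathbb C$-bilinear extension of the inner product. $\pi(1\otimes a+i\otimes b,s)=a+sb$, and $Z_0=\{w\in\mathbb C\otimes A:\ \pi(w,s)=0\text{ for some }s\in S_0(A)\}$. For $D_r=\mathbb R$ and $n_r$ odd, $S_0(M_{n_r}(\mathbb R))=\varnothing$. *)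

theory Defs
  imports "HOL-Analysis.Analysis"
begin

section \<open>Quaternions\<close>

datatype quat = Quat (Q0: real) (Q1: real) (Q2: real) (Q3: real)

lemma quat_eq_iff: "p = q \<longleftrightarrow> Q0 p = Q0 q \<and> Q1 p = Q1 q \<and> Q2 p = Q2 q \<and> Q3 p = Q3 q"
  by (cases p; cases q) simp

instantiation quat :: ab_group_add
begin
definition "0 = Quat 0 0 0 0"
definition "p + q = Quat (Q0 p + Q0 q) (Q1 p + Q1 q) (Q2 p + Q2 q) (Q3 p + Q3 q)"
definition "- p = Quat (- Q0 p) (- Q1 p) (- Q2 p) (- Q3 p)"
definition "p - q = Quat (Q0 p - Q0 q) (Q1 p - Q1 q) (Q2 p - Q2 q) (Q3 p - Q3 q)"
instance
  by standard
    (simp_all add: quat_eq_iff zero_quat_def plus_quat_def uminus_quat_def minus_quat_def)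
end

lemma quat_sel_group [simp]:
  "Q0 0 = 0" "Q1 0 = 0" "Q2 0 = 0" "Q3 0 = 0"
  "Q0 (p + q) = Q0 p + Q0 q" "Q1 (p + q) = Q1 p + Q1 q"
  "Q2 (p + q) = Q2 p + Q2 q" "Q3 (p + q) = Q3 p + Q3 q"
  "Q0 (- p) = - Q0 p" "Q1 (- p) = - Q1 p" "Q2 (- p) = - Q2 p" "Q3 (- p) = - Q3 p"
  "Q0 (p - q) = Q0 p - Q0 q" "Q1 (p - q) = Q1 p - Q1 q"
  "Q2 (p - q) = Q2 p - Q2 q" "Q3 (p - q) = Q3 p - Q3 q"
  by (simp_all add: zero_quat_def plus_quat_def uminus_quat_def minus_quat_def)

instantiation quat :: ring_1
begin
definition "1 = Quat 1 0 0 0"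
definition "p * q = Quat
  (Q0 p * Q0 q - Q1 p * Q1 q - Q2 p * Q2 q - Q3 p * Q3 q)
  (Q0 p * Q1 q + Q1 p * Q0 q + Q2 p * Q3 q - Q3 p * Q2 q)
  (Q0 p * Q2 q - Q1 p * Q3 q + Q2 p * Q0 q + Q3 p * Q1 q)
  (Q0 p * Q3 q + Q1 p * Q2 q - Q2 p * Q1 q + Q3 p * Q0 q)"
instance
  by standard
    (simp_all add: quat_eq_iff one_quat_def times_quat_def algebra_simps)
end

instantiation quat :: real_algebra_1
begin
definition "c *\<^sub>R q = Quat (c * Q0 q) (c * Q1 q) (c * Q2 q) (c * Q3 q)"
instance
  by standard
    (simp_all add: quat_eq_iff scaleR_quat_def times_quat_def algebra_simps)
end

instantiation quat :: real_inner
begin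
definition "inner p q = Q0 p * Q0 q + Q1 p * Q1 q + Q2 p * Q2 q + Q3 p * Q3 q"
definition norm_quat :: "quat \<Rightarrow> real" where "norm_quat p = sqrt (inner p p)"
definition sgn_quat :: "quat \<Rightarrow> quat" where "sgn_quat p = p /\<^sub>R norm p"
definition dist_quat :: "quat \<Rightarrow> quat \<Rightarrow> real" where "dist_quat p q = norm (p - q)"
definition uniformity_quat :: "(quat \<times> quat) filter"
  where "uniformity_quat = (INF e\<in>{0<..}. principal {(x, y). dist x y < e})"
definition open_quat :: "quat set \<Rightarrow> bool"
  where "open_quat U \<longleftrightarrow> (\<forall>x\<in>U. \<forall>\<^sub>F (x', y) in uniformity. x' = x \<longrightarrow> y \<in> U)"
instance
proof
  fix x y z :: quat and r :: real
  show "inner x y = inner y x" "inner (x + y) z = inner x z + inner y z"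
    "inner (r *\<^sub>R x) y = r * inner x y"
    by (simp_all add: inner_quat_def scaleR_quat_def algebra_simps)
  show nn: "0 \<le> inner x x"
    by (simp add: inner_quat_def)
  show "inner x x = 0 \<longleftrightarrow> x = 0"
  proof
    assume "inner x x = 0"
    then have "Q0 x * Q0 x + Q1 x * Q1 x + Q2 x * Q2 x + Q3 x * Q3 x = 0"
      by (simp add: inner_quat_def)
    then have "Q0 x * Q0 x = 0 \<and> Q1 x * Q1 x = 0 \<and> Q2 x * Q2 x = 0 \<and> Q3 x * Q3 x = 0"
      using zero_le_square[of "Q0 x"] zero_le_square[of "Q1 x"]
        zero_le_square[of "Q2 x"] zero_le_square[of "Q3 x"] by linarith
    then show "x = 0" by (simp add: quat_eq_iff)
  qed (simp add: inner_quat_def)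
qed (fact dist_quat_def sgn_quat_def uniformity_quat_def open_quat_def norm_quat_def)+
end

definition qcnj :: "quat \<Rightarrow> quat" where
  "qcnj q = Quat (Q0 q) (- Q1 q) (- Q2 q) (- Q3 q)"

text \<open>The three real division algebras are realised inside the quaternions, the complex numbers
  as the span of \<open>1\<close> and the first imaginary unit; the standard inner product of each of them is
  the restriction of the one above.\<close>

datatype divalg = RR | CC | HH

fun scalars :: "divalg \<Rightarrow> quat set" where
  "scalars RR = {q. Q1 q = 0 \<and> Q2 q = 0 \<and> Q3 q = 0}"
| "scalars CC = {q. Q2 q = 0 \<and> Q3 q = 0}"
| "scalars HH = UNIV"

section \<open>Square matrices of all sizes over the quaternions\<close>

text \<open>One type containing the matrix algebras of every size (padded by zeros), so that the size
  can vary with the index of a Wedderburn factor. It has no unit; its inner product is the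
  Frobenius inner product.\<close>

typedef fmat = "{f :: nat \<Rightarrow> nat \<Rightarrow> quat. \<exists>N. \<forall>i j. N \<le> i \<or> N \<le> j \<longrightarrow> f i j = 0}"
  morphisms ent Abs_fmat
  by (rule exI[of _ "\<lambda>_ _. 0"]) simp

lemma fmat_eqI: "(\<And>i j. ent X i j = ent Y i j) \<Longrightarrow> X = Y"
  by (metis ent_inject ext)

lemma fmat_eq_iff: "X = Y \<longleftrightarrow> (\<forall>i j. ent X i j = ent Y i j)"
  using fmat_eqI by blast

definition bnd :: "nat \<Rightarrow> fmat \<Rightarrow> bool" where
  "bnd N X \<longleftrightarrow> (\<forall>i j. N \<le> i \<or> N \<le> j \<longrightarrow> ent X i j = 0)"

lemma ex_bnd: "\<exists>N. bnd N X"
  using ent[of X] by (simp add: bnd_def)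

lemma bnd_mono: "bnd N X \<Longrightarrow> N \<le> M \<Longrightarrow> bnd M X"
  unfolding bnd_def by (meson le_trans)

lemma ex_bnd2: "\<exists>N. bnd N X \<and> bnd N Y"
  using ex_bnd[of X] ex_bnd[of Y] bnd_mono by (metis nle_le)

lemma ex_bnd3: "\<exists>N. bnd N X \<and> bnd N Y \<and> bnd N Z"
  using ex_bnd2[of X Y] ex_bnd[of Z] bnd_mono by (metis nle_le)

lemma ent_Abs: "(\<And>i j. N \<le> i \<or> N \<le> j \<Longrightarrow> f i j = 0) \<Longrightarrow> ent (Abs_fmat f) = f"
  by (rule Abs_fmat_inverse) blast

instantiation fmat :: ab_group_add
begin
definition "0 = Abs_fmat (\<lambda>i j. 0)"
definition "X + Y = Abs_fmat (\<lambda>i j. ent X i j + ent Y i j)"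
definition "- X = Abs_fmat (\<lambda>i j. - ent X i j)"
definition "X - Y = Abs_fmat (\<lambda>i j. ent X i j - ent Y i j)"

lemma ent_zero [simp]: "ent 0 i j = 0"
  unfolding zero_fmat_def by (subst ent_Abs[of 0]) auto

lemma ent_plus [simp]: "ent (X + Y) i j = ent X i j + ent Y i j"
proof -
  obtain N where "bnd N X" "bnd N Y" using ex_bnd2 by blast
  then show ?thesis unfolding plus_fmat_def by (subst ent_Abs[of N]) (auto simp: bnd_def)
qed

lemma ent_uminus [simp]: "ent (- X) i j = - ent X i j"
proof -
  obtain N where "bnd N X" using ex_bnd by blast
  then show ?thesis unfolding uminus_fmat_def by (subst ent_Abs[of N]) (auto simp: bnd_def)
qed

lemma ent_minus [simp]: "ent (X - Y) i j = ent X i j - ent Y i j"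
proof -
  obtain N where "bnd N X" "bnd N Y" using ex_bnd2 by blast
  then show ?thesis unfolding minus_fmat_def by (subst ent_Abs[of N]) (auto simp: bnd_def)
qed

instance by standard (auto intro!: fmat_eqI)
end

instantiation fmat :: real_algebra
begin
definition "c *\<^sub>R X = Abs_fmat (\<lambda>i j. c *\<^sub>R ent X i j)"
definition "X * Y = Abs_fmat (\<lambda>i j. \<Sum>k | ent X i k \<noteq> 0. ent X i k * ent Y k j)"

lemma ent_scaleR [simp]: "ent (c *\<^sub>R X) i j = c *\<^sub>R ent X i j"
proof -
  obtain N where "bnd N X" using ex_bnd by blast
  then show ?thesis unfolding scaleR_fmat_def by (subst ent_Abs[of N]) (auto simp: bnd_def)
qed

lemma ent_times:
  assumes "bnd N X"
  shows "ent (X * Y) i j = (\<Sum>k<N. ent X i k * ent Y k j)"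
proof -
  obtain M where M: "bnd M X" "bnd M Y" using ex_bnd2 by blast
  have "ent (X * Y) i j = (\<Sum>k | ent X i k \<noteq> 0. ent X i k * ent Y k j)"
    unfolding times_fmat_def
    by (subst ent_Abs[of M]) (use M in \<open>auto simp: bnd_def intro!: sum.neutral\<close>)
  also have "\<dots> = (\<Sum>k<N. ent X i k * ent Y k j)"
    by (rule sum.mono_neutral_left) (use assms in \<open>auto simp: bnd_def not_le[symmetric]\<close>)
  finally show ?thesis .
qed

lemma bnd_times: "bnd N X \<Longrightarrow> bnd N Y \<Longrightarrow> bnd N (X * Y)"
  by (auto simp: bnd_def ent_times[of N] intro!: sum.neutral)

instance
proof
  fix X Y Z :: fmat and c d :: real
  obtain N where N: "bnd N X" "bnd N Y" "bnd N Z" using ex_bnd3 by blast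
  have N': "bnd N (X + Y)" "bnd N (X * Y)" "bnd N (c *\<^sub>R X)"
    using N bnd_times by (auto simp: bnd_def)
  show "c *\<^sub>R (X + Y) = c *\<^sub>R X + c *\<^sub>R Y" "(c + d) *\<^sub>R X = c *\<^sub>R X + d *\<^sub>R X"
    "c *\<^sub>R d *\<^sub>R X = (c * d) *\<^sub>R X" "1 *\<^sub>R X = X"
    by (auto simp: fmat_eq_iff scaleR_add_right scaleR_add_left)
  show "(X + Y) * Z = X * Z + Y * Z" "X * (Y + Z) = X * Y + X * Z"
    "(c *\<^sub>R X) * Y = c *\<^sub>R (X * Y)" "X * (c *\<^sub>R Y) = c *\<^sub>R (X * Y)"
    using N N'
    by (auto simp: fmat_eq_iff ent_times[of N] distrib_left distrib_right sum.distrib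
        scaleR_sum_right)
  have "(\<Sum>k<N. (\<Sum>l<N. ent X i l * ent Y l k) * ent Z k j)
      = (\<Sum>l<N. ent X i l * (\<Sum>k<N. ent Y l k * ent Z k j))" for i j
    unfolding sum_distrib_left sum_distrib_right mult.assoc by (rule sum.swap)
  then show "X * Y * Z = X * (Y * Z)"
    using N N' by (auto simp: fmat_eq_iff ent_times[of N])
qed
end

instantiation fmat :: real_inner
begin
definition "inner X Y = (\<Sum>(i, j) | ent X i j \<noteq> 0. inner (ent X i j) (ent Y i j))"
definition norm_fmat :: "fmat \<Rightarrow> real" where "norm_fmat p = sqrt (inner p p)"
definition sgn_fmat :: "fmat \<Rightarrow> fmat" where "sgn_fmat p = p /\<^sub>R norm p"
definition dist_fmat :: "fmat \<Rightarrow> fmat \<Rightarrow> real" where "dist_fmat p q = norm (p - q)"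
definition uniformity_fmat :: "(fmat \<times> fmat) filter"
  where "uniformity_fmat = (INF e\<in>{0<..}. principal {(x, y). dist x y < e})"
definition open_fmat :: "fmat set \<Rightarrow> bool"
  where "open_fmat U \<longleftrightarrow> (\<forall>x\<in>U. \<forall>\<^sub>F (x', y) in uniformity. x' = x \<longrightarrow> y \<in> U)"

lemma inner_fmat:
  assumes "bnd N X"
  shows "inner X Y = (\<Sum>i<N. \<Sum>j<N. inner (ent X i j) (ent Y i j))"
proof -
  have "inner X Y = (\<Sum>(i, j)\<in>{..<N} \<times> {..<N}. inner (ent X i j) (ent Y i j))"
    unfolding inner_fmat_def
    by (rule sum.mono_neutral_left) (use assms in \<open>auto simp: bnd_def not_le[symmetric]\<close>)
  then show ?thesis by (simp add: sum.cartesian_product)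
qed

instance
proof
  fix X Y Z :: fmat and c :: real
  obtain N where N: "bnd N X" "bnd N Y" "bnd N Z" using ex_bnd3 by blast
  have N': "bnd N (X + Y)" "bnd N (c *\<^sub>R X)"
    using N by (auto simp: bnd_def)
  show "inner X Y = inner Y X"
    using N by (simp add: inner_fmat[of N] inner_commute)
  show "inner (X + Y) Z = inner X Z + inner Y Z"
    using N N' by (simp add: inner_fmat[of N] inner_add_left sum.distrib)
  show "inner (c *\<^sub>R X) Y = c * inner X Y"
    using N N' by (simp add: inner_fmat[of N] sum_distrib_left)
  show "0 \<le> inner X X"
    using N by (simp add: inner_fmat[of N] sum_nonneg)
  show "inner X X = 0 \<longleftrightarrow> X = 0"
  proof
    assume "inner X X = 0"
    then have "\<forall>i<N. \<forall>j<N. ent X i j = 0"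
      using N(1) by (simp add: inner_fmat[of N] sum_nonneg sum_nonneg_eq_0_iff)
    then have "ent X i j = 0" for i j
      using N(1) unfolding bnd_def by (cases "i < N \<and> j < N") auto
    then show "X = 0" by (simp add: fmat_eq_iff)
  qed (simp add: inner_fmat_def)
qed (fact dist_fmat_def sgn_fmat_def uniformity_fmat_def open_fmat_def norm_fmat_def)+
end

definition mk :: "nat \<Rightarrow> (nat \<Rightarrow> nat \<Rightarrow> quat) \<Rightarrow> fmat" where
  "mk n f = Abs_fmat (\<lambda>i j. if i < n \<and> j < n then f i j else 0)"

lemma ent_mk [simp]: "ent (mk n f) i j = (if i < n \<and> j < n then f i j else 0)"
  unfolding mk_def by (subst ent_Abs[of n]) auto

definition idm :: "nat \<Rightarrow> fmat" where
  "idm n = mk n (\<lambda>i j. if i = j then 1 else 0)"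

definition ctransp :: "fmat \<Rightarrow> fmat" where
  "ctransp X = Abs_fmat (\<lambda>i j. qcnj (ent X j i))"

lemma ent_ctransp [simp]: "ent (ctransp X) i j = qcnj (ent X j i)"
proof -
  obtain N where "bnd N X" using ex_bnd by blast
  then show ?thesis unfolding ctransp_def
    by (subst ent_Abs[of N]) (auto simp: bnd_def qcnj_def quat_eq_iff)
qed

text \<open>The algebra of \<open>n\<close> by \<open>n\<close> matrices over \<open>D\<close>; its unit is \<^term>\<open>idm n\<close>.\<close>

definition matalg :: "divalg \<Rightarrow> nat \<Rightarrow> fmat set" where
  "matalg D n = {X. bnd n X \<and> (\<forall>i j. ent X i j \<in> scalars D)}"

section \<open>Euclidean algebras\<close>

text \<open>An algebra is given by a carrier inside a type of class \<open>real_algebra\<close>, together with a unit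
  for that carrier; its Euclidean structure is the restriction of the inner product of the type.\<close>

definition findim :: "'a::real_vector set \<Rightarrow> bool" where
  "findim V \<longleftrightarrow> (\<exists>B. finite B \<and> V = span B)"

definition findim_algebra :: "'a::real_algebra set \<Rightarrow> 'a \<Rightarrow> bool" where
  "findim_algebra A e \<longleftrightarrow> findim A \<and> (\<forall>x\<in>A. \<forall>y\<in>A. x * y \<in> A) \<and>
     e \<in> A \<and> (\<forall>x\<in>A. e * x = x \<and> x * e = x)"

definition left_ideal :: "'a::real_algebra set \<Rightarrow> 'a set \<Rightarrow> bool" where
  "left_ideal A L \<longleftrightarrow> subspace L \<and> L \<subseteq> A \<and> (\<forall>a\<in>A. \<forall>x\<in>L. a * x \<in> L)"

definition semisimple_algebra :: "'a::real_algebra set \<Rightarrow> bool" where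
  "semisimple_algebra A \<longleftrightarrow> (\<forall>L. left_ideal A L \<longrightarrow>
     (\<exists>L'. left_ideal A L' \<and> L \<inter> L' = {0} \<and> A = {x + y | x y. x \<in> L \<and> y \<in> L'}))"

definition wedderburn_decomposition ::
  "'a::real_algebra set \<Rightarrow> 'a \<Rightarrow> 'r set \<Rightarrow> ('r \<Rightarrow> divalg) \<Rightarrow> ('r \<Rightarrow> nat) \<Rightarrow> ('a \<Rightarrow> 'r \<Rightarrow> fmat) \<Rightarrow> bool"
where
  "wedderburn_decomposition A e I D n \<phi> \<longleftrightarrow>
     finite I \<and> (\<forall>r\<in>I. 0 < n r) \<and>
     bij_betw \<phi> A (\<Pi>\<^sub>E r\<in>I. matalg (D r) (n r)) \<and>
     (\<forall>x\<in>A. \<forall>y\<in>A. \<forall>r\<in>I. \<phi> (x + y) r = \<phi> x r + \<phi> y r \<and> \<phi> (x * y) r = \<phi> x r * \<phi> y r) \<and>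
     (\<forall>c. \<forall>x\<in>A. \<forall>r\<in>I. \<phi> (c *\<^sub>R x) r = c *\<^sub>R \<phi> x r) \<and>
     (\<forall>r\<in>I. \<phi> e r = idm (n r))"

definition adapted :: "'a::real_inner set \<Rightarrow> 'r set \<Rightarrow> ('a \<Rightarrow> 'r \<Rightarrow> fmat) \<Rightarrow> bool" where
  "adapted A I \<phi> \<longleftrightarrow> (\<forall>x\<in>A. \<forall>y\<in>A. inner x y = (\<Sum>r\<in>I. inner (\<phi> x r) (\<phi> y r)))"

text \<open>The analogue for a carrier of \<^const>\<open>adjoint\<close>. Only its values on \<open>V\<close> are meaningful.\<close>

definition adjoint_on :: "'a::real_inner set \<Rightarrow> ('a \<Rightarrow> 'a) \<Rightarrow> 'a \<Rightarrow> 'a" where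
  "adjoint_on V f =
     (SOME g. (\<forall>x\<in>V. g x \<in> V) \<and> (\<forall>x\<in>V. \<forall>y\<in>V. inner (f x) y = inner x (g y)))"

definition lmul :: "'a::real_algebra \<Rightarrow> 'a \<Rightarrow> 'a" where
  "lmul a x = a * x"

definition Sq :: "'a::real_algebra set \<Rightarrow> 'a \<Rightarrow> 'a set" where
  "Sq A e = {a \<in> A. a * a = - e}"

definition S0 :: "'a::{real_algebra,real_inner} set \<Rightarrow> 'a \<Rightarrow> 'a set" where
  "S0 A e = {s \<in> Sq A e. \<forall>x\<in>A. lmul s (adjoint_on A (lmul s) x) = x}"

section \<open>Complexification\<close>

text \<open>The pair \<open>(a, b)\<close> with \<open>a, b \<in> A\<close> stands for the element \<open>1 \<otimes> a + \<i> \<otimes> b\<close> of the tensor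
  product of \<open>\<complex>\<close> and \<open>A\<close> over \<open>\<real>\<close>; every element is uniquely of this form.\<close>

fun cscale :: "complex \<Rightarrow> 'a::real_vector \<times> 'a \<Rightarrow> 'a \<times> 'a" where
  "cscale c (a, b) = (Re c *\<^sub>R a - Im c *\<^sub>R b, Re c *\<^sub>R b + Im c *\<^sub>R a)"

fun clmul :: "'a::real_algebra \<times> 'a \<Rightarrow> 'a \<times> 'a \<Rightarrow> 'a \<times> 'a" where
  "clmul (a, b) (x, y) = (a * x - b * y, a * y + b * x)"

text \<open>The \<open>\<complex>\<close>-bilinear (not sesquilinear) extension of the inner product.\<close>

fun cform :: "'a::real_inner \<times> 'a \<Rightarrow> 'a \<times> 'a \<Rightarrow> complex" where
  "cform (a, b) (x, y) = Complex (inner a x - inner b y) (inner a y + inner b x)"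

definition ctranspose_on ::
  "'a::real_inner set \<Rightarrow> ('a \<times> 'a \<Rightarrow> 'a \<times> 'a) \<Rightarrow> 'a \<times> 'a \<Rightarrow> 'a \<times> 'a" where
  "ctranspose_on A f =
     (SOME g. (\<forall>x\<in>A \<times> A. g x \<in> A \<times> A) \<and>
        (\<forall>x\<in>A \<times> A. \<forall>y\<in>A \<times> A. cform (f x) y = cform x (g y)))"

definition csubspace_of :: "('a::real_vector \<times> 'a) set \<Rightarrow> bool" where
  "csubspace_of W \<longleftrightarrow> 0 \<in> W \<and> (\<forall>x\<in>W. \<forall>y\<in>W. x + y \<in> W) \<and> (\<forall>c. \<forall>x\<in>W. cscale c x \<in> W)"

fun proj :: "'a::real_algebra \<times> 'a \<Rightarrow> 'a \<Rightarrow> 'a" where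
  "proj (a, b) s = a + s * b"

definition Z0 :: "'a::{real_algebra,real_inner} set \<Rightarrow> 'a \<Rightarrow> ('a \<times> 'a) set" where
  "Z0 A e = {w \<in> A \<times> A. \<exists>s\<in>S0 A e. proj w s = 0}"

definition calZ :: "'a::{real_algebra,real_inner} set \<Rightarrow> ('a \<times> 'a) set" where
  "calZ A = {w \<in> A \<times> A. \<forall>x\<in>A \<times> A. ctranspose_on A (clmul w) (clmul w x) = 0}"

definition calW :: "'a set \<Rightarrow> ('a \<Rightarrow> 'a) \<Rightarrow> ('a \<times> 'a) set" where
  "calW A f = {(v, f v) | v. v \<in> A}"

section \<open>Compact groups and homogeneous spaces\<close>

text \<open>\<open>O(n)\<close>, \<open>U(n)\<close> and \<open>Sp(n)\<close> for \<open>D\<close> equal to \<^const>\<open>RR\<close>, \<^const>\<open>CC\<close> and \<^const>\<open>HH\<close>.\<close>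

definition unitary_group :: "divalg \<Rightarrow> nat \<Rightarrow> fmat set" where
  "unitary_group D n = {X \<in> matalg D n. ctransp X * X = idm n \<and> X * ctransp X = idm n}"

text \<open>\<open>A + \<i>B\<close> is sent to the real block matrix with rows \<open>(A, -B)\<close> and \<open>(B, A)\<close>.\<close>

definition realify :: "nat \<Rightarrow> fmat \<Rightarrow> fmat" where
  "realify m X = mk (2 * m) (\<lambda>i j. let q = ent X (i mod m) (j mod m) in
     if (i < m) = (j < m) then of_real (Q0 q)
     else if i < m then of_real (- Q1 q) else of_real (Q1 q))"

definition block_diag :: "nat \<Rightarrow> nat \<Rightarrow> fmat \<Rightarrow> fmat \<Rightarrow> fmat" where
  "block_diag j k X Y = mk (j + k) (\<lambda>a b.
     if a < j \<and> b < j then ent X a b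
     else if j \<le> a \<and> j \<le> b then ent Y (a - j) (b - j) else 0)"

definition U_in_O :: "nat \<Rightarrow> fmat set" where
  "U_in_O m = realify m ` unitary_group CC m"

definition UxU :: "nat \<Rightarrow> nat \<Rightarrow> fmat set" where
  "UxU j k = {block_diag j k X Y | X Y. X \<in> unitary_group CC j \<and> Y \<in> unitary_group CC k}"

definition left_cosets :: "'a::times set \<Rightarrow> 'a set \<Rightarrow> 'a set set" where
  "left_cosets G K = (\<lambda>g. (*) g ` K) ` G"

text \<open>The quotient topology on the coset space.\<close>

definition coset_topology :: "'a::{times,topological_space} set \<Rightarrow> 'a set \<Rightarrow> 'a set topology" where
  "coset_topology G K = topology (\<lambda>U. U \<subseteq> left_cosets G K \<and>
     openin (top_of_set G) {g \<in> G. (*) g ` K \<in> U})"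

lemma openin_coset_topology:
  "openin (coset_topology G K) U \<longleftrightarrow>
     U \<subseteq> left_cosets G K \<and> openin (top_of_set G) {g \<in> G. (*) g ` K \<in> U}"
proof -
  have "istopology (\<lambda>U. U \<subseteq> left_cosets G K \<and> openin (top_of_set G) {g \<in> G. (*) g ` K \<in> U})"
    unfolding istopology_def
  proof (intro conjI allI impI)
    fix S T
    assume S: "S \<subseteq> left_cosets G K \<and> openin (top_of_set G) {g \<in> G. (*) g ` K \<in> S}"
      and T: "T \<subseteq> left_cosets G K \<and> openin (top_of_set G) {g \<in> G. (*) g ` K \<in> T}"
    show "S \<inter> T \<subseteq> left_cosets G K" using S by blast
    have "{g \<in> G. (*) g ` K \<in> S \<inter> T} = {g \<in> G. (*) g ` K \<in> S} \<inter> {g \<in> G. (*) g ` K \<in> T}"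
      by blast
    moreover have "openin (top_of_set G) ({g \<in> G. (*) g ` K \<in> S} \<inter> {g \<in> G. (*) g ` K \<in> T})"
      using S T by (intro openin_Int) auto
    ultimately show "openin (top_of_set G) {g \<in> G. (*) g ` K \<in> S \<inter> T}"
      by (simp only:)
  next
    fix \<K>
    assume K: "\<forall>S\<in>\<K>. S \<subseteq> left_cosets G K \<and> openin (top_of_set G) {g \<in> G. (*) g ` K \<in> S}"
    show "\<Union>\<K> \<subseteq> left_cosets G K" using K by blast
    have "{g \<in> G. (*) g ` K \<in> \<Union>\<K>} = \<Union>((\<lambda>S. {g \<in> G. (*) g ` K \<in> S}) ` \<K>)" by blast
    moreover have "openin (top_of_set G) (\<Union>((\<lambda>S. {g \<in> G. (*) g ` K \<in> S}) ` \<K>))"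
      using K by (intro openin_Union) auto
    ultimately show "openin (top_of_set G) {g \<in> G. (*) g ` K \<in> \<Union>\<K>}"
      by (simp only:)
  qed
  then show ?thesis by (simp add: coset_topology_def)
qed

lemma quotient_map_coset_topology:
  "quotient_map (top_of_set G) (coset_topology G K) (\<lambda>g. (*) g ` K)"
proof -
  have "topspace (coset_topology G K) = left_cosets G K"
  proof (rule subset_antisym)
    show "topspace (coset_topology G K) \<subseteq> left_cosets G K"
      using openin_topspace[of "coset_topology G K"] unfolding openin_coset_topology by (rule conjunct1)
    have "{g \<in> G. (*) g ` K \<in> left_cosets G K} = G" by (auto simp: left_cosets_def)
    then have "openin (coset_topology G K) (left_cosets G K)"
      by (simp add: openin_coset_topology)
    then show "left_cosets G K \<subseteq> topspace (coset_topology G K)" by (rule openin_subset)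
  qed
  then show ?thesis
    unfolding quotient_map_def topspace_subtopology by (simp add: openin_coset_topology left_cosets_def)
qed

text \<open>Identification of \<open>M\<close>, on which the group \<open>G\<close> of unitary matrices acts by conjugation, with
  the homogeneous space \<open>G/K\<close>: a \<open>G\<close>-equivariant homeomorphism.\<close>

definition identified_with :: "fmat set \<Rightarrow> fmat set \<Rightarrow> fmat set \<Rightarrow> bool" where
  "identified_with M G K \<longleftrightarrow> (\<exists>F. homeomorphic_map (coset_topology G K) (top_of_set M) F \<and>
     (\<forall>g\<in>G. \<forall>C\<in>left_cosets G K. F ((*) g ` C) = g * F C * ctransp g))"

section \<open>Hermitian symmetric spaces\<close>

text \<open>\<open>Ck_on k V U f\<close>: \<open>f\<close> is \<open>k\<close> times continuously differentiable on the open subset \<open>U\<close> of the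
  finite-dimensional subspace \<open>V\<close>, in terms of iterated directional derivatives.\<close>

primrec Ck_on :: "nat \<Rightarrow> 'e::real_normed_vector set \<Rightarrow> 'e set \<Rightarrow>
    ('e \<Rightarrow> 'f::real_normed_vector) \<Rightarrow> bool" where
  "Ck_on 0 V U f \<longleftrightarrow> continuous_on U f"
| "Ck_on (Suc k) V U f \<longleftrightarrow> continuous_on U f \<and>
     (\<forall>v\<in>V. \<exists>g. (\<forall>x\<in>U. ((\<lambda>t. f (x + t *\<^sub>R v)) has_vector_derivative g x) (at 0)) \<and>
        Ck_on k V U g)"

definition tangent_space :: "'e::real_normed_vector set \<Rightarrow> 'e \<Rightarrow> 'e set" where
  "tangent_space M p =
     {v. \<exists>c. c 0 = p \<and> (\<forall>t. c t \<in> M) \<and> (c has_vector_derivative v) (at (0::real))}"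

text \<open>A holomorphic parametrisation of an open piece of \<open>M\<close>, whose model is the complex vector
  space given by the real vector space \<open>V\<close> and the multiplication \<open>i\<close> by the imaginary unit. It is
  a smooth embedding into the ambient space whose differential intertwines \<open>i\<close> with \<open>J\<close>.\<close>

definition holomorphic_chart :: "'e::real_inner set \<Rightarrow> ('e \<Rightarrow> 'e \<Rightarrow> 'e) \<Rightarrow>
    'e set \<Rightarrow> ('e \<Rightarrow> 'e) \<Rightarrow> 'e set \<Rightarrow> ('e \<Rightarrow> 'e) \<Rightarrow> bool" where
  "holomorphic_chart M J V i U \<phi> \<longleftrightarrow>
     findim V \<and> i ` V \<subseteq> V \<and>
     (\<forall>u\<in>V. \<forall>v\<in>V. i (u + v) = i u + i v) \<and> (\<forall>c. \<forall>v\<in>V. i (c *\<^sub>R v) = c *\<^sub>R i v) \<and>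
     (\<forall>v\<in>V. i (i v) = - v) \<and>
     openin (top_of_set V) U \<and> (\<forall>k. Ck_on k V U \<phi>) \<and>
     openin (top_of_set M) (\<phi> ` U) \<and> (\<exists>\<psi>. homeomorphism U (\<phi> ` U) \<phi> \<psi>) \<and>
     (\<forall>x\<in>U. \<forall>v\<in>V. \<forall>d. ((\<lambda>t. \<phi> (x + t *\<^sub>R v)) has_vector_derivative d) (at 0) \<longrightarrow>
        (v \<noteq> 0 \<longrightarrow> d \<noteq> 0) \<and>
        ((\<lambda>t. \<phi> (x + t *\<^sub>R i v)) has_vector_derivative J (\<phi> x) d) (at 0))"

text \<open>\<open>J\<close> is an integrable almost complex structure on the embedded submanifold \<open>M\<close>; in particular
  the coordinate changes between holomorphic charts are holomorphic.\<close>

definition complex_submanifold :: "'e::real_inner set \<Rightarrow> ('e \<Rightarrow> 'e \<Rightarrow> 'e) \<Rightarrow> bool" where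
  "complex_submanifold M J \<longleftrightarrow>
     (\<forall>p\<in>M. \<exists>V i U \<phi>. holomorphic_chart M J V i U \<phi> \<and> p \<in> \<phi> ` U)"

definition holomorphic_isometry ::
  "'e::real_inner set \<Rightarrow> ('e \<Rightarrow> 'e \<Rightarrow> 'e) \<Rightarrow> ('e \<Rightarrow> 'e) \<Rightarrow> bool" where
  "holomorphic_isometry M J \<sigma> \<longleftrightarrow> bij_betw \<sigma> M M \<and>
     (\<forall>x\<in>M. \<exists>\<sigma>'. (\<sigma> has_derivative \<sigma>') (at x within M) \<and>
        (\<forall>u\<in>tangent_space M x. \<sigma>' (J x u) = J (\<sigma> x) (\<sigma>' u)) \<and>
        (\<forall>u\<in>tangent_space M x. \<forall>v\<in>tangent_space M x. inner (\<sigma>' u) (\<sigma>' v) = inner u v))"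

text \<open>A connected complex manifold with a Hermitian metric (here the Riemannian metric induced from
  the ambient inner product) in which every point is an isolated fixed point of an involutive
  holomorphic isometry.\<close>

definition hermitian_symmetric_space :: "'e::real_inner set \<Rightarrow> ('e \<Rightarrow> 'e \<Rightarrow> 'e) \<Rightarrow> bool" where
  "hermitian_symmetric_space M J \<longleftrightarrow>
     M \<noteq> {} \<and> connected M \<and> complex_submanifold M J \<and>
     (\<forall>p\<in>M. \<forall>u\<in>tangent_space M p. \<forall>v\<in>tangent_space M p. inner (J p u) (J p v) = inner u v) \<and>
     (\<forall>p\<in>M. \<exists>\<sigma>. holomorphic_isometry M J \<sigma> \<and> (\<forall>x\<in>M. \<sigma> (\<sigma> x) = x) \<and> \<sigma> p = p \<and>
        (\<exists>W. open W \<and> p \<in> W \<and> (\<forall>x\<in>W \<inter> M. \<sigma> x = x \<longrightarrow> x = p)))"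

definition compact_hermitian_symmetric_space :: "'e::real_inner set \<Rightarrow> bool" where
  "compact_hermitian_symmetric_space M \<longleftrightarrow> compact M \<and> (\<exists>J. hermitian_symmetric_space M J)"

end

theory Submission
  imports Defs
begin

text \<open>
  In \<open>M\<^sub>n(D)\<close> with conjugate transpose \<open>*\<close>, the set \<open>S\<^sub>0\<close> consists of the \<open>s\<close> with \<open>s\<^sup>* = - s\<close> and
  \<open>s\<^sup>2 = - 1\<close>. Around \<open>p\<close> it is parametrised by the Cayley chart \<open>x \<mapsto> (1 + x) p (1 + x)\<^sup>-\<^sup>1\<close>, where \<open>x\<close>
  is skew and anticommutes with \<open>p\<close>; the chart is holomorphic for the complex structures \<open>v \<mapsto> p v\<close> on
  its domain and \<open>u \<mapsto> s u\<close> on the tangent space at \<open>s\<close>. The symmetry at \<open>p\<close> is \<open>y \<mapsto> - p y p\<close>: if \<open>x\<close>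
  is fixed then \<open>d = x - p\<close> satisfies \<open>d\<^sup>2 = - 2 p d\<close>, so \<open>d = 0\<close> or \<open>d\<close> is not small. All of this
  restricts to connected components, and compactness leaves only finitely many of them.

  Transitivity of the unitary groups is obtained by building orthonormal frames column by column: if
  \<open>s\<^sup>2 = \<iota>\<^sup>2 = - 1\<close> then \<open>v - s v \<iota>\<close> intertwines \<open>s\<close> with \<open>\<iota>\<close>.

  If \<open>a\<^sup>* a = b\<^sup>* b\<close> and \<open>a\<^sup>* b + b\<^sup>* a = 0\<close>, then the polar part of \<open>b a\<^sup>* - a b\<^sup>*\<close> is a complex structure
  on the sum of the images of \<open>a\<close> and \<open>b\<close> that maps \<open>b\<close> to \<open>- a\<close>, and the frames extend it to an
  element of \<open>S\<^sub>0\<close>.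
\<close>

section \<open>Finite-dimensional subspaces\<close>

text \<open>\<open>fmat\<close> holds matrices of all sizes, so it is infinite-dimensional, has no
  unit and belongs to no finite-dimensional type class. Dimension counts, closedness and Heine-Borel
  are therefore proved for spans of finite sets, and every unit is the unit of a carrier only.
  Quaternionic eigenvalues are avoided: ranks are read off from inner products with the unit, and
  the inverse of a self-adjoint element on its support comes from its commutant.

  The three division algebras differ in whether the intertwiner \<open>v - s v \<iota>\<close> can
  vanish. Over the reals \<open>v\<close> and \<open>s v \<iota>\<close> sit in different columns,
  so it cannot, but frames grow by two columns and the size must be even. Over the quaternions a
  vanishing intertwiner is repaired by multiplying \<open>v\<close> by the unit j. Over the complex
  numbers there is no repair: i is central and the rank of the i-eigenspace of \<open>s\<close> is
  an invariant, which produces one Grassmannian for each rank; there projections take the place of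
  intertwiners.\<close>

lemma findim_subspace: "findim V \<Longrightarrow> subspace V"
  by (auto simp: findim_def)

lemma findim_subset:
  assumes "findim V" "subspace W" "W \<subseteq> V"
  shows "findim W"
proof -
  obtain T where T: "finite T" "V = span T" using assms(1) by (auto simp: findim_def)
  obtain C where C: "C \<subseteq> W" "independent C" "W \<subseteq> span C"
    by (rule real_vector.maximal_independent_subset)
  have "finite C" using real_vector.independent_span_bound[OF T(1) C(2)] C(1) assms(3) T(2) by blast
  moreover have "W = span C" using C assms(2) by (metis span_minimal subset_antisym)
  ultimately show ?thesis by (auto simp: findim_def)
qed

text \<open>A basis of \<open>V\<close> goes to an independent set of the same size; a vector of
  \<open>V\<close> outside its span would enlarge that set beyond what the dimension allows.\<close>

lemma findim_inj_imp_surj: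
  assumes V: "findim V" and f: "linear f" "f ` V \<subseteq> V" "\<And>x. x \<in> V \<Longrightarrow> f x = 0 \<Longrightarrow> x = 0"
  shows "f ` V = V"
proof -
  obtain T where T: "finite T" "V = span T" using V by (auto simp: findim_def)
  obtain C where C: "C \<subseteq> V" "independent C" "V \<subseteq> span C"
    by (rule real_vector.maximal_independent_subset)
  have VC: "V = span C" using C(1,3) T(2) by (metis span_minimal subset_antisym subspace_span)
  have inj: "inj_on f V"
    using linear_inj_on_iff_eq_0[OF f(1) findim_subspace[OF V]] f(3) by blast
  have finC: "finite C" using real_vector.independent_span_bound[OF T(1) C(2)] C(1) T(2) by blast
  have indf: "independent (f ` C)"
    using linear_independent_injective_image[OF f(1) C(2)] inj VC by blast
  have cardf: "card (f ` C) = card C"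
    using card_image inj C(1) inj_on_subset by blast
  have "y \<in> span (f ` C)" if "y \<in> V" for y
  proof (rule ccontr)
    assume y: "y \<notin> span (f ` C)"
    have "independent (insert y (f ` C))" using y indf by (rule real_vector.independent_insertI)
    moreover have "insert y (f ` C) \<subseteq> span C" using that C(1) f(2) VC by blast
    ultimately have "card (insert y (f ` C)) \<le> card C"
      using real_vector.independent_span_bound[OF finC] by blast
    moreover have "y \<notin> f ` C" using y span_base[of y "f ` C"] by metis
    ultimately show False using cardf finC by simp
  qed
  then show ?thesis using f(2) linear_span_image[OF f(1), of C] VC by blast
qed

text \<open>By induction this is the sum of a compact segment and a compact set.\<close>

lemma compact_bounded_combinations:
  fixes C :: "'a::real_normed_vector set"
  assumes "finite C"
  shows "compact {\<Sum>c\<in>C. k c *\<^sub>R c |k. \<forall>c\<in>C. \<bar>k c\<bar> \<le> (r c :: real)}"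
  using assms
proof (induction C)
  case empty
  then show ?case by simp
next
  case (insert b C)
  let ?K = "\<lambda>C. {\<Sum>c\<in>C. k c *\<^sub>R c |k. \<forall>c\<in>C. \<bar>k c\<bar> \<le> r c}"
  have "?K (insert b C) = {x + y |x y. x \<in> (\<lambda>t. t *\<^sub>R b) ` {- r b..r b} \<and> y \<in> ?K C}"
  proof (intro set_eqI iffI)
    fix z assume "z \<in> ?K (insert b C)"
    then obtain k where k: "\<forall>c\<in>insert b C. \<bar>k c\<bar> \<le> r c" "z = (\<Sum>c\<in>insert b C. k c *\<^sub>R c)" by blast
    then have "z = k b *\<^sub>R b + (\<Sum>c\<in>C. k c *\<^sub>R c)" "k b \<in> {- r b..r b}"
      using insert.hyps by (auto simp: abs_le_iff)
    then show "z \<in> {x + y |x y. x \<in> (\<lambda>t. t *\<^sub>R b) ` {- r b..r b} \<and> y \<in> ?K C}"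
      using k(1) by blast
  next
    fix z assume "z \<in> {x + y |x y. x \<in> (\<lambda>t. t *\<^sub>R b) ` {- r b..r b} \<and> y \<in> ?K C}"
    then obtain t k where tk: "t \<in> {- r b..r b}" "\<forall>c\<in>C. \<bar>k c\<bar> \<le> r c"
      "z = t *\<^sub>R b + (\<Sum>c\<in>C. k c *\<^sub>R c)" by blast
    have "(\<Sum>c\<in>C. (k(b := t)) c *\<^sub>R c) = (\<Sum>c\<in>C. k c *\<^sub>R c)"
      using insert.hyps by (intro sum.cong) auto
    then have "z = (\<Sum>c\<in>insert b C. (k(b := t)) c *\<^sub>R c)"
      using insert.hyps tk(3) by simp
    moreover have "\<forall>c\<in>insert b C. \<bar>(k(b := t)) c\<bar> \<le> r c" using tk(1,2) by auto
    ultimately show "z \<in> ?K (insert b C)" by blast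
  qed
  moreover have "compact ((\<lambda>t. t *\<^sub>R b) ` {- r b..r b})"
    by (intro compact_continuous_image continuous_intros) simp
  ultimately show ?case
    using compact_sums[OF _ insert.IH] by simp
qed

text \<open>Orthogonality makes the coordinates of \<open>x\<close> explicit inner products, hence
  continuous in \<open>x\<close>. The vectors are not normalised; zero is removed so that no
  denominator vanishes.\<close>

lemma findim_orthogonal_basis:
  fixes V :: "'a::real_inner set"
  assumes "findim V"
  obtains C where "finite C" "V = span C" "0 \<notin> C"
    "\<And>x. x \<in> V \<Longrightarrow> x = (\<Sum>c\<in>C. (inner c x / inner c c) *\<^sub>R c)"
proof -
  obtain T where T: "finite T" "V = span T" using assms by (auto simp: findim_def)
  obtain C0 where C0: "finite C0" "span C0 = V" "pairwise orthogonal C0"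
    using basis_orthogonal[OF T(1)] T(2) by blast
  define C where "C = C0 - {0}"
  have C: "finite C" "V = span C" "0 \<notin> C" "pairwise orthogonal C"
    using C0 by (auto simp: C_def pairwise_def)
  moreover have "x = (\<Sum>c\<in>C. (inner c x / inner c c) *\<^sub>R c)" if x: "x \<in> V" for x
  proof -
    obtain k where k: "x = (\<Sum>c\<in>C. k c *\<^sub>R c)"
      using x unfolding C(2) real_vector.span_finite[OF C(1)] by blast
    have "inner b x / inner b b = k b" if b: "b \<in> C" for b
    proof -
      have "inner b x = (\<Sum>c\<in>C. k c * inner b c)" by (simp add: k inner_sum_right)
      also have "\<dots> = (\<Sum>c\<in>C. if c = b then k b * inner b b else 0)"
        using b C(4) by (intro sum.cong) (auto simp: pairwise_def orthogonal_def)
      also have "\<dots> = k b * inner b b" using C(1) b by simp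
      finally show ?thesis using b C(3) by auto
    qed
    then show ?thesis by (subst k) (rule sum.cong, auto)
  qed
  ultimately show thesis using that by blast
qed

text \<open>\<open>V\<close> is the fixed-point set of its orthogonal projection, which is
  continuous.\<close>

lemma findim_closed:
  fixes V :: "'a::real_inner set"
  assumes "findim V"
  shows "closed V"
proof -
  obtain C where C: "finite C" "V = span C" "0 \<notin> C"
    "\<And>x. x \<in> V \<Longrightarrow> x = (\<Sum>c\<in>C. (inner c x / inner c c) *\<^sub>R c)"
    by (rule findim_orthogonal_basis[OF assms]) blast
  have "V = {x. x = (\<Sum>c\<in>C. (inner c x / inner c c) *\<^sub>R c)}"
  proof (intro subset_antisym subsetI CollectI)
    fix x assume "x \<in> {x. x = (\<Sum>c\<in>C. (inner c x / inner c c) *\<^sub>R c)}"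
    then show "x \<in> V" unfolding C(2) mem_Collect_eq
      by (metis (no_types, lifting) span_sum span_base span_scale)
  qed (use C(4) in blast)
  also have "closed \<dots>"
    by (intro closed_Collect_eq continuous_intros) (use C in auto)
  finally show ?thesis .
qed

text \<open>Heine-Borel inside \<open>V\<close>: by Cauchy-Schwarz a vector of norm at most
  \<open>R\<close> has a coordinate of size at most \<open>R / norm c\<close> along
  \<open>c\<close>.\<close>

lemma findim_compact_Int_cball:
  fixes V :: "'a::real_inner set"
  assumes "findim V"
  shows "compact (V \<inter> cball 0 R)"
proof -
  obtain C where C: "finite C" "V = span C" "0 \<notin> C"
    "\<And>x. x \<in> V \<Longrightarrow> x = (\<Sum>c\<in>C. (inner c x / inner c c) *\<^sub>R c)"
    by (rule findim_orthogonal_basis[OF assms]) blast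
  define K where "K = {\<Sum>c\<in>C. k c *\<^sub>R c |k. \<forall>c\<in>C. \<bar>k c\<bar> \<le> R / norm c}"
  have "compact K" unfolding K_def by (rule compact_bounded_combinations[OF C(1)])
  moreover have "closed (V \<inter> cball 0 R)" using findim_closed[OF assms] by auto
  moreover have "V \<inter> cball 0 R \<subseteq> K"
  proof
    fix x assume x: "x \<in> V \<inter> cball 0 R"
    have "\<bar>inner c x / inner c c\<bar> \<le> R / norm c" if "c \<in> C" for c
    proof -
      have c: "0 < norm c" using that C(3) by auto
      have "\<bar>inner c x\<bar> \<le> norm c * R"
        using Cauchy_Schwarz_ineq2[of c x] x c by (smt (verit) IntD2 mem_cball_0 mult_left_mono)
      then show ?thesis
        using c by (simp add: dot_square_norm power2_eq_square field_simps abs_divide)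
    qed
    then show "x \<in> K" unfolding K_def using C(4)[of x] x
      by (intro CollectI exI[of _ "\<lambda>c. inner c x / inner c c"] conjI) auto
  qed
  ultimately show ?thesis by (metis compact_Int_closed inf.absorb_iff2)
qed

section \<open>Euclidean star algebras\<close>

text \<open>\<open>adjoint_on\<close> is a choice: \<open>g\<close> shows that there is something to
  choose, and nondegeneracy of the inner product on \<open>V\<close> makes the value unique.\<close>

lemma adjoint_on_eqI:
  assumes V: "subspace V" and x: "x \<in> V"
    and g: "\<And>x. x \<in> V \<Longrightarrow> g x \<in> V" "\<And>x y. x \<in> V \<Longrightarrow> y \<in> V \<Longrightarrow> inner (f x) y = inner x (g y)"
  shows "adjoint_on V f x = g x"
proof -
  let ?P = "\<lambda>g. (\<forall>x\<in>V. g x \<in> V) \<and> (\<forall>x\<in>V. \<forall>y\<in>V. inner (f x) y = inner x (g y))"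
  have P: "?P (adjoint_on V f)"
    unfolding adjoint_on_def by (rule someI[of ?P g]) (use g in blast)
  let ?d = "adjoint_on V f x - g x"
  have "?d \<in> V" using P g(1) x V by (simp add: subspace_diff)
  then have "inner ?d ?d = 0" using P g(2) x by (metis inner_diff_right right_minus_eq)
  then show ?thesis by simp
qed

text \<open>As a rewrite rule this lets an equation for \<open>a * b\<close> apply inside a
  right-nested product.\<close>

lemma mult_eq_assoc: "a * b = c \<Longrightarrow> a * (b * z) = c * (z :: 'a::semigroup_mult)"
  by (simp add: mult.assoc[symmetric])

text \<open>The laws of \<open>star\<close> hold on the ambient type, whereas \<open>e\<close> is a
  unit for \<open>B\<close> only. The last two assumptions make \<open>star\<close> the adjoint for
  left and right multiplications, so the inner product with \<open>e\<close> behaves like a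
  trace.\<close>

locale star_algebra =
  fixes B :: "'a::{real_normed_algebra,real_inner} set" and e :: 'a and star :: "'a \<Rightarrow> 'a"
  assumes algebra: "findim_algebra B e"
    and star_add: "star (x + y) = star x + star y"
    and star_scaleR: "star (c *\<^sub>R x) = c *\<^sub>R star x"
    and star_star [simp]: "star (star x) = x"
    and star_mult: "star (x * y) = star y * star x"
    and star_closed: "x \<in> B \<Longrightarrow> star x \<in> B"
    and inner_mult_left: "inner (a * x) y = inner x (star a * y)"
    and inner_mult_right: "inner (x * a) y = inner x (y * star a)"
begin

lemma findim: "findim B" and mult_closed: "x \<in> B \<Longrightarrow> y \<in> B \<Longrightarrow> x * y \<in> B"
  and unit_closed: "e \<in> B"
  and unit [simp]: "x \<in> B \<Longrightarrow> e * x = x" "x \<in> B \<Longrightarrow> x * e = x"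
  using algebra by (auto simp: findim_algebra_def)

lemma closed_ops:
  "0 \<in> B" "x \<in> B \<Longrightarrow> y \<in> B \<Longrightarrow> x + y \<in> B" "x \<in> B \<Longrightarrow> y \<in> B \<Longrightarrow> x - y \<in> B"
  "x \<in> B \<Longrightarrow> - x \<in> B" "x \<in> B \<Longrightarrow> c *\<^sub>R x \<in> B"
  using findim_subspace[OF findim]
  by (simp_all add: subspace_0 subspace_add subspace_diff subspace_neg subspace_scale)

lemmas closed = closed_ops mult_closed unit_closed star_closed

lemma linear_star: "linear star"
  by (intro linearI) (simp_all add: star_add star_scaleR)

lemma star_ops: "star 0 = 0" "star (- x) = - star x" "star (x - y) = star x - star y"
  using linear_0[OF linear_star] linear_neg[OF linear_star] linear_diff[OF linear_star] by auto

lemma star_unit [simp]: "star e = e"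
proof -
  have "star (star e * e) = star e * e" by (simp add: star_mult)
  then show ?thesis using star_closed[OF unit_closed] by simp
qed

lemmas star_simps = star_ops star_add star_scaleR star_mult

lemma inner_unit: "x \<in> B \<Longrightarrow> inner e (star x * y) = inner x y"
  "x \<in> B \<Longrightarrow> inner e (y * star x) = inner x y"
  by (simp_all flip: inner_mult_left inner_mult_right)

lemma norm_star:
  assumes "x \<in> B"
  shows "norm (star x) = norm x"
proof -
  have "inner (star x) (star x) = inner e (x * star x)"
    using inner_unit(1)[of "star x" "star x"] assms closed by simp
  then show ?thesis using inner_unit(2)[of x x] assms by (simp add: norm_eq_sqrt_inner)
qed

lemma star_mult_eq_0: "x \<in> B \<Longrightarrow> star x * x = 0 \<Longrightarrow> x = 0"
  using inner_unit(1)[of x x] by simp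

text \<open>Pairing \<open>x * star x\<close> with \<open>e\<close> gives the squared norm of
  \<open>x\<close>, so the two summands cannot cancel.\<close>

lemma sum_mult_star_eq_0:
  assumes "x \<in> B" "y \<in> B" "x * star x + y * star y = 0"
  shows "x = 0" "y = 0"
proof -
  have "inner x x + inner y y = 0"
    using assms inner_unit(2)[of x x] inner_unit(2)[of y y]
      inner_add_right[of e "x * star x" "y * star y"] by simp
  then show "x = 0" "y = 0"
    using inner_ge_zero[of x] inner_ge_zero[of y]
    by (simp_all add: add_nonneg_eq_0_iff)
qed

lemma linear_mult_left: "linear (\<lambda>x. a * x)" for a :: 'a
  by (intro linearI) (simp_all add: algebra_simps)

lemma left_mult_surj:
  assumes "a \<in> B" "\<And>x. x \<in> B \<Longrightarrow> a * x = 0 \<Longrightarrow> x = 0" "y \<in> B"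
  obtains x where "x \<in> B" "a * x = y"
proof -
  have "(\<lambda>x. a * x) ` B = B"
    by (rule findim_inj_imp_surj[OF findim linear_mult_left]) (use assms closed in auto)
  then show thesis using assms(3) that by (metis imageE)
qed

lemma adjoint_lmul:
  assumes "a \<in> B" "x \<in> B"
  shows "adjoint_on B (lmul a) x = star a * x"
  by (rule adjoint_on_eqI[OF findim_subspace[OF findim]])
    (use assms closed in \<open>auto simp: lmul_def inner_mult_left\<close>)

text \<open>The condition on the adjoint makes \<open>star s\<close> a right inverse of
  \<open>s\<close>; but \<open>s * s = - e\<close> says that the inverse of \<open>s\<close> is
  \<open>- s\<close>.\<close>

lemma S0_iff: "s \<in> S0 B e \<longleftrightarrow> s \<in> B \<and> star s = - s \<and> s * s = - e"
proof
  assume "s \<in> S0 B e"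
  then have s: "s \<in> B" "s * s = - e" and *: "\<And>x. x \<in> B \<Longrightarrow> s * (star s * x) = x"
    by (auto simp: S0_def Sq_def adjoint_lmul) (simp add: lmul_def)
  have "s * star s = e" using *[of e] s closed by simp
  then have "s * (s * star s) = s" using s by simp
  then have "- star s = s" using s closed by (simp add: mult.assoc[symmetric])
  then show "s \<in> B \<and> star s = - s \<and> s * s = - e" using s by (metis minus_minus)
next
  assume s: "s \<in> B \<and> star s = - s \<and> s * s = - e"
  then have "s * (star s * x) = x" if "x \<in> B" for x
    using that by (simp add: mult.assoc[symmetric])
  then show "s \<in> S0 B e" using s by (auto simp: S0_def Sq_def adjoint_lmul lmul_def)
qed

text \<open>In this form a decomposition into factors can be checked one component at a
  time.\<close>

lemma S0_iff_unitary: "s \<in> S0 B e \<longleftrightarrow> s \<in> B \<and> s * s = - e \<and> s * star s = e"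
proof
  assume "s \<in> S0 B e"
  then show "s \<in> B \<and> s * s = - e \<and> s * star s = e" by (auto simp: S0_iff)
next
  assume s: "s \<in> B \<and> s * s = - e \<and> s * star s = e"
  then have "(s * s) * star s = s" by (metis mult.assoc unit(2))
  then have "- star s = s" using s closed by simp
  then show "s \<in> S0 B e" using s by (metis S0_iff minus_minus)
qed

text \<open>The pseudo-inverse is found in the bicommutant of \<open>h\<close>: on the commutative algebra \<open>h Z\<close>,
  multiplication by \<open>h\<close> is injective because a self-adjoint element of square zero vanishes.\<close>

lemma ex_pseudo_inverse:
  assumes h: "h \<in> B" "star h = h"
  obtains r where "r \<in> B" "star r = r" "h * r * h = h"
    "\<And>z. z \<in> B \<Longrightarrow> z * h = h * z \<Longrightarrow> z * r = r * z"
proof -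
  define Z where "Z = {y \<in> B. star y = y \<and> (\<forall>z\<in>B. z * h = h * z \<longrightarrow> z * y = y * z)}"
  let ?L = "\<lambda>x. h * x"
  have Zh: "h * y = y * h" if "y \<in> Z" for y using that h by (auto simp: Z_def)
  have hZ: "h * y \<in> Z" if "y \<in> Z" for y
  proof -
    have "z * (h * y) = h * y * z" if "z \<in> B" "z * h = h * z" for z
    proof -
      have "z * y = y * z" using \<open>y \<in> Z\<close> that by (auto simp: Z_def)
      then show ?thesis using that(2) by (metis mult.assoc)
    qed
    moreover have "star (h * y) = h * y"
      using that h Zh[OF that] by (auto simp: star_mult Z_def)
    moreover have "h * y \<in> B" using that h closed by (auto simp: Z_def)
    ultimately show ?thesis unfolding Z_def by simp
  qed
  have eZ: "e \<in> Z" using closed by (auto simp: Z_def)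
  have "subspace Z"
    unfolding subspace_def Z_def using closed by (auto simp: star_simps algebra_simps)
  then have "subspace (?L ` Z)" by (intro linear_subspace_image linear_mult_left)
  moreover have "?L ` Z \<subseteq> B" using h closed by (auto simp: Z_def)
  ultimately have "findim (?L ` Z)" using findim findim_subset by blast
  moreover have "c = 0" if c: "c \<in> ?L ` Z" "h * c = 0" for c
  proof -
    obtain y where y: "y \<in> Z" "c = h * y" using c by blast
    have "c * c = y * (h * c)" using Zh[OF y(1)] y(2) by (simp add: mult.assoc)
    then have "star c * c = 0" using hZ[OF y(1)] y(2) c(2) by (simp add: Z_def)
    then show ?thesis using star_mult_eq_0 hZ[OF y(1)] y(2) by (auto simp: Z_def)
  qed
  \<comment> \<open>Being injective on the finite-dimensional space \<open>h Z\<close>,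
    multiplication by \<open>h\<close> maps it onto itself. As \<open>h = h * e\<close> lies in it,
    \<open>h = h * (h * r)\<close> for some \<open>r\<close> in \<open>Z\<close>.\<close>
  ultimately have "?L ` (?L ` Z) = ?L ` Z"
    by (intro findim_inj_imp_surj linear_mult_left) (use hZ in auto)
  moreover have "h \<in> ?L ` Z" using eZ h by (metis image_iff unit(2))
  ultimately obtain r where r: "r \<in> Z" "h = h * (h * r)" by (metis (no_types, lifting) imageE)
  have "h * r * h = h" using r Zh[OF r(1)] by (metis mult.assoc)
  then show thesis using r(1) that[of r] by (auto simp: Z_def)
qed

text \<open>The partial complex structure is the polar part of \<open>b a\<^sup>* - a b\<^sup>*\<close>, whose square is
  \<open>- (a a\<^sup>* + b b\<^sup>*)\<^sup>2\<close>.\<close>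

lemma ex_partial_complex_structure:
  assumes ab: "a \<in> B" "b \<in> B" and eq: "star a * a = star b * b" "star a * b + star b * a = 0"
  obtains t where "t \<in> B" "star t = - t" "t * (t * t) = - t" "t * a = b" "t * b = - a"
proof -
  define h where "h = a * star a + b * star b"
  define q where "q = b * star a - a * star b"
  have eq2: "star b * a = - (star a * b)" using eq(2) by (simp add: eq_neg_iff_add_eq_0 add.commute)
  note eqs = eq(1)[symmetric] eq(1)[symmetric, THEN mult_eq_assoc] eq2 eq2[THEN mult_eq_assoc]
  have mem: "h \<in> B" "q \<in> B" using ab closed by (auto simp: h_def q_def)
  have sh: "star h = h" and sq: "star q = - q" by (simp_all add: h_def q_def star_simps)
  have qh: "q * h = h * q"
    by (simp add: h_def q_def algebra_simps eqs)
  have qq: "q * q = - (h * h)"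
    by (simp add: h_def q_def algebra_simps eqs)
  have qa: "q * a = h * b" "q * b = - (h * a)"
    by (simp_all add: h_def q_def algebra_simps eqs)
  obtain r where r: "r \<in> B" "star r = r" "h * r * h = h"
    "\<And>z. z \<in> B \<Longrightarrow> z * h = h * z \<Longrightarrow> z * r = r * z"
    using ex_pseudo_inverse[OF mem(1) sh] by blast
  have comm: "q * r = r * q" "h * r = r * h" using r(4) mem qh by auto
  have hrh: "h * (r * h) = h" "r * (h * h) = h"
    using r(3) comm by (simp_all add: mult.assoc[symmetric])
  \<comment> \<open>The support projection of \<open>h\<close>.\<close>
  define P where "P = r * h"
  have P: "P \<in> B" "star P = P" "P * h = h" "h * P = h"
    using r mem sh closed comm hrh by (auto simp: P_def star_mult mult.assoc)
  \<comment> \<open>Because \<open>star q * q = h * h\<close>, the part of \<open>q\<close> outside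
    the support of \<open>h\<close> has Gram element zero.\<close>
  have "q - q * P = 0"
  proof (rule star_mult_eq_0)
    have "star (q - q * P) * (q - q * P) = - (q - P * q) * (q - q * P)"
      using P sq by (simp add: star_simps)
    also have "\<dots> = 0"
      using qq P qq[THEN mult_eq_assoc] P(3)[THEN mult_eq_assoc]
      by (simp add: algebra_simps)
    finally show "star (q - q * P) * (q - q * P) = 0" .
  qed (use mem P closed in auto)
  then have qP: "q * P = q" by simp
  \<comment> \<open>Since \<open>h = a * star a + b * star b\<close>, the two defects add up to
    \<open>h\<close> compressed to the complement of \<open>P\<close>, which is zero; positivity
    separates them.\<close>
  have Pb: "b - P * b = 0" "a - P * a = 0"
  proof -
    have "(b - P * b) * star (b - P * b) + (a - P * a) * star (a - P * a)
        = h - P * h - h * P + P * (h * P)"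
      using P(2) by (simp add: h_def star_simps algebra_simps)
    also have "\<dots> = 0" using P by simp
    finally have *: "(b - P * b) * star (b - P * b) + (a - P * a) * star (a - P * a) = 0" .
    show "b - P * b = 0" "a - P * a = 0"
      by (rule sum_mult_star_eq_0[OF _ _ *]; simp add: P ab closed)+
  qed
  \<comment> \<open>As \<open>star q * q = h * h\<close>, the absolute value of \<open>q\<close> is
    \<open>h\<close>, and multiplying by its pseudo-inverse \<open>r\<close> gives the polar
    part.\<close>
  define t where "t = r * q"
  have "t * a = r * (h * b)" "t * b = - (r * (h * a))"
    using qa by (simp_all add: t_def mult.assoc)
  then have ta: "t * a = b" "t * b = - a" using Pb by (simp_all add: P_def mult.assoc)
  have "t * t = - P"
  proof -
    have "t * t = r * (q * (q * r))" using comm by (simp add: t_def mult.assoc)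
    also have "\<dots> = - (r * (h * (h * r)))" using qq by (simp add: mult.assoc[symmetric])
    also have "h * (h * r) = h" using comm hrh by (simp add: mult.assoc[symmetric])
    finally show ?thesis by (simp add: P_def)
  qed
  then have "t * (t * t) = - (r * (q * P))" by (simp add: t_def mult.assoc)
  then have "t * (t * t) = - t" using qP by (simp add: t_def)
  moreover have "t \<in> B" "star t = - t"
    using r mem closed sq comm by (auto simp: t_def star_simps)
  ultimately show thesis using that ta by blast
qed

end

section \<open>Cayley charts\<close>

text \<open>Caratheodory's form of differentiability: the difference quotient extends continuously
  to \<open>0\<close>.\<close>

lemma has_vector_derivative_at_0I:
  fixes f :: "real \<Rightarrow> 'a::real_normed_vector"
  assumes "\<And>t. f t = f 0 + t *\<^sub>R k t" "isCont k 0"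
  shows "(f has_vector_derivative k 0) (at 0)"
proof -
  have "(\<lambda>h. norm (k h - k 0)) \<midarrow>0\<rightarrow> 0"
    using assms(2) by (simp add: isCont_def tendsto_norm_zero_iff LIM_zero_iff)
  moreover have "norm (f h - f 0 - h *\<^sub>R k 0) / norm h = norm (k h - k 0)" if "h \<noteq> 0" for h
  proof -
    have "f h - f 0 - h *\<^sub>R k 0 = h *\<^sub>R (k h - k 0)"
      by (subst assms(1)) (simp add: algebra_simps)
    then show ?thesis using that by simp
  qed
  ultimately have "(\<lambda>h. norm (f h - f 0 - h *\<^sub>R k 0) / norm h) \<midarrow>0\<rightarrow> 0"
    by (auto simp: LIM_def)
  then show ?thesis
    unfolding has_vector_derivative_def has_derivative_at
    by (simp add: bounded_linear_scaleR_left)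
qed

text \<open>Submultiplicativity turns the first bound into
  \<open>2 * norm d \<le> norm d * norm d\<close>. This isolates the fixed point of a
  symmetry.\<close>

lemma eq_0_if_norm_square_ge:
  fixes d :: "'a::real_normed_algebra"
  assumes "2 * norm d \<le> norm (d * d)" "norm d < 2"
  shows "d = 0"
proof (rule ccontr)
  assume "d \<noteq> 0"
  then have "norm d * norm d < 2 * norm d" using assms(2) by simp
  then show False using assms(1) norm_mult_ineq[of d d] by linarith
qed

context star_algebra
begin

lemma inverse_unique:
  assumes "a \<in> B" "g \<in> B" "g' \<in> B" "g * a = e" "a * g' = e"
  shows "g = g'"
proof -
  have "g * (a * g') = g * a * g'" by (simp add: mult.assoc)
  then show ?thesis using assms by simp
qed

text \<open>The identity \<open>g s' - g s = g s' * (f s - f s') * g s\<close> bounds the change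
  \<open>D\<close> of the inverse by \<open>(n + D) * E * n\<close>, where \<open>E\<close> is the
  change of \<open>f\<close>.\<close>

lemma continuous_on_inverse:
  fixes f g :: "'x::metric_space \<Rightarrow> 'a"
  assumes f: "continuous_on Q f"
    and B: "\<And>s. s \<in> Q \<Longrightarrow> f s \<in> B \<and> g s \<in> B"
    and inv: "\<And>s. s \<in> Q \<Longrightarrow> f s * g s = e" "\<And>s. s \<in> Q \<Longrightarrow> g s * f s = e"
  shows "continuous_on Q g"
  unfolding continuous_on_iff
proof (intro ballI allI impI)
  fix s and \<epsilon> :: real assume s: "s \<in> Q" and \<epsilon>: "0 < \<epsilon>"
  define n where "n = norm (g s)"
  have n: "0 \<le> n" by (simp add: n_def)
  \<comment> \<open>The first term forces \<open>E * n \<le> 1 / 2\<close>, so that the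
    \<open>D\<close> on the right of the estimate can be absorbed; the second makes what remains
    smaller than \<epsilon>. Adding 1 to \<open>n\<close> keeps the denominators positive.\<close>
  define \<eta> where "\<eta> = min (1 / (2 * (n + 1))) (\<epsilon> / (2 * (n + 1)\<^sup>2))"
  have \<eta>: "0 < \<eta>" using n \<epsilon> by (simp add: \<eta>_def)
  obtain \<delta> where \<delta>: "\<delta> > 0" "\<And>s'. s' \<in> Q \<Longrightarrow> dist s' s < \<delta> \<Longrightarrow> dist (f s') (f s) < \<eta>"
    using f s \<eta> unfolding continuous_on_iff by blast
  have "dist (g s') (g s) < \<epsilon>" if s': "s' \<in> Q" "dist s' s < \<delta>" for s'
  proof -
    define E where "E = norm (f s - f s')"
    define D where "D = norm (g s' - g s)"
    have E: "0 \<le> E" "E < \<eta>" using \<delta>(2)[OF s'] by (simp_all add: E_def dist_norm norm_minus_commute)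
    have D: "0 \<le> D" by (simp add: D_def)
    have "g s' * (f s - f s') * g s = g s' * (f s * g s) - g s' * f s' * g s"
      by (simp add: algebra_simps)
    then have "g s' - g s = g s' * (f s - f s') * g s"
      using B s s' inv by simp
    then have "D \<le> norm (g s') * E * n"
      unfolding D_def E_def n_def
      by (simp only: order_trans[OF norm_mult_ineq mult_right_mono[OF norm_mult_ineq norm_ge_zero]])
    also have "\<dots> \<le> (n + D) * E * n"
      using E n norm_triangle_sub[of "g s'" "g s"]
      by (intro mult_right_mono) (auto simp: n_def D_def)
    finally have *: "D \<le> (n + D) * E * n" .
    have En: "E * (n + 1) \<le> 1 / 2"
    proof -
      have "E \<le> 1 / (2 * (n + 1))" using E by (simp add: \<eta>_def)
      then show ?thesis using n by (simp add: field_simps)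
    qed
    have "E * n \<le> 1 / 2" using En E by (simp add: algebra_simps)
    then have "D * (E * n) \<le> D * (1 / 2)" using D by (rule mult_left_mono)
    with * have "D \<le> 2 * (n * n * E)" by (simp add: algebra_simps)
    also have "\<dots> \<le> 2 * ((n + 1)\<^sup>2 * E)"
      using n E by (intro mult_left_mono mult_right_mono) (auto simp: power2_eq_square algebra_simps)
    also have "\<dots> < 2 * ((n + 1)\<^sup>2 * \<eta>)"
      using n E by (intro mult_strict_left_mono) auto
    also have "\<dots> \<le> 2 * ((n + 1)\<^sup>2 * (\<epsilon> / (2 * (n + 1)\<^sup>2)))"
      using n by (intro mult_left_mono) (auto simp: \<eta>_def)
    also have "\<dots> = \<epsilon>" using n by (simp add: field_simps)
    finally show ?thesis by (simp add: D_def dist_norm)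
  qed
  then show "\<exists>\<delta>>0. \<forall>s'\<in>Q. dist s' s < \<delta> \<longrightarrow> dist (g s') (g s) < \<epsilon>"
    using \<delta>(1) by blast
qed

section \<open>Skew elements and their resolvents\<close>

definition skew :: "'a set" where
  "skew = {x \<in> B. star x = - x}"

lemma subspace_skew: "subspace skew"
  unfolding subspace_def skew_def using closed by (auto simp: star_simps)

lemma skew_line: "x \<in> skew \<Longrightarrow> v \<in> skew \<Longrightarrow> x + t *\<^sub>R v \<in> skew"
  using subspace_skew by (simp add: subspace_add subspace_scale)

text \<open>Skewness gives \<open>inner (x * z) z = 0\<close>, whereas \<open>x * z = - z\<close>
  would make this minus the squared norm of \<open>z\<close>.\<close>

lemma unit_plus_skew_inj:
  assumes x: "x \<in> skew" and z: "z \<in> B" "(e + x) * z = 0"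
  shows "z = 0"
proof -
  have "x * z = - z" using z by (simp add: algebra_simps eq_neg_iff_add_eq_0)
  moreover have "inner (x * z) z = - inner z (x * z)"
    using x inner_mult_left[of x z z] by (simp add: skew_def)
  ultimately show ?thesis by simp
qed

text \<open>Injectivity yields a right inverse by finite dimension; used once more, it makes that a
  left inverse.\<close>

lemma ex_resolvent:
  assumes x: "x \<in> skew"
  shows "\<exists>g. g \<in> B \<and> (e + x) * g = e \<and> g * (e + x) = e"
proof -
  have ex: "e + x \<in> B" using x closed by (simp add: skew_def)
  obtain g where g: "g \<in> B" "(e + x) * g = e"
    using left_mult_surj[OF ex unit_plus_skew_inj[OF x] unit_closed] by blast
  have "(e + x) * (g * (e + x) - e) = ((e + x) * g) * (e + x) - (e + x) * e"
    by (simp only: right_diff_distrib mult.assoc)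
  also have "\<dots> = 0" using g ex by simp
  finally have "g * (e + x) - e = 0"
    using unit_plus_skew_inj[OF x, of "g * (e + x) - e"] g ex closed by simp
  then show ?thesis using g by auto
qed

text \<open>The resolvent exists at every skew element, so the Cayley charts are defined on whole
  linear spaces.\<close>

definition res :: "'a \<Rightarrow> 'a" where
  "res x = (SOME g. g \<in> B \<and> (e + x) * g = e \<and> g * (e + x) = e)"

lemma res:
  assumes "x \<in> skew"
  shows "res x \<in> B" "(e + x) * res x = e" "res x * (e + x) = e"
  using someI_ex[OF ex_resolvent[OF assms]] by (auto simp: res_def)

lemma continuous_on_res: "continuous_on skew res"
proof (rule continuous_on_inverse[where f = "\<lambda>x. e + x"])
  show "continuous_on skew (\<lambda>x. e + x)" by (intro continuous_intros)
qed (use closed in \<open>auto simp: res skew_def\<close>)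

lemma continuous_on_res_line:
  assumes "x \<in> skew" "v \<in> skew"
  shows "continuous_on UNIV (\<lambda>t. res (x + t *\<^sub>R v))"
proof (rule continuous_on_compose2[OF continuous_on_res])
  show "continuous_on UNIV (\<lambda>t. x + t *\<^sub>R v)" by (intro continuous_intros)
qed (use skew_line assms in auto)

text \<open>The resolvent identity factors \<open>t\<close> out exactly, as
  \<open>has_vector_derivative_at_0I\<close> asks.\<close>

lemma has_vector_derivative_res:
  assumes x: "x \<in> skew" and v: "v \<in> skew"
  shows "((\<lambda>t. res (x + t *\<^sub>R v)) has_vector_derivative - (res x * v * res x)) (at 0)"
proof -
  define k where "k = (\<lambda>t. - (res (x + t *\<^sub>R v) * v * res x))"
  have "continuous_on UNIV k"
    unfolding k_def by (intro continuous_intros continuous_on_res_line x v)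
  then have "isCont k 0" by (simp add: continuous_on_eq_continuous_at)
  moreover have "res (x + t *\<^sub>R v) = res (x + 0 *\<^sub>R v) + t *\<^sub>R k t" for t
  proof -
    let ?g = "res (x + t *\<^sub>R v)"
    note rt = res[OF skew_line[OF x v, of t]] and r0 = res[OF x]
    have "?g * (t *\<^sub>R v) * res x = ?g * ((e + (x + t *\<^sub>R v)) - (e + x)) * res x" by simp
    also have "\<dots> = ?g * (e + (x + t *\<^sub>R v)) * res x - ?g * ((e + x) * res x)"
      by (simp only: right_diff_distrib left_diff_distrib mult.assoc)
    also have "\<dots> = res x - ?g" using rt r0 by simp
    finally show ?thesis by (simp add: k_def algebra_simps)
  qed
  ultimately have "((\<lambda>t. res (x + t *\<^sub>R v)) has_vector_derivative k 0) (at 0)"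
    by (intro has_vector_derivative_at_0I)
  then show ?thesis by (simp add: k_def)
qed

text \<open>A class that contains the charts and is closed under directional derivatives, so that
  smoothness follows by induction on the order.\<close>

inductive rational_map :: "('a \<Rightarrow> 'a) \<Rightarrow> bool" where
  "rational_map (\<lambda>_. c)"
| "rational_map res"
| "rational_map f \<Longrightarrow> rational_map g \<Longrightarrow> rational_map (\<lambda>x. f x + g x)"
| "rational_map f \<Longrightarrow> rational_map g \<Longrightarrow> rational_map (\<lambda>x. f x * g x)"

lemma continuous_on_rational_map: "rational_map f \<Longrightarrow> continuous_on skew f"
  by (induction rule: rational_map.induct) (auto intro!: continuous_intros continuous_on_res)

lemma rational_map_derivative:
  assumes "rational_map f" and v: "v \<in> skew"
  shows "\<exists>g. rational_map g \<and>
    (\<forall>x\<in>skew. ((\<lambda>t. f (x + t *\<^sub>R v)) has_vector_derivative g x) (at 0))"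
  using assms(1)
proof (induction rule: rational_map.induct)
  case (1 c)
  show ?case by (rule exI[of _ "\<lambda>_. 0"]) (auto intro: rational_map.intros)
next
  case 2
  \<comment> \<open>There is no rule for negation, so the sign enters as the constant factor
    \<open>- e\<close>.\<close>
  have "rational_map (\<lambda>x. (- e) * (res x * v * res x))"
    by (intro rational_map.intros)
  moreover have "(- e) * (res x * v * res x) = - (res x * v * res x)" if "x \<in> skew" for x
    using res(1)[OF that] v closed by (simp add: skew_def)
  ultimately show ?case
    using has_vector_derivative_res[OF _ v]
    by (intro exI[of _ "\<lambda>x. (- e) * (res x * v * res x)"]) auto
next
  case (3 f g)
  then obtain f' g' where h: "rational_map f'" "rational_map g'"
    "\<And>x. x \<in> skew \<Longrightarrow> ((\<lambda>t. f (x + t *\<^sub>R v)) has_vector_derivative f' x) (at 0)"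
    "\<And>x. x \<in> skew \<Longrightarrow> ((\<lambda>t. g (x + t *\<^sub>R v)) has_vector_derivative g' x) (at 0)" by blast
  show ?case
    by (rule exI[of _ "\<lambda>x. f' x + g' x"])
      (use h in \<open>auto intro: rational_map.intros has_vector_derivative_add\<close>)
next
  case (4 f g)
  then obtain f' g' where h: "rational_map f'" "rational_map g'"
    "\<And>x. x \<in> skew \<Longrightarrow> ((\<lambda>t. f (x + t *\<^sub>R v)) has_vector_derivative f' x) (at 0)"
    "\<And>x. x \<in> skew \<Longrightarrow> ((\<lambda>t. g (x + t *\<^sub>R v)) has_vector_derivative g' x) (at 0)" by blast
  have "((\<lambda>t. f (x + t *\<^sub>R v) * g (x + t *\<^sub>R v)) has_vector_derivative
      (f x * g' x + f' x * g x)) (at 0)" if "x \<in> skew" for x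
    using has_vector_derivative_mult[OF h(3,4)[OF that]] by simp
  then show ?case
    by (intro exI[of _ "\<lambda>x. f x * g' x + f' x * g x"])
      (use h 4 in \<open>auto intro!: rational_map.intros\<close>)
qed

lemma Ck_on_rational_map:
  assumes "rational_map f" "V \<subseteq> skew" "U \<subseteq> skew"
  shows "Ck_on k V U f"
  using assms(1)
proof (induction k arbitrary: f)
  case 0
  then show ?case using continuous_on_subset[OF continuous_on_rational_map assms(3)] by simp
next
  case (Suc k)
  have "\<exists>g. (\<forall>x\<in>U. ((\<lambda>t. f (x + t *\<^sub>R v)) has_vector_derivative g x) (at 0)) \<and> Ck_on k V U g"
    if "v \<in> V" for v
    using rational_map_derivative[OF Suc.prems, of v] Suc.IH that assms(2,3) by blast
  moreover have "continuous_on U f"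
    using continuous_on_rational_map[OF Suc.prems] assms(3) continuous_on_subset by blast
  ultimately show ?case by simp
qed

text \<open>Inside \<open>skew\<close>, viewed as the Lie algebra of the unitary group, this is the
  complement of the elements commuting with \<open>p\<close>. It is also the linearisation of
  \<open>s * s = - e\<close> at \<open>p\<close>.\<close>

definition tangent :: "'a \<Rightarrow> 'a set" where
  "tangent p = {x \<in> skew. p * x = - (x * p)}"

text \<open>Equal to \<open>(e + x) p (e + x)\<^sup>-\<^sup>1\<close>, as \<open>p\<close> anticommutes with \<open>x\<close>.\<close>

definition cayley :: "'a \<Rightarrow> 'a \<Rightarrow> 'a" where
  "cayley p x = 2 *\<^sub>R (p * res x) - p"

section \<open>Cayley charts as holomorphic parametrisations\<close>

lemma S0_facts:
  assumes "p \<in> S0 B e"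
  shows "p \<in> B" "star p = - p" "p * p = - e" "z \<in> B \<Longrightarrow> p * (p * z) = - z"
  using assms by (auto simp: S0_iff mult.assoc[symmetric])

lemma subspace_tangent: "subspace (tangent p)"
  using subspace_skew unfolding subspace_def tangent_def by (auto simp: algebra_simps)

text \<open>Moving \<open>p\<close> past \<open>e + x\<close> gives \<open>e - x\<close>, the star
  of \<open>e + x\<close>; hence \<open>p\<close> exchanges \<open>res x\<close> with its star. The
  last equation is the partial fraction identity 1/(1-x) + 1/(1+x) = 2/((1-x)(1+x)).\<close>

lemma res_relations:
  assumes p: "p \<in> S0 B e" and x: "x \<in> tangent p"
  shows "star (res x) * (e - x) = e" "(e - x) * star (res x) = e"
    "star (res x) * p = p * res x" "res x * p = p * star (res x)"
    "star (res x) + res x = 2 *\<^sub>R (star (res x) * res x)"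
proof -
  define r where "r = res x"
  have xs: "x \<in> skew" "x \<in> B" "star x = - x" "p * x = - (x * p)"
    using x by (auto simp: tangent_def skew_def)
  note r = res[OF xs(1), folded r_def] and p = S0_facts[OF p]
  have ex: "e + x \<in> B" "e - x \<in> B" using xs closed by auto
  have "star ((e + x) * r) = e" "star (r * (e + x)) = e" using r by simp_all
  then have r': "star r * (e - x) = e" "(e - x) * star r = e"
    using xs by (simp_all add: star_simps)
  then show "star (res x) * (e - x) = e" "(e - x) * star (res x) = e" by (simp_all add: r_def)
  have sr: "star r \<in> B" using r closed by simp
  have "p * (e + x) = (e - x) * p" using xs p by (simp add: algebra_simps)
  then have "star r * (p * (e + x)) * r = star r * ((e - x) * p) * r" by simp
  then have "star r * p * ((e + x) * r) = (star r * (e - x)) * (p * r)" by (simp only: mult.assoc)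
  then have rp: "star r * p = p * r" using r r' p sr closed by simp
  then have "p * (star r * p) * p = p * (p * r) * p" by simp
  then have "p * (star r * (p * p)) = p * (p * (r * p))" by (simp add: mult.assoc)
  then have "r * p = p * star r" using r sr p closed by simp
  with rp show "star (res x) * p = p * res x" "res x * p = p * star (res x)" by (simp_all add: r_def)
  have "star r + r = star r * ((e + x) * r) + (star r * (e - x)) * r" using r r' sr by simp
  also have "\<dots> = 2 *\<^sub>R (star r * (e * r))" by (simp add: algebra_simps scaleR_2)
  also have "e * r = r" using r by simp
  finally show "star (res x) + res x = 2 *\<^sub>R (star (res x) * res x)" by (simp add: r_def)
qed

text \<open>With \<open>r = res x\<close>, the square is \<open>- e\<close> plus a multiple of the
  difference of the two sides of the partial fraction identity.\<close>

lemma cayley_in_S0: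
  assumes p: "p \<in> S0 B e" and x: "x \<in> tangent p"
  shows "cayley p x \<in> S0 B e"
proof -
  define r where "r = res x"
  have "x \<in> skew" using x by (auto simp: tangent_def)
  note r = res[OF this, folded r_def] and rr = res_relations[OF p x, folded r_def]
    and p = S0_facts[OF p]
  have sr: "star r \<in> B" using r closed by simp
  have c: "cayley p x = 2 *\<^sub>R (p * r) - p" by (simp add: cayley_def r_def)
  have "star (cayley p x) = - cayley p x"
    using rr p by (simp add: c star_simps)
  moreover have "cayley p x * cayley p x = - e"
  proof -
    have 1: "p * r * (p * r) = - (star r * r)" "p * r * p = - star r"
      "p * (p * r) = - r"
      using rr(4) rr(4)[THEN mult_eq_assoc] p r sr closed by (simp_all add: mult.assoc)
    have "cayley p x * cayley p x
        = 4 *\<^sub>R (p * r * (p * r)) - 2 *\<^sub>R (p * r * p) - 2 *\<^sub>R (p * (p * r)) + p * p"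
      unfolding c by (simp add: algebra_simps)
    also have "\<dots> = - e + 2 *\<^sub>R (star r + r - 2 *\<^sub>R (star r * r))"
      unfolding 1 p(3) by (simp add: algebra_simps)
    finally show ?thesis using rr(5) by simp
  qed
  moreover have "cayley p x \<in> B" using p r closed by (simp add: c)
  ultimately show ?thesis by (simp add: S0_iff)
qed

lemma cayley_0: "p \<in> B \<Longrightarrow> cayley p 0 = p"
proof -
  assume p: "p \<in> B"
  have "0 \<in> skew" using subspace_skew by (rule subspace_0)
  then have "res 0 = e" using res[of 0] by simp
  then show ?thesis using p by (simp add: cayley_def scaleR_2)
qed

text \<open>Adding \<open>p\<close> to \<open>cayley p x\<close> leaves twice
  \<open>p * res x\<close>, which is invertible; conversely an inverse of \<open>s + p\<close>
  allows solving for \<open>x\<close>.\<close>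

lemma cayley_image:
  assumes p0: "p \<in> S0 B e"
  shows "cayley p ` tangent p = {s \<in> S0 B e. \<exists>y\<in>B. (s + p) * y = e}"
proof (intro subset_antisym subsetI)
  note p = S0_facts[OF p0]
  fix s assume "s \<in> cayley p ` tangent p"
  then obtain x where x: "x \<in> tangent p" "s = cayley p x" by blast
  have xs: "x \<in> skew" "x \<in> B" using x by (auto simp: tangent_def skew_def)
  note r = res[OF xs(1)]
  have "(s + p) * (- ((1 / 2) *\<^sub>R ((e + x) * p))) = - (p * ((res x * (e + x)) * p))"
    using x by (simp add: cayley_def mult.assoc)
  also have "\<dots> = e" unfolding r(3) using p closed by simp
  finally have "(s + p) * (- ((1 / 2) *\<^sub>R ((e + x) * p))) = e" .
  moreover have "- ((1 / 2) *\<^sub>R ((e + x) * p)) \<in> B" using xs p closed by simp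
  ultimately show "s \<in> {s \<in> S0 B e. \<exists>y\<in>B. (s + p) * y = e}"
    using cayley_in_S0[OF p0 x(1)] x(2) by blast
next
  note p = S0_facts[OF p0]
  fix s assume "s \<in> {s \<in> S0 B e. \<exists>y\<in>B. (s + p) * y = e}"
  then obtain y where s0: "s \<in> S0 B e" and y: "y \<in> B" "(s + p) * y = e" by blast
  note s = S0_facts[OF s0]
  define q where "q = s + p"
  define d where "d = s - p"
  have mem: "q \<in> B" "d \<in> B" using s p closed by (auto simp: q_def d_def)
  have sq: "star q = - q" "star d = - d" using s p by (simp_all add: q_def d_def star_simps)
  have qy: "q * y = e" using y by (simp add: q_def)
  have "star (q * y) = e" using qy by simp
  then have "(- star y) * q = e" using sq by (simp add: star_mult)
  then have sy: "star y = - y"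
    using inverse_unique[of q "- star y" y] mem y qy closed by (metis minus_minus)
  with \<open>(- star y) * q = e\<close> have yq: "y * q = e" by simp
  \<comment> \<open>The sum and the difference of \<open>s\<close> and \<open>p\<close> anticommute
    because \<open>s\<close> and \<open>p\<close> have the same square.\<close>
  have qd: "q * d = - (d * q)" using s p by (simp add: q_def d_def algebra_simps)
  have "y * (q * d) * y = - (y * (d * q) * y)" using qd by simp
  then have "(y * q) * (d * y) = - ((y * d) * (q * y))" by (simp add: mult.assoc)
  then have dy: "y * d = - (d * y)" using qy yq mem y closed by simp
  \<comment> \<open>Solving \<open>s = cayley p x\<close>: the inverse of \<open>res x\<close> has
    to be twice \<open>y * p\<close>, that is \<open>y * (q - d) = e - y * d\<close>.\<close>
  define x where "x = - (y * d)"
  have xB: "x \<in> B" using mem y closed by (simp add: x_def)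
  have sx: "star x = - x" using sy sq dy by (simp add: x_def star_simps)
  have xs: "x \<in> skew" using xB sx by (simp add: skew_def)
  have pe: "p = (1 / 2) *\<^sub>R (q - d)" by (simp add: q_def d_def scaleR_2[symmetric])
  have qx: "q * x = - (x * q)"
  proof -
    have "q * x = - ((q * y) * d)" by (simp add: x_def mult.assoc)
    also have "\<dots> = - d" using qy mem by simp
    also have "\<dots> = - ((y * q) * d)" using yq mem by simp
    also have "\<dots> = - (x * q)" using qd by (simp add: x_def mult.assoc)
    finally show ?thesis .
  qed
  have dx: "d * x = - (x * d)"
  proof -
    have "x * d = - ((y * d) * d)" by (simp add: x_def)
    also have "\<dots> = (d * y) * d" by (subst dy) simp
    finally show ?thesis by (simp add: x_def mult.assoc)
  qed
  have "p * x = (1 / 2) *\<^sub>R (q * x - d * x)" by (subst pe) (simp add: algebra_simps)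
  also have "\<dots> = - ((1 / 2) *\<^sub>R (x * q - x * d))"
    unfolding qx dx by (simp add: algebra_simps)
  also have "\<dots> = - (x * p)" by (subst pe) (simp add: algebra_simps)
  finally have px: "p * x = - (x * p)" .
  have xt: "x \<in> tangent p" using xs px by (simp add: tangent_def)
  have "(2 *\<^sub>R (y * p)) = e + x"
  proof -
    have "2 *\<^sub>R (y * p) = y * (q - d)" by (simp add: q_def d_def scaleR_2 algebra_simps)
    also have "\<dots> = e + x" using yq by (simp add: x_def algebra_simps)
    finally show ?thesis .
  qed
  then have "- ((1 / 2) *\<^sub>R (p * q)) * (e + x) = - ((1 / 2) *\<^sub>R (p * q)) * (2 *\<^sub>R (y * p))"
    by simp
  also have "\<dots> = - (p * ((q * y) * p))" by (simp add: mult.assoc)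
  also have "\<dots> = e" using qy p by simp
  finally have "- ((1 / 2) *\<^sub>R (p * q)) * (e + x) = e" .
  then have "- ((1 / 2) *\<^sub>R (p * q)) = res x"
    using inverse_unique[of "e + x" "- ((1 / 2) *\<^sub>R (p * q))" "res x"] res[OF xs] xB mem(1) p(1)
    by (simp only: closed simp_thms)
  then have "res x = - ((1 / 2) *\<^sub>R (p * q))" by simp
  then have "cayley p x = s" using p(4)[OF mem(1)] by (simp add: cayley_def q_def)
  then show "s \<in> cayley p ` tangent p" using xt by blast
qed

text \<open>A perturbation of \<open>s\<close> by less than the reciprocal of \<open>norm y\<close>
  keeps multiplication by \<open>s + p\<close> injective, hence surjective on
  \<open>B\<close>.\<close>

lemma openin_cayley_image:
  assumes p0: "p \<in> S0 B e"
  shows "openin (top_of_set (S0 B e)) (cayley p ` tangent p)"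
proof (subst openin_subopen, intro ballI)
  note p = S0_facts[OF p0]
  fix s assume "s \<in> cayley p ` tangent p"
  then obtain y where s: "s \<in> S0 B e" and y: "y \<in> B" "(s + p) * y = e"
    unfolding cayley_image[OF p0] by blast
  define \<delta> where "\<delta> = 1 / (norm y + 1)"
  have n: "0 < norm y + 1" by (smt (verit) norm_ge_zero)
  have ys: "- star y * (s + p) = e"
  proof -
    have "star ((s + p) * y) = e" using y by simp
    then show ?thesis using S0_facts[OF s] p by (simp add: star_simps algebra_simps)
  qed
  then have "- star y = y"
    using inverse_unique[of "s + p" "- star y" y] y ys S0_facts(1)[OF s] p(1)
    by (simp add: closed)
  then have ys: "y * (s + p) = e" using ys by simp
  have "S0 B e \<inter> ball s \<delta> \<subseteq> cayley p ` tangent p"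
  proof
    fix s' assume s': "s' \<in> S0 B e \<inter> ball s \<delta>"
    have "z = 0" if z: "z \<in> B" "(s' + p) * z = 0" for z
    proof (rule ccontr)
      assume "z \<noteq> 0"
      have "y * ((s - s') * z) = y * (s + p) * z - y * ((s' + p) * z)"
        by (simp add: algebra_simps)
      then have "z = y * ((s - s') * z)" using ys z by simp
      then have "norm z \<le> norm y * (norm (s - s') * norm z)"
        by (metis norm_mult_ineq order_trans mult_left_mono norm_ge_zero)
      then have "1 \<le> norm y * norm (s - s')" using \<open>z \<noteq> 0\<close>
        by (simp add: mult.assoc[symmetric])
      also have "\<dots> \<le> norm y * \<delta>"
        using s' by (intro mult_left_mono) (auto simp: dist_norm)
      also have "\<dots> < 1" using n by (simp add: \<delta>_def field_simps)
      finally show False by simp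
    qed
    moreover have "s' + p \<in> B" using s' S0_facts(1)[of s'] p(1) by (simp add: closed)
    ultimately obtain y' where "y' \<in> B" "(s' + p) * y' = e"
      using left_mult_surj[OF _ _ unit_closed] by blast
    then show "s' \<in> cayley p ` tangent p" using s' unfolding cayley_image[OF p0] by blast
  qed
  moreover have "openin (top_of_set (S0 B e)) (S0 B e \<inter> ball s \<delta>)" by auto
  moreover have "s \<in> S0 B e \<inter> ball s \<delta>" using s n by (simp add: \<delta>_def)
  ultimately show "\<exists>T. openin (top_of_set (S0 B e)) T \<and> s \<in> T \<and> T \<subseteq> cayley p ` tangent p"
    by blast
qed

lemma continuous_on_cayley: "continuous_on (tangent p) (cayley p)"
  unfolding cayley_def
  by (intro continuous_intros continuous_on_subset[OF continuous_on_res]) (auto simp: tangent_def)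

lemma res_cayley:
  assumes "p \<in> S0 B e" "x \<in> tangent p"
  shows "res x = - ((1 / 2) *\<^sub>R (p * (cayley p x + p)))"
proof -
  have "res x \<in> B" using assms res by (auto simp: tangent_def)
  then show ?thesis using S0_facts[OF assms(1)] by (simp add: cayley_def)
qed

text \<open>The inverse chart is again an inversion: \<open>e + \<psi> s\<close> is the inverse of a
  function affine in \<open>s\<close>, so \<open>continuous_on_inverse\<close> applies.\<close>

lemma homeomorphism_cayley:
  assumes p: "p \<in> S0 B e"
  shows "\<exists>\<psi>. homeomorphism (tangent p) (cayley p ` tangent p) (cayley p) \<psi>"
proof -
  define \<psi> where "\<psi> = inv_into (tangent p) (cayley p)"
  have "res x * (e + y) = e \<Longrightarrow> x = y" if "x \<in> tangent p" "y \<in> tangent p" for x y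
  proof -
    assume *: "res x * (e + y) = e"
    have x: "x \<in> skew" "e + x \<in> B" "e + y \<in> B" using that closed by (auto simp: tangent_def skew_def)
    have "e + x = e + y"
      by (rule inverse_unique[OF res(1)[OF x(1)] x(2,3) res(2)[OF x(1)] *])
    then show ?thesis by simp
  qed
  then have inj: "inj_on (cayley p) (tangent p)"
    using res_cayley[OF p] res(3) unfolding inj_on_def tangent_def
    by (smt (verit) mem_Collect_eq)
  have \<psi>: "\<psi> (cayley p x) = x" if "x \<in> tangent p" for x
    using that inj by (simp add: \<psi>_def)
  have "continuous_on (cayley p ` tangent p) (\<lambda>s. e + \<psi> s)"
  proof (rule continuous_on_inverse[where f = "\<lambda>s. - ((1 / 2) *\<^sub>R (p * (s + p)))"])
    show "continuous_on (cayley p ` tangent p) (\<lambda>s. - ((1 / 2) *\<^sub>R (p * (s + p))))"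
      by (intro continuous_intros)
    fix s assume "s \<in> cayley p ` tangent p"
    then obtain x where x: "x \<in> tangent p" "s = cayley p x" by blast
    then have xs: "x \<in> skew" "e + x \<in> B" using closed by (auto simp: tangent_def skew_def)
    have "- ((1 / 2) *\<^sub>R (p * (s + p))) = res x" "e + \<psi> s = e + x"
      using res_cayley[OF p x(1)] x \<psi> by auto
    then show "- ((1 / 2) *\<^sub>R (p * (s + p))) * (e + \<psi> s) = e"
      "(e + \<psi> s) * - ((1 / 2) *\<^sub>R (p * (s + p))) = e"
      "- ((1 / 2) *\<^sub>R (p * (s + p))) \<in> B \<and> e + \<psi> s \<in> B"
      using res[OF xs(1)] xs(2) by simp_all
  qed
  from continuous_on_diff[OF this continuous_on_const[of _ e]]
  have "continuous_on (cayley p ` tangent p) \<psi>" by simp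
  then have "homeomorphism (tangent p) (cayley p ` tangent p) (cayley p) \<psi>"
    using \<psi> continuous_on_cayley by (auto simp: homeomorphism_def image_image)
  then show ?thesis by blast
qed

lemma cayley_derivative:
  assumes p: "p \<in> S0 B e" and x: "x \<in> skew" and v: "v \<in> skew"
  shows "((\<lambda>t. cayley p (x + t *\<^sub>R v)) has_vector_derivative
    - (2 *\<^sub>R (p * (res x * (v * res x))))) (at 0)"
proof -
  have "bounded_linear (\<lambda>y. 2 *\<^sub>R (p * y))"
    by (intro bounded_linear_intros)
  from bounded_linear.has_vector_derivative[OF this has_vector_derivative_res[OF x v]]
  have "((\<lambda>t. 2 *\<^sub>R (p * res (x + t *\<^sub>R v)) - p) has_vector_derivative
    2 *\<^sub>R (p * - (res x * v * res x)) - 0) (at 0)"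
    by (intro has_vector_derivative_diff) auto
  then show ?thesis by (simp add: cayley_def mult.assoc)
qed

text \<open>\<open>M\<close> may be anything between the chart image and \<open>S0 B e\<close>, so
  that it can be taken to be a connected component.\<close>

lemma holomorphic_chart_cayley:
  assumes p0: "p \<in> S0 B e" and M: "cayley p ` tangent p \<subseteq> M" "M \<subseteq> S0 B e"
  shows "holomorphic_chart M (*) (tangent p) ((*) p) (tangent p) (cayley p)"
  unfolding holomorphic_chart_def
proof (intro conjI ballI allI impI)
  note p = S0_facts[OF p0]
  have pt: "p * v \<in> tangent p" "p * (p * v) = - v" if "v \<in> tangent p" for v
  proof -
    have v: "v \<in> B" "star v = - v" "p * v = - (v * p)"
      using that by (auto simp: tangent_def skew_def)
    show "p * (p * v) = - v" by (rule p(4)[OF v(1)])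
    moreover have "p * v * p = v"
      using v p(4)[of v] by (metis minus_equation_iff mult.assoc mult_minus_right)
    ultimately show "p * v \<in> tangent p"
      using p v closed by (simp add: tangent_def skew_def star_simps)
  qed
  show "findim (tangent p)"
    by (rule findim_subset[OF findim subspace_tangent]) (auto simp: tangent_def skew_def)
  show "(*) p ` tangent p \<subseteq> tangent p" using pt by blast
  show "p * (p * v) = - v" if "v \<in> tangent p" for v using pt that by blast
  show "openin (top_of_set (tangent p)) (tangent p)" by simp
  have "rational_map (\<lambda>x. (2 *\<^sub>R p) * res x + (- p))" by (intro rational_map.intros)
  moreover have "(\<lambda>x. (2 *\<^sub>R p) * res x + (- p)) = cayley p" by (auto simp: cayley_def)
  ultimately show "Ck_on k (tangent p) (tangent p) (cayley p)" for k
    by (intro Ck_on_rational_map) (auto simp: tangent_def)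
  show "openin (top_of_set M) (cayley p ` tangent p)"
    using openin_cayley_image[OF p0] M openin_subset_trans by blast
  show "\<exists>\<psi>. homeomorphism (tangent p) (cayley p ` tangent p) (cayley p) \<psi>"
    by (rule homeomorphism_cayley[OF p0])
  fix x v d assume xv: "x \<in> tangent p" "v \<in> tangent p"
    and "((\<lambda>t. cayley p (x + t *\<^sub>R v)) has_vector_derivative d) (at 0)"
  moreover have sk: "x \<in> skew" "v \<in> skew" "p * v \<in> skew"
    using xv pt by (auto simp: tangent_def)
  ultimately have d: "d = - (2 *\<^sub>R (p * (res x * (v * res x))))"
    using cayley_derivative[OF p0] vector_derivative_unique_at by blast
  define r where "r = res x"
  note r = res[OF sk(1), folded r_def] and rr = res_relations[OF p0 xv(1), folded r_def]
  have vB: "v \<in> B" "star r \<in> B" using sk r closed by (auto simp: skew_def)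
  have d: "d = - (2 *\<^sub>R (p * (r * (v * r))))" using d by (simp add: r_def)
  {
    assume "v \<noteq> 0"
    show "d \<noteq> 0"
    proof
      assume "d = 0"
      then have "p * (r * (v * r)) = 0" using d by simp
      then have "p * (p * (r * (v * r))) = 0" by simp
      then have "r * (v * r) = 0" using p r vB closed by simp
      then have "((e + x) * r) * v * (r * (e + x)) = 0"
        by (metis mult.assoc mult_zero_left mult_zero_right)
      then show False using r vB \<open>v \<noteq> 0\<close> by simp
    qed
  }
  \<comment> \<open>Carrying \<open>p\<close> across \<open>r\<close> turns \<open>r\<close> into
    \<open>star r\<close>; both sides become twice \<open>star r * (v * r)\<close>, the right one
    through the partial fraction identity.\<close>
  have "- (2 *\<^sub>R (p * (r * (p * v * r)))) = cayley p x * d"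
  proof -
    have rp: "r * (p * z) = p * (star r * z)" "star r * (p * z) = p * (r * z)" for z
      using rr(3,4) by (metis mult.assoc)+
    have "- (2 *\<^sub>R (p * (r * (p * v * r)))) = 2 *\<^sub>R (star r * (v * r))"
      using p r vB closed by (simp add: rp mult.assoc)
    also have "\<dots> = 2 *\<^sub>R ((2 *\<^sub>R (star r * r)) * (v * r)) - 2 *\<^sub>R (r * (v * r))"
      unfolding rr(5)[symmetric] by (simp add: algebra_simps)
    also have "\<dots> = cayley p x * d"
      using p r vB closed
      by (simp add: d cayley_def r_def[symmetric] rp algebra_simps mult.assoc)
    finally show ?thesis .
  qed
  then show "((\<lambda>t. cayley p (x + t *\<^sub>R (p * v))) has_vector_derivative cayley p x * d) (at 0)"
    using cayley_derivative[OF p0 sk(1,3)] by (simp add: r_def)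
qed (simp_all add: algebra_simps)

section \<open>Compact Hermitian symmetric spaces\<close>

lemma norm_S0_mult:
  assumes "p \<in> S0 B e" "x \<in> B"
  shows "norm (p * x) = norm x"
proof -
  note p = S0_facts[OF assms(1)]
  have "star p * (p * x) = x" unfolding p(2) using p(4)[OF assms(2)] by simp
  then show ?thesis using inner_mult_left[of p x "p * x"] by (simp add: norm_eq_sqrt_inner)
qed

lemma norm_S0: "p \<in> S0 B e \<Longrightarrow> norm p = norm e"
  using norm_S0_mult[OF _ unit_closed, of p] S0_facts(1)[of p] by simp

lemma continuous_on_star: "continuous_on B star"
proof -
  have "dist (star x) (star y) = dist x y" if "x \<in> B" "y \<in> B" for x y
    using norm_star[of "x - y"] that closed by (simp add: dist_norm star_simps)
  then show ?thesis unfolding continuous_on_iff by metis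
qed

text \<open>All elements have the norm of \<open>e\<close>, so closed equations cut the set out of a
  compact ball of \<open>B\<close>.\<close>

lemma compact_S0: "compact (S0 B e)"
proof -
  let ?K = "B \<inter> cball 0 (norm e)"
  have K: "compact ?K" by (rule findim_compact_Int_cball[OF findim])
  have "continuous_on ?K (\<lambda>s. (star s + s, s * s))"
    using continuous_on_subset[OF continuous_on_star] by (intro continuous_intros) auto
  then have "closed {s \<in> ?K. (star s + s, s * s) = (0, - e)}"
    using continuous_closed_preimage_constant compact_imp_closed[OF K] by blast
  then have "compact (?K \<inter> {s \<in> ?K. (star s + s, s * s) = (0, - e)})"
    using K by (rule compact_Int_closed[rotated])
  also have "?K \<inter> {s \<in> ?K. (star s + s, s * s) = (0, - e)} = S0 B e"
    using norm_S0 by (auto simp: S0_iff eq_neg_iff_add_eq_0)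
  finally show ?thesis .
qed

text \<open>The chart has a linear, hence connected, domain and takes the value \<open>p\<close> at
  \<open>0\<close>.\<close>

lemma cayley_image_subset_component:
  assumes "C \<in> components (S0 B e)" "p \<in> C"
  shows "p \<in> S0 B e" "p \<in> cayley p ` tangent p" "cayley p ` tangent p \<subseteq> C"
proof -
  show p: "p \<in> S0 B e" using assms in_components_subset by blast
  show pc: "p \<in> cayley p ` tangent p"
    using cayley_0[OF S0_facts(1)[OF p]] subspace_0[OF subspace_tangent] by (metis imageI)
  have "connected (cayley p ` tangent p)"
    by (intro connected_continuous_image continuous_on_cayley convex_connected
        subspace_imp_convex subspace_tangent)
  then show "cayley p ` tangent p \<subseteq> C"
    using components_maximal[OF assms(1)] cayley_in_S0[OF p] assms(2) pc by blast
qed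

lemma finite_components_S0: "finite (components (S0 B e))"
proof -
  have "openin (top_of_set (S0 B e)) C" if "C \<in> components (S0 B e)" for C
  proof (subst openin_subopen, rule ballI)
    fix p assume "p \<in> C"
    from cayley_image_subset_component[OF that this]
    show "\<exists>T. openin (top_of_set (S0 B e)) T \<and> p \<in> T \<and> T \<subseteq> C"
      using openin_cayley_image by blast
  qed
  moreover have "S0 B e \<subseteq> \<Union>(components (S0 B e))" by (simp add: Union_components)
  ultimately obtain F where F: "F \<subseteq> components (S0 B e)" "finite F" "S0 B e \<subseteq> \<Union>F"
    using compact_S0 unfolding compact_eq_openin_cover by meson
  have "C \<in> F" if C: "C \<in> components (S0 B e)" for C
  proof -
    obtain x where "x \<in> C" using in_components_nonempty[OF C] by blast
    moreover obtain C' where "C' \<in> F" "x \<in> C'"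
      using \<open>x \<in> C\<close> F(3) in_components_subset[OF C] by blast
    ultimately show ?thesis using components_nonoverlap[OF C, of C'] F(1) by blast
  qed
  then show ?thesis using finite_subset[OF subsetI F(2)] by blast
qed

text \<open>The equations \<open>e * c t = c t\<close> and \<open>c t * e = c t\<close> hold along
  any curve in \<open>M\<close> and can be differentiated. They let \<open>p * p * u\<close> be
  simplified to \<open>- u\<close> although \<open>e\<close> is not a unit of the type.\<close>

lemma tangent_space_unit:
  assumes "M \<subseteq> S0 B e" "u \<in> tangent_space M x"
  shows "e * u = u" "u * e = u"
proof -
  obtain c where c: "\<And>t. c t \<in> M" "(c has_vector_derivative u) (at 0)"
    using assms(2) by (auto simp: tangent_space_def)
  have "e * c t = c t" "c t * e = c t" for t using c(1)[of t] assms(1) S0_facts(1) by auto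
  moreover have "((\<lambda>t. e * c t) has_vector_derivative e * u) (at 0)"
    "((\<lambda>t. c t * e) has_vector_derivative u * e) (at 0)"
    using bounded_linear.has_vector_derivative[OF bounded_linear_mult_right c(2)]
      bounded_linear.has_vector_derivative[OF bounded_linear_mult_left c(2)] by auto
  ultimately show "e * u = u" "u * e = u"
    using vector_derivative_unique_at[OF _ c(2), of "e * u"]
      vector_derivative_unique_at[OF _ c(2), of "u * e"] by simp_all
qed

text \<open>Since \<open>- p\<close> is both the inverse and the star of \<open>p\<close>, the map
  is conjugation by the unitary element \<open>p\<close>.\<close>

lemma symmetry_in_S0:
  assumes p0: "p \<in> S0 B e" and y0: "y \<in> S0 B e"
  shows "- (p * (y * p)) \<in> S0 B e" "p * (p * (y * p) * p) = y"
proof -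
  note p = S0_facts[OF p0] and y = S0_facts[OF y0]
  have "p * (y * (p * (p * (y * p)))) = - e"
    using p y closed by (simp add: mult.assoc)
  then show "- (p * (y * p)) \<in> S0 B e" 
    using p y closed by (simp add: S0_iff star_simps mult.assoc)
  show "p * (p * (y * p) * p) = y"
    using p y closed by (simp add: mult.assoc)
qed

lemma compact_hermitian_symmetric_component:
  assumes C: "C \<in> components (S0 B e)"
  shows "compact_hermitian_symmetric_space C"
proof -
  have CS: "C \<subseteq> S0 B e" using in_components_subset[OF C] .
  have "compact C"
    using compact_S0 CS closed_components[OF compact_imp_closed[OF compact_S0] C]
    by (metis compact_Int_closed inf.absorb2 inf_commute)
  moreover have "complex_submanifold C (*)"
    unfolding complex_submanifold_def
  proof
    fix p assume "p \<in> C"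
    note pc = cayley_image_subset_component[OF C this]
    show "\<exists>V i U \<phi>. holomorphic_chart C (*) V i U \<phi> \<and> p \<in> \<phi> ` U"
      using holomorphic_chart_cayley[OF pc(1,3) CS] pc(2) by blast
  qed
  moreover have "inner (p * u) (p * v) = inner u v"
    if "p \<in> C" "v \<in> tangent_space C p" for p u v
  proof -
    have "star p * (p * v) = - ((p * p) * v)" using S0_facts(2)[of p] that CS by (auto simp: mult.assoc)
    also have "\<dots> = v"
      using S0_facts(3)[of p] that CS tangent_space_unit[OF CS that(2)] by auto
    finally show ?thesis by (simp add: inner_mult_left)
  qed
  moreover have "\<exists>\<sigma>. holomorphic_isometry C (*) \<sigma> \<and> (\<forall>x\<in>C. \<sigma> (\<sigma> x) = x) \<and> \<sigma> p = p \<and>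
        (\<exists>W. open W \<and> p \<in> W \<and> (\<forall>x\<in>W \<inter> C. \<sigma> x = x \<longrightarrow> x = p))" if pC: "p \<in> C" for p
  proof -
    have p0: "p \<in> S0 B e" using pC CS by blast
    note p = S0_facts[OF p0]
    \<comment> \<open>A bounded linear map of the ambient space, hence its own derivative
      everywhere.\<close>
    define \<sigma> where "\<sigma> = (\<lambda>y. - (p * (y * p)))"
    have bl: "bounded_linear \<sigma>" unfolding \<sigma>_def
      by (intro bounded_linear_minus bounded_linear_const_mult bounded_linear_mult_const
          bounded_linear_ident)
    have \<sigma>p: "\<sigma> p = p" using p closed by (simp add: \<sigma>_def)
    have inv: "\<sigma> (\<sigma> x) = x" if "x \<in> C" for x
      using symmetry_in_S0(2)[OF p0, of x] that CS by (auto simp: \<sigma>_def)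
    have "connected (\<sigma> ` C)"
      using in_components_connected[OF C] bl
      by (intro connected_continuous_image linear_continuous_on)
    moreover have "\<sigma> ` C \<subseteq> S0 B e" using symmetry_in_S0(1)[OF p0] CS by (auto simp: \<sigma>_def)
    \<comment> \<open>The image of \<open>C\<close> is connected and contains the fixed point
      \<open>p\<close>, so it stays in the component.\<close>
    ultimately have \<sigma>C: "\<sigma> ` C \<subseteq> C"
      using components_maximal[OF C] \<sigma>p pC by (metis IntI empty_iff imageI)
    have "bij_betw \<sigma> C C" by (rule bij_betw_byWitness[where f' = \<sigma>]) (use inv \<sigma>C in auto)
    moreover have "\<sigma> (x * u) = \<sigma> x * \<sigma> u" if "x \<in> C" "u \<in> tangent_space C x" for x u
    proof -
      have "\<sigma> x * \<sigma> u = p * (x * ((p * p) * u) * p)" by (simp add: \<sigma>_def mult.assoc)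
      also have "(p * p) * u = - u" using p tangent_space_unit[OF CS that(2)] by simp
      finally show ?thesis by (simp add: \<sigma>_def mult.assoc)
    qed
    moreover have "inner (\<sigma> u) (\<sigma> v) = inner u v"
      if "x \<in> C" "u \<in> tangent_space C x" "v \<in> tangent_space C x" for x u v
    proof -
      note uv = tangent_space_unit[OF CS that(2)] tangent_space_unit[OF CS that(3)]
      have "inner (\<sigma> u) (\<sigma> v) = inner (u * p) (star p * (p * (v * p)))"
        by (simp add: \<sigma>_def inner_mult_left)
      also have "star p * (p * (v * p)) = - ((p * p) * v * p)" unfolding p(2) by (simp add: mult.assoc)
      also have "\<dots> = v * p" using p uv by simp
      also have "inner (u * p) (v * p) = inner u (v * (p * star p))"
        by (simp add: inner_mult_right mult.assoc)
      also have "v * (p * star p) = v" using p uv by simp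
      finally show ?thesis .
    qed
    moreover have "(\<sigma> has_derivative \<sigma>) (at x within C)" for x
      using bl by (rule bounded_linear_imp_has_derivative)
    ultimately have "holomorphic_isometry C (*) \<sigma>"
      unfolding holomorphic_isometry_def by blast
    \<comment> \<open>The radius 2 comes from \<open>norm (d * d) = 2 * norm d\<close>, which
      excludes \<open>0 < norm d < 2\<close>.\<close>
    moreover have "x = p" if x: "x \<in> ball p 2 \<inter> C" "\<sigma> x = x" for x
    proof -
      have x0: "x \<in> S0 B e" using x CS by blast
      note xx = S0_facts[OF x0]
      define d where "d = x - p"
      have dB: "d \<in> B" using xx p closed by (simp add: d_def)
      have "p * (x * p) = - x" using x(2) by (simp add: \<sigma>_def minus_equation_iff)
      then have "p * (p * (x * p)) = - (p * x)" by simp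
      then have "x * p = p * x" using p xx closed by simp
      then have "d * d = - (2 *\<^sub>R (p * d))"
        using p xx by (simp add: d_def algebra_simps scaleR_2)
      moreover have "norm (p * d) = norm d" by (rule norm_S0_mult[OF p0 dB])
      ultimately have "norm (d * d) = 2 * norm d" by simp
      moreover have "norm d < 2" using x by (simp add: d_def dist_norm norm_minus_commute)
      ultimately have "d = 0" using eq_0_if_norm_square_ge[of d] by simp
      then show ?thesis by (simp add: d_def)
    qed
    ultimately show ?thesis using inv \<sigma>p by (metis open_ball centre_in_ball zero_less_numeral)
  qed
  ultimately have "compact C" "hermitian_symmetric_space C (*)"
    unfolding hermitian_symmetric_space_def
    using in_components_nonempty[OF C] in_components_connected[OF C] by blast+
  then show ?thesis unfolding compact_hermitian_symmetric_space_def by blast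
qed

end

section \<open>The star algebra of matrices\<close>

lemma qcnj_simps [simp]:
  "Q0 (qcnj q) = Q0 q" "Q1 (qcnj q) = - Q1 q" "Q2 (qcnj q) = - Q2 q" "Q3 (qcnj q) = - Q3 q"
  by (simp_all add: qcnj_def)

lemma quat_sel_mult [simp]:
  "Q0 (p * q) = Q0 p * Q0 q - Q1 p * Q1 q - Q2 p * Q2 q - Q3 p * Q3 q"
  "Q1 (p * q) = Q0 p * Q1 q + Q1 p * Q0 q + Q2 p * Q3 q - Q3 p * Q2 q"
  "Q2 (p * q) = Q0 p * Q2 q - Q1 p * Q3 q + Q2 p * Q0 q + Q3 p * Q1 q"
  "Q3 (p * q) = Q0 p * Q3 q + Q1 p * Q2 q - Q2 p * Q1 q + Q3 p * Q0 q"
  "Q0 1 = 1" "Q1 1 = 0" "Q2 1 = 0" "Q3 1 = 0"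
  "Q0 (c *\<^sub>R q) = c * Q0 q" "Q1 (c *\<^sub>R q) = c * Q1 q"
  "Q2 (c *\<^sub>R q) = c * Q2 q" "Q3 (c *\<^sub>R q) = c * Q3 q"
  by (simp_all add: times_quat_def one_quat_def scaleR_quat_def)

lemma qcnj_ops [simp]:
  "qcnj 0 = 0" "qcnj 1 = 1" "qcnj (p + q) = qcnj p + qcnj q" "qcnj (- p) = - qcnj p"
  "qcnj (p - q) = qcnj p - qcnj q" "qcnj (p * q) = qcnj q * qcnj p"
  "qcnj (c *\<^sub>R p) = c *\<^sub>R qcnj p" "qcnj (qcnj p) = p"
  by (simp_all add: quat_eq_iff algebra_simps)

lemma qcnj_sum: "qcnj (sum f X) = (\<Sum>x\<in>X. qcnj (f x))"
  by (induction X rule: infinite_finite_induct) auto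

lemma Q_sum:
  "Q0 (sum f X) = (\<Sum>x\<in>X. Q0 (f x))" "Q1 (sum f X) = (\<Sum>x\<in>X. Q1 (f x))"
  "Q2 (sum f X) = (\<Sum>x\<in>X. Q2 (f x))" "Q3 (sum f X) = (\<Sum>x\<in>X. Q3 (f x))"
  by (induction X rule: infinite_finite_induct) auto

lemma inner_quat_mult: "inner (p * q) r = inner q (qcnj p * r)" "inner (p * q) r = inner p (r * qcnj q)"
  by (simp_all add: inner_quat_def algebra_simps)

lemma qcnj_mult_self: "qcnj q * q = (norm q)\<^sup>2 *\<^sub>R 1"
  by (simp add: quat_eq_iff power2_norm_eq_inner inner_quat_def)

text \<open>Euler's four-square identity.\<close>

lemma norm_quat_mult: "norm (p * q) = norm p * norm (q :: quat)"
proof -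
  have "inner (p * q) (p * q) = inner p p * inner q q"
    by (simp add: inner_quat_def) algebra
  then show ?thesis by (simp add: norm_quat_def real_sqrt_mult)
qed

instance quat :: real_normed_algebra_1
  by standard (simp_all add: norm_quat_mult norm_quat_def[of 1] inner_quat_def)

lemma norm_fmat_eq:
  assumes "bnd N X"
  shows "(norm X)\<^sup>2 = (\<Sum>i<N. \<Sum>j<N. (norm (ent X i j))\<^sup>2)"
  using assms by (simp add: power2_norm_eq_inner inner_fmat[of N])

text \<open>Cauchy-Schwarz applied to each entry of the product makes the Frobenius norm
  submultiplicative.\<close>

instance fmat :: real_normed_algebra
proof
  fix X Y :: fmat
  obtain N where N: "bnd N X" "bnd N Y" using ex_bnd2 by blast
  have "(norm (X * Y))\<^sup>2 = (\<Sum>i<N. \<Sum>j<N. (norm (\<Sum>k<N. ent X i k * ent Y k j))\<^sup>2)"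
    using N bnd_times[OF N] by (simp add: norm_fmat_eq ent_times[of N])
  also have "\<dots> \<le> (\<Sum>i<N. \<Sum>j<N. (\<Sum>k<N. (norm (ent X i k))\<^sup>2) * (\<Sum>k<N. (norm (ent Y k j))\<^sup>2))"
  proof (intro sum_mono)
    fix i j
    have "norm (\<Sum>k<N. ent X i k * ent Y k j) \<le> (\<Sum>k<N. norm (ent X i k) * norm (ent Y k j))"
      using norm_sum[of "\<lambda>k. ent X i k * ent Y k j" "{..<N}"] by (simp add: norm_quat_mult)
    then have "(norm (\<Sum>k<N. ent X i k * ent Y k j))\<^sup>2 \<le> (\<Sum>k<N. norm (ent X i k) * norm (ent Y k j))\<^sup>2"
      by (intro power_mono) auto
    also have "\<dots> \<le> (\<Sum>k<N. (norm (ent X i k))\<^sup>2) * (\<Sum>k<N. (norm (ent Y k j))\<^sup>2)"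
      by (rule Cauchy_Schwarz_ineq_sum)
    finally show "(norm (\<Sum>k<N. ent X i k * ent Y k j))\<^sup>2
        \<le> (\<Sum>k<N. (norm (ent X i k))\<^sup>2) * (\<Sum>k<N. (norm (ent Y k j))\<^sup>2)" .
  qed
  also have "\<dots> = (\<Sum>i<N. \<Sum>k<N. (norm (ent X i k))\<^sup>2) * (\<Sum>j<N. \<Sum>k<N. (norm (ent Y k j))\<^sup>2)"
    by (rule sum_product[symmetric])
  also have "\<dots> = (norm X * norm Y)\<^sup>2"
    unfolding norm_fmat_eq[OF N(1)] norm_fmat_eq[OF N(2)] power_mult_distrib by (subst (3) sum.swap) (rule refl)
  finally show "norm (X * Y) \<le> norm X * norm Y" by (rule power2_le_imp_le) simp
qed

lemma ent_sum: "ent (sum f A) i j = (\<Sum>a\<in>A. ent (f a) i j)"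
  by (induction A rule: infinite_finite_induct) auto

lemma bnd_ctransp: "bnd N X \<Longrightarrow> bnd N (ctransp X)"
  by (simp add: bnd_def)

lemma ctransp_add: "ctransp (X + Y) = ctransp X + ctransp Y"
  and ctransp_scaleR: "ctransp (c *\<^sub>R X) = c *\<^sub>R ctransp X"
  and ctransp_ctransp: "ctransp (ctransp X) = X"
  by (simp_all add: fmat_eq_iff)

lemma ctransp_mult: "ctransp (X * Y) = ctransp Y * ctransp X"
proof -
  obtain N where N: "bnd N X" "bnd N Y" using ex_bnd2 by blast
  then show ?thesis
    using bnd_ctransp[OF N(2)] by (simp add: fmat_eq_iff ent_times[of N] qcnj_sum)
qed

lemma inner_fmat_mult:
  "inner (A * X) Y = inner X (ctransp A * Y)" "inner (X * A) Y = inner X (Y * ctransp A)"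
proof -
  obtain N where N: "bnd N A" "bnd N X" "bnd N Y" using ex_bnd3 by blast
  note N' = bnd_times[OF N(1,2)] bnd_times[OF N(2,1)] bnd_ctransp[OF N(1)]
  have "inner (A * X) Y = (\<Sum>i<N. \<Sum>j<N. \<Sum>k<N. inner (ent X k j) (qcnj (ent A i k) * ent Y i j))"
    using N N' by (simp add: inner_fmat[of N] ent_times[of N] inner_sum_left inner_quat_mult(1))
  also have "\<dots> = (\<Sum>k<N. \<Sum>j<N. \<Sum>i<N. inner (ent X k j) (qcnj (ent A i k) * ent Y i j))"
    by (subst sum.swap, subst (2) sum.swap, subst sum.swap) (rule refl)
  also have "\<dots> = inner X (ctransp A * Y)"
    using N N' by (simp add: inner_fmat[of N] ent_times[of N] inner_sum_right)
  finally show "inner (A * X) Y = inner X (ctransp A * Y)" .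
  have "inner (X * A) Y = (\<Sum>i<N. \<Sum>j<N. \<Sum>k<N. inner (ent X i k) (ent Y i j * qcnj (ent A k j)))"
    using N N' by (simp add: inner_fmat[of N] ent_times[of N] inner_sum_left inner_quat_mult(2))
  also have "\<dots> = (\<Sum>i<N. \<Sum>k<N. \<Sum>j<N. inner (ent X i k) (ent Y i j * qcnj (ent A k j)))"
    by (intro sum.cong sum.swap refl)
  also have "\<dots> = inner X (Y * ctransp A)"
    using N N' by (simp add: inner_fmat[of N] ent_times[of N] inner_sum_right)
  finally show "inner (X * A) Y = inner X (Y * ctransp A)" .
qed

lemma scalars_closed:
  "0 \<in> scalars D" "1 \<in> scalars D" "p \<in> scalars D \<Longrightarrow> q \<in> scalars D \<Longrightarrow> p + q \<in> scalars D"
  "p \<in> scalars D \<Longrightarrow> q \<in> scalars D \<Longrightarrow> p * q \<in> scalars D" "p \<in> scalars D \<Longrightarrow> c *\<^sub>R p \<in> scalars D"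
  "p \<in> scalars D \<Longrightarrow> qcnj p \<in> scalars D" "p \<in> scalars D \<Longrightarrow> - p \<in> scalars D"
  by (cases D; simp)+

lemma scalars_sum: "(\<And>x. x \<in> X \<Longrightarrow> f x \<in> scalars D) \<Longrightarrow> sum f X \<in> scalars D"
  by (induction X rule: infinite_finite_induct) (auto simp: scalars_closed)

lemma matalg_bnd: "X \<in> matalg D n \<Longrightarrow> bnd n X"
  by (simp add: matalg_def)

lemma matalgI:
  assumes "\<And>i j. n \<le> i \<or> n \<le> j \<Longrightarrow> ent X i j = 0"
    and "\<And>i j. i < n \<Longrightarrow> j < n \<Longrightarrow> ent X i j \<in> scalars D"
  shows "X \<in> matalg D n"
proof -
  have "ent X i j \<in> scalars D" for i j
    using assms[of i j] scalars_closed(1)[of D] by (cases "i < n \<and> j < n") auto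
  then show ?thesis using assms(1) by (simp add: matalg_def bnd_def)
qed

lemma mk_in_matalg: "(\<And>i j. i < n \<Longrightarrow> j < n \<Longrightarrow> f i j \<in> scalars D) \<Longrightarrow> mk n f \<in> matalg D n"
  by (rule matalgI) auto

lemma subspace_matalg: "subspace (matalg D n)"
  unfolding subspace_def matalg_def bnd_def by (auto simp: scalars_closed)

lemma matalg_subset_HH: "matalg D n \<subseteq> matalg HH n"
  by (auto simp: matalg_def)

definition unit_mat :: "nat \<Rightarrow> nat \<Rightarrow> nat \<Rightarrow> quat \<Rightarrow> fmat" where
  "unit_mat n i j q = mk n (\<lambda>a b. if a = i \<and> b = j then q else 0)"

text \<open>Only the quaternionic case needs a spanning set; the other two are real subspaces of
  it.\<close>

lemma findim_matalg: "findim (matalg D n)"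
proof -
  define T where "T = (\<lambda>(i, j, q). unit_mat n i j q) `
    ({..<n} \<times> {..<n} \<times> {1, Quat 0 1 0 0, Quat 0 0 1 0, Quat 0 0 0 1})"
  have mem: "unit_mat n i j q \<in> span T"
    if "i < n" "j < n" "q \<in> {1, Quat 0 1 0 0, Quat 0 0 1 0, Quat 0 0 0 1}" for i j q
    using that by (intro span_base) (force simp: T_def)
  have "X \<in> span T" if X: "X \<in> matalg HH n" for X
  proof -
    define R where "R i j = Q0 (ent X i j) *\<^sub>R unit_mat n i j 1
        + Q1 (ent X i j) *\<^sub>R unit_mat n i j (Quat 0 1 0 0)
        + Q2 (ent X i j) *\<^sub>R unit_mat n i j (Quat 0 0 1 0)
        + Q3 (ent X i j) *\<^sub>R unit_mat n i j (Quat 0 0 0 1)" for i j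
    have "X = (\<Sum>i<n. \<Sum>j<n. R i j)"
    proof (rule fmat_eqI)
      fix a b
      have "ent (R i j) a b = (if a = i then if b = j then ent X a b else 0 else 0)"
        if "i < n" "j < n" for i j
        using that by (simp add: R_def unit_mat_def quat_eq_iff)
      then have "ent (\<Sum>i<n. \<Sum>j<n. R i j) a b
          = (\<Sum>i<n. \<Sum>j<n. if a = i then if b = j then ent X a b else 0 else 0)"
        unfolding ent_sum by (intro sum.cong) auto
      also have "\<dots> = (\<Sum>i<n. if a = i then \<Sum>j<n. if b = j then ent X a b else 0 else 0)"
        by (intro sum.cong) auto
      also have "\<dots> = ent X a b" using matalg_bnd[OF X] by (auto simp: bnd_def)
      finally show "ent X a b = ent (\<Sum>i<n. \<Sum>j<n. R i j) a b" by simp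
    qed
    moreover have "(\<Sum>i<n. \<Sum>j<n. R i j) \<in> span T"
      unfolding R_def by (intro span_sum span_add span_scale mem) auto
    ultimately show ?thesis by simp
  qed
  moreover have "T \<subseteq> matalg HH n" by (auto simp: T_def unit_mat_def intro!: mk_in_matalg)
  ultimately have "matalg HH n = span T"
    using span_minimal[OF _ subspace_matalg] by blast
  moreover have "finite T" unfolding T_def by (intro finite_imageI) auto
  ultimately have "findim (matalg HH n)" by (auto simp: findim_def)
  then show ?thesis using findim_subset subspace_matalg matalg_subset_HH by blast
qed

lemma matalg_times: "X \<in> matalg D n \<Longrightarrow> Y \<in> matalg D n \<Longrightarrow> X * Y \<in> matalg D n"
  unfolding matalg_def using bnd_times
  by (auto simp: ent_times[of n] intro!: scalars_sum scalars_closed)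

lemma ctransp_in_matalg: "X \<in> matalg D n \<Longrightarrow> ctransp X \<in> matalg D n"
  unfolding matalg_def using bnd_ctransp by (auto simp: scalars_closed)

definition diag_mat :: "nat \<Rightarrow> (nat \<Rightarrow> quat) \<Rightarrow> fmat" where
  "diag_mat n f = mk n (\<lambda>i j. if i = j then f i else 0)"

lemma bnd_mk: "bnd n (mk n f)"
  by (auto simp: bnd_def)

lemma diag_mat_in_matalg: "(\<And>i. i < n \<Longrightarrow> f i \<in> scalars D) \<Longrightarrow> diag_mat n f \<in> matalg D n"
  unfolding diag_mat_def by (rule mk_in_matalg) (auto simp: scalars_closed)

lemma ent_diag_mat: "ent (diag_mat n f) i j = (if i = j \<and> i < n then f i else 0)"
  by (auto simp: diag_mat_def)

lemma ent_diag_mat_times: "ent (diag_mat n f * X) i j = (if i < n then f i * ent X i j else 0)"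
proof -
  have "ent (diag_mat n f * X) i j = (\<Sum>k<n. if i = k then f i * ent X i j else 0)"
    unfolding diag_mat_def ent_times[OF bnd_mk] by (intro sum.cong) auto
  then show ?thesis by simp
qed

lemma ent_times_diag_mat:
  assumes "bnd n X"
  shows "ent (X * diag_mat n f) i j = (if j < n then ent X i j * f j else 0)"
proof -
  have "ent (X * diag_mat n f) i j = (\<Sum>k<n. if k = j then ent X i j * f j else 0)"
    unfolding ent_times[OF assms] by (intro sum.cong) (auto simp: diag_mat_def)
  then show ?thesis by simp
qed

lemma idm_diag_mat: "idm n = diag_mat n (\<lambda>_. 1)"
  by (simp add: idm_def diag_mat_def)

lemma bnd_diag_mat: "bnd n (diag_mat n f)"
  unfolding diag_mat_def by (rule bnd_mk)

lemma diag_mat_mult: "diag_mat n f * diag_mat n g = diag_mat n (\<lambda>i. f i * g i)"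
  by (auto simp: fmat_eq_iff ent_diag_mat_times ent_diag_mat)

lemma ctransp_diag_mat: "ctransp (diag_mat n f) = diag_mat n (\<lambda>i. qcnj (f i))"
  by (auto simp: fmat_eq_iff ent_diag_mat)

lemma idm_mult: "bnd n X \<Longrightarrow> idm n * X = X" "bnd n X \<Longrightarrow> X * idm n = X"
  by (auto simp: fmat_eq_iff idm_diag_mat ent_diag_mat_times ent_times_diag_mat bnd_def)

lemma star_algebra_matalg: "star_algebra (matalg D n) (idm n) ctransp"
proof
  have "idm n \<in> matalg D n"
    unfolding idm_diag_mat by (rule diag_mat_in_matalg) (rule scalars_closed)
  then show "findim_algebra (matalg D n) (idm n)"
    unfolding findim_algebra_def
    using findim_matalg matalg_times idm_mult matalg_bnd by blast
qed (rule ctransp_add ctransp_scaleR ctransp_ctransp ctransp_mult inner_fmat_mult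
    | erule ctransp_in_matalg)+

section \<open>Orthonormal frames\<close>

text \<open>A frame is an orthonormal family of columns, placed in the positions \<open>X\<close> of a square matrix
  whose other columns vanish.\<close>

definition col_proj :: "nat \<Rightarrow> nat set \<Rightarrow> fmat" where
  "col_proj n X = diag_mat n (\<lambda>i. if i \<in> X then 1 else 0)"

definition frame :: "divalg \<Rightarrow> nat \<Rightarrow> nat set \<Rightarrow> fmat \<Rightarrow> bool" where
  "frame D n X u \<longleftrightarrow> u \<in> matalg D n \<and> ctransp u * u = col_proj n X"

lemma col_proj_in_matalg: "col_proj n X \<in> matalg D n"
  unfolding col_proj_def by (rule diag_mat_in_matalg) (auto simp: scalars_closed)

lemma ctransp_col_proj [simp]: "ctransp (col_proj n X) = col_proj n X"
  by (auto simp: col_proj_def ctransp_diag_mat intro!: arg_cong[where f = "diag_mat n"])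

lemma col_proj_mult: "col_proj n X * col_proj n Y = col_proj n (X \<inter> Y)"
  unfolding col_proj_def diag_mat_mult by (rule arg_cong[where f = "diag_mat n"]) auto

lemma col_proj_empty: "col_proj n {} = 0"
  by (simp add: fmat_eq_iff col_proj_def ent_diag_mat)

lemma col_proj_full: "col_proj n {..<n} = idm n"
  by (auto simp: fmat_eq_iff col_proj_def idm_diag_mat ent_diag_mat)

lemma col_proj_union: "X \<inter> Y = {} \<Longrightarrow> col_proj n X + col_proj n Y = col_proj n (X \<union> Y)"
  by (auto simp: fmat_eq_iff col_proj_def ent_diag_mat)

text \<open>The inner product with \<open>idm n\<close> is the real part of the trace, so it gives
  the rank of a projection without dimension theory over the quaternions.\<close>

lemma inner_idm_col_proj:
  assumes "X \<subseteq> {..<n}"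
  shows "inner (idm n) (col_proj n X) = real (card X)"
proof -
  have "inner (idm n) (col_proj n X) = (\<Sum>i<n. \<Sum>j<n. if i = j then if i \<in> X then 1 else 0 else 0)"
    unfolding inner_fmat[OF bnd_diag_mat[of n "\<lambda>_. 1", folded idm_diag_mat]]
    by (intro sum.cong) (auto simp: col_proj_def idm_diag_mat ent_diag_mat inner_quat_def)
  also have "\<dots> = real (card ({..<n} \<inter> X))" by (simp add: sum.If_cases)
  also have "{..<n} \<inter> X = X" using assms by blast
  finally show ?thesis .
qed

text \<open>Used to take a frame with as many columns as possible and contradict maximality.\<close>

lemma ex_greatest_bounded:
  fixes N :: nat
  assumes "\<Phi> 0"
  obtains l where "l \<le> N" "\<Phi> l" "l < N \<Longrightarrow> \<not> \<Phi> (Suc l)"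
proof -
  define l where "l = (GREATEST l. l \<le> N \<and> \<Phi> l)"
  have 1: "l \<le> N \<and> \<Phi> l" unfolding l_def
    by (rule GreatestI_nat[where b = N and k = 0]) (use assms in auto)
  have "k \<le> l" if "k \<le> N \<and> \<Phi> k" for k unfolding l_def
    by (rule Greatest_le_nat[where b = N]) (use that in auto)
  then show thesis using that 1 by (metis Suc_leI not_less_eq_eq order_refl)
qed

context
  fixes D :: divalg and n :: nat
begin

interpretation M: star_algebra "matalg D n" "idm n" ctransp
  by (rule star_algebra_matalg)

text \<open>The part of \<open>u\<close> outside the columns \<open>X\<close> has zero Gram
  matrix.\<close>

lemma frame_mult_col_proj:
  assumes "frame D n X u"
  shows "u * col_proj n X = u"
proof -
  note u = assms[unfolded frame_def]
  have "ctransp (u - u * col_proj n X) * (u - u * col_proj n X) = 0"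
    using u by (simp add: M.star_simps algebra_simps col_proj_mult u[THEN conjunct2, THEN mult_eq_assoc])
  then have "u - u * col_proj n X = 0"
    by (rule M.star_mult_eq_0[rotated]) (use u in \<open>simp add: M.closed col_proj_in_matalg\<close>)
  then show ?thesis by simp
qed

text \<open>The matrix is the projection onto the orthogonal complement of the columns; its rank
  follows because \<open>u * ctransp u\<close> and \<open>ctransp u * u\<close> have the same
  trace.\<close>

lemma frame_complement:
  assumes "frame D n X u" "X \<subseteq> {..<n}"
  shows "inner (idm n - u * ctransp u) (idm n - u * ctransp u) = real n - real (card X)"
proof -
  note u = assms(1)[unfolded frame_def]
  let ?Q = "idm n - u * ctransp u"
  have uu: "u * ctransp u \<in> matalg D n" using u by (simp add: M.closed)
  have "(u * ctransp u) * (u * ctransp u) = u * (ctransp u * u) * ctransp u" by (simp add: mult.assoc)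
  also have "\<dots> = u * ctransp u" using u frame_mult_col_proj[OF assms(1)] by simp
  finally have "?Q * ?Q = ?Q" using u uu by (simp add: algebra_simps M.closed)
  moreover have "ctransp ?Q = ?Q" by (simp add: M.star_simps)
  ultimately have "inner ?Q ?Q = inner (idm n) ?Q"
    using M.inner_unit(1)[of ?Q ?Q] uu by (simp add: M.closed)
  also have "inner (idm n) (u * ctransp u) = inner (idm n) (ctransp u * u)"
    using M.inner_unit[of u u] u by simp
  then have "inner (idm n) ?Q = inner (idm n) (col_proj n {..<n}) - inner (idm n) (col_proj n X)"
    using u by (simp add: inner_diff_right col_proj_full)
  finally show ?thesis using assms(2) by (simp add: inner_idm_col_proj)
qed

text \<open>With \<open>n\<close> columns the complementary projection has norm zero, which turns
  the left inverse into a two-sided one.\<close>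

lemma frame_full: "frame D n {..<n} g \<longleftrightarrow> g \<in> unitary_group D n"
proof
  assume g: "frame D n {..<n} g"
  then have "idm n - g * ctransp g = 0" using frame_complement[OF g] by simp
  then show "g \<in> unitary_group D n" using g by (simp add: frame_def unitary_group_def col_proj_full)
qed (auto simp: frame_def unitary_group_def col_proj_full)

text \<open>A matrix unit moves a nonzero column of \<open>Q\<close> to position
  \<open>l\<close>.\<close>

lemma ex_column:
  assumes Q: "Q \<in> matalg D n" "Q \<noteq> 0" and l: "l < n"
  obtains x where "x \<in> matalg D n" "Q * x \<noteq> 0" "x * col_proj n {l} = x"
proof -
  obtain i j where ij: "ent Q i j \<noteq> 0" using Q(2) by (auto simp: fmat_eq_iff)
  then have j: "i < n" "j < n" using matalg_bnd[OF Q(1)] by (auto simp: bnd_def not_le[symmetric])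
  define x where "x = unit_mat n j l 1"
  have x: "x \<in> matalg D n"
    unfolding x_def unit_mat_def by (rule mk_in_matalg) (auto simp: scalars_closed)
  have "ent (Q * x) i l = (\<Sum>k<n. if k = j then ent Q i j else 0)"
    unfolding ent_times[OF matalg_bnd[OF Q(1)]] using l j
    by (intro sum.cong) (auto simp: x_def unit_mat_def)
  then have "Q * x \<noteq> 0" using ij j by auto
  moreover have "x * col_proj n {l} = x"
    unfolding col_proj_def fmat_eq_iff ent_times_diag_mat[OF matalg_bnd[OF x]]
    by (auto simp: x_def unit_mat_def)
  ultimately show thesis using that x by blast
qed

text \<open>The only entry of the Gram matrix is a sum of terms \<open>qcnj q * q\<close>, which are
  real even over the quaternions.\<close>

lemma column_gram:
  assumes v: "v \<in> matalg D n" "v * col_proj n {l} = v" "v \<noteq> 0" and l: "l < n"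
  obtains c where "c > 0" "ctransp v * v = c *\<^sub>R col_proj n {l}"
proof -
  define c where "c = (norm v)\<^sup>2"
  have v0: "ent v i j = 0" if "j \<noteq> l" for i j
    using that arg_cong[OF v(2), of "\<lambda>x. ent x i j"]
    unfolding col_proj_def ent_times_diag_mat[OF matalg_bnd[OF v(1)]] by (auto split: if_splits)
  have "c = (\<Sum>i<n. \<Sum>j<n. if j = l then (norm (ent v i l))\<^sup>2 else 0)"
    unfolding c_def norm_fmat_eq[OF matalg_bnd[OF v(1)]]
    by (intro sum.cong) (auto simp: v0)
  then have c: "c = (\<Sum>i<n. (norm (ent v i l))\<^sup>2)" using l by simp
  have "ent (ctransp v * v) a b = ent (c *\<^sub>R col_proj n {l}) a b" for a b
  proof (cases "a = l \<and> b = l")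
    case True
    then show ?thesis using l
      by (simp add: ent_times[OF bnd_ctransp[OF matalg_bnd[OF v(1)]]] qcnj_mult_self
          scaleR_sum_left[symmetric] c col_proj_def ent_diag_mat)
  next
    case False
    then show ?thesis
      by (auto simp: ent_times[OF bnd_ctransp[OF matalg_bnd[OF v(1)]]] v0 col_proj_def ent_diag_mat
          intro!: sum.neutral)
  qed
  then have "ctransp v * v = c *\<^sub>R col_proj n {l}" by (rule fmat_eqI)
  moreover have "c > 0" using v(3) by (simp add: c_def)
  ultimately show thesis using that by blast
qed

text \<open>\<open>Y\<close> may have several elements; the real case adds two columns at
  once.\<close>

lemma frame_union:
  assumes u: "frame D n X u" and w: "w \<in> matalg D n" "ctransp u * w = 0"
    and c: "ctransp w * w = c *\<^sub>R col_proj n Y" "c > 0" and XY: "X \<inter> Y = {}"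
  shows "frame D n (X \<union> Y) (u + (1 / sqrt c) *\<^sub>R w)"
proof -
  note u = u[unfolded frame_def]
  have "ctransp (ctransp u * w) = 0" using w by (simp add: M.star_simps)
  then have wu: "ctransp w * u = 0" by (simp add: M.star_simps)
  have "1 / sqrt c * (1 / sqrt c) * c = 1" using c(2) by (simp add: field_simps)
  then have "ctransp (u + (1 / sqrt c) *\<^sub>R w) * (u + (1 / sqrt c) *\<^sub>R w) = col_proj n X + col_proj n Y"
    using u w(2) wu c(1) by (simp add: M.star_simps algebra_simps)
  then show ?thesis
    using u w(1) col_proj_union[OF XY] by (simp add: frame_def M.closed)
qed

lemma frame_empty: "frame D n {} 0"
  by (simp add: frame_def col_proj_empty M.closed)

text \<open>If a maximal frame fixed by \<open>P\<close> does not fill the range of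
  \<open>P\<close>, a column of \<open>P - u * ctransp u\<close> extends it.\<close>

lemma ex_frame_of_projection:
  assumes P: "P \<in> matalg D n" "ctransp P = P" "P * P = P"
  obtains l u where "l \<le> n" "frame D n {..<l} u" "u * ctransp u = P"
proof -
  obtain l where l: "l \<le> n" "\<exists>u. frame D n {..<l} u \<and> P * u = u"
    "l < n \<Longrightarrow> \<not> (\<exists>u. frame D n {..<Suc l} u \<and> P * u = u)"
    by (rule ex_greatest_bounded[of "\<lambda>l. \<exists>u. frame D n {..<l} u \<and> P * u = u" n])
      (use frame_empty in auto)
  then obtain u where u: "frame D n {..<l} u" "P * u = u" by blast
  have uB: "u \<in> matalg D n" "ctransp u * u = col_proj n {..<l}"
    using u by (auto simp: frame_def)
  have "u * ctransp u = P"
  proof (rule ccontr)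
    assume neq: "u * ctransp u \<noteq> P"
    have "l \<noteq> n"
    proof
      assume "l = n"
      then have "u * ctransp u = idm n" using u frame_full by (simp add: unitary_group_def)
      then have "P * (u * ctransp u) = P" using P by simp
      then show False using neq u(2) by (simp add: mult.assoc[symmetric])
    qed
    with l have ln: "l < n" by simp
    define R where "R = P - u * ctransp u"
    have R: "R \<in> matalg D n" "R \<noteq> 0" using P uB neq by (auto simp: R_def M.closed)
    obtain x where x: "x \<in> matalg D n" "R * x \<noteq> 0" "x * col_proj n {l} = x"
      using ex_column[OF R ln] by blast
    define v where "v = R * x"
    have v: "v \<in> matalg D n" "v \<noteq> 0" "v * col_proj n {l} = v"
      using x R by (simp_all add: v_def M.closed mult.assoc)
    have "ctransp (P * u) = ctransp u" using u by simp
    then have uP: "ctransp u * P = ctransp u" using P by (simp add: M.star_simps)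
    have "ctransp (u * col_proj n {..<l}) = ctransp u" using frame_mult_col_proj[OF u(1)] by simp
    then have "ctransp u * R = 0"
      using uP uB(2) by (simp add: R_def algebra_simps M.star_simps mult.assoc[symmetric])
    then have uv: "ctransp u * v = 0" by (simp add: v_def mult.assoc[symmetric])
    have "P * R = P * P - (P * u) * ctransp u" by (simp add: R_def right_diff_distrib mult.assoc)
    then have "P * R = R" using P(3) u(2) by (simp add: R_def)
    then have Pv: "P * v = v" by (simp add: v_def mult.assoc[symmetric])
    obtain c where c: "c > 0" "ctransp v * v = c *\<^sub>R col_proj n {l}"
      using column_gram[OF v(1,3,2) ln] by blast
    have "frame D n ({..<l} \<union> {l}) (u + (1 / sqrt c) *\<^sub>R v)"
      using frame_union[OF u(1) v(1) uv c(2,1)] by simp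
    moreover have "{..<l} \<union> {l} = {..<Suc l}" by auto
    moreover have "P * (u + (1 / sqrt c) *\<^sub>R v) = u + (1 / sqrt c) *\<^sub>R v"
      using u(2) Pv by (simp add: algebra_simps)
    ultimately show False using l(3)[OF ln] by auto
  qed
  then show thesis using that l(1) u(1) by blast
qed

text \<open>Gram-Schmidt: as long as a position is free, the complementary projection is nonzero and
  supplies a column for it.\<close>

lemma frame_completion:
  assumes "frame D n X u" "X \<subseteq> {..<n}"
  shows "\<exists>g\<in>unitary_group D n. g * col_proj n X = u"
  using assms
proof (induction "n - card X" arbitrary: X u rule: less_induct)
  case less
  note u = less.prems(1)
  have fin: "finite X" using less.prems(2) finite_subset by blast
  show ?case
  proof (cases "X = {..<n}")
    case True
    then show ?thesis using u frame_full frame_mult_col_proj by blast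
  next
    case False
    then have lt: "card X < n" using less.prems(2) by (metis card_lessThan finite_lessThan psubsetI psubset_card_mono)
    obtain l where l: "l < n" "l \<notin> X" using False less.prems(2) by blast
    let ?Q = "idm n - u * ctransp u"
    have uB: "u \<in> matalg D n" "ctransp u * u = col_proj n X" using u by (auto simp: frame_def)
    have Q: "?Q \<in> matalg D n" "?Q \<noteq> 0"
      using frame_complement[OF u less.prems(2)] lt uB by (auto simp: M.closed)
    obtain x where x: "x \<in> matalg D n" "?Q * x \<noteq> 0" "x * col_proj n {l} = x"
      using ex_column[OF Q l(1)] by blast
    define v where "v = ?Q * x"
    have v: "v \<in> matalg D n" "v \<noteq> 0" "v * col_proj n {l} = v"
      using x Q by (simp_all only: v_def M.closed mult.assoc not_False_eq_True)
    have "ctransp (u * col_proj n X) = ctransp u" using frame_mult_col_proj[OF u] by simp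
    then have "ctransp u * ?Q = 0"
      using uB by (simp add: algebra_simps M.star_simps M.closed mult.assoc[symmetric])
    then have uv: "ctransp u * v = 0" by (simp add: v_def mult.assoc[symmetric])
    obtain c where c: "c > 0" "ctransp v * v = c *\<^sub>R col_proj n {l}"
      using column_gram[OF v(1,3,2) l(1)] by blast
    let ?u = "u + (1 / sqrt c) *\<^sub>R v"
    have fu: "frame D n (X \<union> {l}) ?u"
      using frame_union[OF u v(1) uv c(2,1)] l(2) by simp
    have "v * col_proj n X = (v * col_proj n {l}) * col_proj n X" using v(3) by simp
    also have "\<dots> = 0" using l(2) by (simp add: mult.assoc col_proj_mult col_proj_empty)
    finally have ux: "?u * col_proj n X = u"
      using frame_mult_col_proj[OF u] by (simp add: algebra_simps)
    have "n - card (X \<union> {l}) < n - card X" using fin l lt by simp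
    then obtain g where g: "g \<in> unitary_group D n" "g * col_proj n (X \<union> {l}) = ?u"
      using less.hyps[OF _ fu] less.prems(2) l(1) by auto
    have "(X \<union> {l}) \<inter> X = X" by blast
    then have "g * col_proj n X = u"
      using g(2) ux by (metis col_proj_mult mult.assoc)
    then show ?thesis using g(1) by blast
  qed
qed

lemma conj_in_S0:
  assumes g: "g \<in> unitary_group D n" and i: "\<iota> \<in> S0 (matalg D n) (idm n)"
  shows "g * \<iota> * ctransp g \<in> S0 (matalg D n) (idm n)"
proof -
  note i = M.S0_facts[OF i]
  have g: "g \<in> matalg D n" "ctransp g * g = idm n" "g * ctransp g = idm n"
    using g by (auto simp: unitary_group_def)
  have "g * \<iota> * ctransp g * (g * \<iota> * ctransp g) = g * (\<iota> * ((ctransp g * g) * \<iota>)) * ctransp g"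
    by (simp add: mult.assoc)
  also have "\<dots> = - idm n" using g i by simp
  finally show ?thesis using g i by (simp add: M.S0_iff M.closed M.star_simps mult.assoc)
qed

text \<open>For a unitary \<open>g\<close> completing \<open>u\<close>, the conjugate of \<iota>
  agrees with \<open>t\<close> on the range of \<open>u\<close>. That range is the support of
  \<open>t\<close>, whose projection is \<open>- (t * t)\<close>, whence the form of the
  conclusion.\<close>

lemma frame_conjugation:
  assumes i: "\<iota> \<in> S0 (matalg D n) (idm n)" and u: "frame D n X u" "X \<subseteq> {..<n}"
    and comm: "\<iota> * col_proj n X = col_proj n X * \<iota>"
    and t: "t \<in> matalg D n" "t * (t * t) = - t" "t * u = u * \<iota>" "u * ctransp u = - (t * t)"
  shows "\<exists>g\<in>unitary_group D n. g * \<iota> * ctransp g * (t * t) = - t"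
proof -
  obtain g where g: "g \<in> unitary_group D n" "g * col_proj n X = u"
    using frame_completion[OF u] by blast
  then have g': "g \<in> matalg D n" "ctransp g * g = idm n" by (auto simp: unitary_group_def)
  note i' = M.S0_facts[OF i]
  have "ctransp g * u = (ctransp g * g) * col_proj n X" using g(2) by (simp add: mult.assoc)
  also have "\<dots> = col_proj n X" using g' col_proj_in_matalg by simp
  finally have gu: "ctransp g * u = col_proj n X" .
  have "g * \<iota> * ctransp g * (u * ctransp u) = g * (\<iota> * (ctransp g * u)) * ctransp u"
    by (simp add: mult.assoc)
  also have "\<dots> = (g * col_proj n X) * \<iota> * ctransp u" by (simp add: gu comm mult.assoc)
  also have "\<dots> = t * (u * ctransp u)" unfolding g(2) t(3)[symmetric] by (rule mult.assoc)
  finally show ?thesis using t(2,4) g(1) by (auto simp: minus_equation_iff)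
qed

text \<open>The step of the construction of a frame that intertwines \<open>t\<close> with \<open>\<iota>\<close>: \<open>v - t v \<iota>\<close> intertwines
  them for any \<open>v\<close> on which \<open>t\<^sup>2 = - 1\<close>.\<close>

lemma intertwining_step:
  assumes i: "\<iota> \<in> S0 (matalg D n) (idm n)" and u: "frame D n X u"
    and t: "t \<in> matalg D n" "ctransp t = - t" "t * (t * t) = - t"
    and tu: "t * u = u * \<iota>" and neq: "u * ctransp u \<noteq> - (t * t)" and l: "l < n"
  obtains v where "v \<in> matalg D n" "v \<noteq> 0" "v * col_proj n {l} = v" "ctransp u * v = 0"
    "t * (t * v) = - v" "t * (v - t * v * \<iota>) = (v - t * v * \<iota>) * \<iota>"
    "ctransp u * (v - t * v * \<iota>) = 0"
proof -
  note i = M.S0_facts[OF i]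
  have uB: "u \<in> matalg D n" "ctransp u * u = col_proj n X" using u by (auto simp: frame_def)
  define R where "R = - (t * t) - u * ctransp u"
  have R: "R \<in> matalg D n" "R \<noteq> 0" using t uB neq by (auto simp: R_def M.closed)
  obtain x where x: "x \<in> matalg D n" "R * x \<noteq> 0" "x * col_proj n {l} = x"
    using ex_column[OF R l] by blast
  define v where "v = R * x"
  have v: "v \<in> matalg D n" "v \<noteq> 0" "v * col_proj n {l} = v"
    using x R by (simp_all add: v_def M.closed mult.assoc)
  have "ctransp (t * u) = ctransp (u * \<iota>)" using tu by simp
  then have ut: "ctransp u * t = \<iota> * ctransp u" using t i by (simp add: M.star_simps)
  have ttu: "t * (t * u) = - u" 
  proof -
    have "t * (t * u) = t * u * \<iota>" by (metis tu mult.assoc)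
    also have "\<dots> = - u" using i uB by (simp add: tu mult.assoc)
    finally show ?thesis .
  qed
  have "ctransp (t * (t * u)) = - ctransp u" using ttu by (simp add: M.star_ops)
  then have utt: "ctransp u * (t * t) = - ctransp u" using t by (simp add: M.star_simps mult.assoc)
  have "ctransp (u * col_proj n X) = ctransp u" using frame_mult_col_proj[OF u] by simp
  then have "col_proj n X * ctransp u = ctransp u" by (simp add: M.star_simps)
  then have "ctransp u * R = 0"
    using utt uB(2)[THEN mult_eq_assoc] by (simp add: R_def algebra_simps)
  then have uv: "ctransp u * v = 0" by (simp add: v_def mult.assoc[symmetric])
  have "t * (t * R) = - R"
    using t(3) ttu[unfolded mult.assoc[symmetric]]
    by (simp add: R_def algebra_simps) (simp add: mult.assoc[symmetric])
  then have ttv: "t * (t * v) = - v" by (simp add: v_def) (simp add: mult.assoc[symmetric])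
  have "ctransp u * (t * v) = \<iota> * (ctransp u * v)" by (simp add: ut mult.assoc[symmetric])
  then have utv: "ctransp u * (t * v) = 0" using uv by simp
  have "t * (v - t * v * \<iota>) = t * v - (t * (t * v)) * \<iota>" by (simp add: algebra_simps)
  also have "\<dots> = v * \<iota> + t * v" by (simp add: ttv)
  also have "\<dots> = v * \<iota> - t * v * (\<iota> * \<iota>)" using i v t by (simp add: M.closed)
  also have "\<dots> = (v - t * v * \<iota>) * \<iota>" by (simp add: algebra_simps)
  finally have tw: "t * (v - t * v * \<iota>) = (v - t * v * \<iota>) * \<iota>" .
  have "ctransp u * (v - t * v * \<iota>) = ctransp u * v - (ctransp u * (t * v)) * \<iota>"
    by (simp add: algebra_simps)
  then have "ctransp u * (v - t * v * \<iota>) = 0" using uv utv by simp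
  then show thesis using that v uv ttv tw by blast
qed

text \<open>A full frame is unitary, so intertwining with \<iota> forces
  \<open>t * t = - idm n\<close>. A frame that misses part of the support of \<open>t\<close> thus
  leaves a free position.\<close>

lemma intertwining_frame_full:
  assumes i: "\<iota> \<in> S0 (matalg D n) (idm n)" and u: "frame D n {..<n} u"
    and t: "t \<in> matalg D n" "t * u = u * \<iota>"
  shows "u * ctransp u = - (t * t)"
proof -
  have uB: "u \<in> matalg D n" "u * ctransp u = idm n"
    using u frame_full by (auto simp: unitary_group_def)
  have "t * (t * u) = - u"
  proof -
    have "t * (t * u) = t * u * \<iota>" by (metis t(2) mult.assoc)
    also have "\<dots> = - u" using M.S0_facts[OF i] uB(1) by (simp add: t mult.assoc)
    finally show ?thesis .
  qed
  then have "t * t * (u * ctransp u) = - (u * ctransp u)" by (simp add: mult.assoc[symmetric])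
  then show ?thesis using t uB(2) by (simp add: M.closed)
qed

end

section \<open>Standard complex structures\<close>

definition qi :: quat where "qi = Quat 0 1 0 0"

definition qj :: quat where "qj = Quat 0 0 1 0"

lemma qi_sel [simp]: "Q0 qi = 0" "Q1 qi = 1" "Q2 qi = 0" "Q3 qi = 0"
  and qj_sel [simp]: "Q0 qj = 0" "Q1 qj = 0" "Q2 qj = 1" "Q3 qj = 0"
  by (simp_all add: qi_def qj_def)

lemma qi_relations: "qcnj qi = - qi" "qi * qi = - 1" "qj * qj = - 1" "qi * qj = - (qj * qi)"
  by (simp_all add: quat_eq_iff)

text \<open>Base point of the orbit with a \<open>j\<close>-dimensional i-eigenspace; for
  \<open>j = n\<close> it is scalar multiplication by i.\<close>

definition signed_i :: "nat \<Rightarrow> nat \<Rightarrow> fmat" where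
  "signed_i n j = diag_mat n (\<lambda>i. if i < j then qi else - qi)"

text \<open>The image under \<open>realify\<close> of i times the identity.\<close>

definition symplectic :: "nat \<Rightarrow> fmat" where
  "symplectic m = mk (2 * m) (\<lambda>i j. if j = i + m then - 1 else if i = j + m then 1 else 0)"

lemma signed_i_in_S0:
  assumes "D = CC \<or> D = HH"
  shows "signed_i n j \<in> S0 (matalg D n) (idm n)"
proof -
  interpret M: star_algebra "matalg D n" "idm n" ctransp by (rule star_algebra_matalg)
  have "qi \<in> scalars D" "- qi \<in> scalars D" using assms by auto
  then have "signed_i n j \<in> matalg D n" unfolding signed_i_def by (intro diag_mat_in_matalg) auto
  moreover have "ctransp (signed_i n j) = - signed_i n j" "signed_i n j * signed_i n j = - idm n"
    by (auto simp: fmat_eq_iff signed_i_def ent_diag_mat idm_diag_mat diag_mat_mult qi_relations)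
  ultimately show ?thesis by (simp add: M.S0_iff)
qed

lemma diag_mat_commute_col_proj: "diag_mat n f * col_proj n X = col_proj n X * diag_mat n f"
  unfolding col_proj_def diag_mat_mult by (rule arg_cong[where f = "diag_mat n"]) auto

lemma ent_symplectic_times:
  "ent (symplectic m * X) i j = (if i < m then - ent X (i + m) j else if i < 2 * m then ent X (i - m) j else 0)"
proof -
  have "ent (symplectic m * X) i j = (\<Sum>k<2 * m. if k = (if i < m then i + m else i - m) then
      (if i < m then - ent X (i + m) j else if i < 2 * m then ent X (i - m) j else 0) else 0)"
    unfolding symplectic_def ent_times[OF bnd_mk] by (intro sum.cong) auto
  also have "\<dots> = (if i < m then - ent X (i + m) j else if i < 2 * m then ent X (i - m) j else 0)"
    by (subst sum.delta) auto
  finally show ?thesis .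
qed

lemma ent_times_symplectic:
  assumes "bnd (2 * m) X"
  shows "ent (X * symplectic m) i j
    = (if j < m then ent X i (j + m) else if j < 2 * m then - ent X i (j - m) else 0)"
proof -
  have "ent (X * symplectic m) i j = (\<Sum>k<2 * m. if k = (if j < m then j + m else j - m) then
      (if j < m then ent X i (j + m) else if j < 2 * m then - ent X i (j - m) else 0) else 0)"
    unfolding ent_times[OF assms] by (intro sum.cong) (auto simp: symplectic_def)
  also have "\<dots> = (if j < m then ent X i (j + m) else if j < 2 * m then - ent X i (j - m) else 0)"
    by (subst sum.delta) auto
  finally show ?thesis .
qed

lemma symplectic_in_S0: "symplectic m \<in> S0 (matalg RR (2 * m)) (idm (2 * m))"
proof -
  interpret M: star_algebra "matalg RR (2 * m)" "idm (2 * m)" ctransp by (rule star_algebra_matalg)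
  have "symplectic m \<in> matalg RR (2 * m)"
    unfolding symplectic_def by (rule mk_in_matalg) simp
  moreover have "ctransp (symplectic m) = - symplectic m"
    by (auto simp: fmat_eq_iff symplectic_def)
  moreover have "symplectic m * symplectic m = - idm (2 * m)"
    unfolding fmat_eq_iff ent_symplectic_times
    by (auto simp: symplectic_def idm_diag_mat ent_diag_mat)
  ultimately show ?thesis by (simp add: M.S0_iff)
qed

text \<open>A maximal intertwining frame fills the support of \<open>t\<close>. If the candidate for
  a new column vanishes, right multiplication by j repairs it, so one sign of i suffices.\<close>

lemma ex_intertwining_frame_HH:
  assumes t: "t \<in> matalg HH n" "ctransp t = - t" "t * (t * t) = - t"
  obtains X u where "X \<subseteq> {..<n}" "frame HH n X u" "t * u = u * signed_i n n" "u * ctransp u = - (t * t)"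
proof -
  interpret M: star_algebra "matalg HH n" "idm n" ctransp by (rule star_algebra_matalg)
  let ?\<iota> = "signed_i n n"
  have i: "?\<iota> \<in> S0 (matalg HH n) (idm n)" by (rule signed_i_in_S0) simp
  let ?\<Phi> = "\<lambda>l. \<exists>u. frame HH n {..<l} u \<and> t * u = u * ?\<iota>"
  obtain l where l: "l \<le> n" "?\<Phi> l" "l < n \<Longrightarrow> \<not> ?\<Phi> (Suc l)"
    by (rule ex_greatest_bounded[of ?\<Phi> n]) (use frame_empty in \<open>auto intro!: exI[of _ 0]\<close>)
  then obtain u where u: "frame HH n {..<l} u" "t * u = u * ?\<iota>" by blast
  have "u * ctransp u = - (t * t)"
  proof (rule ccontr)
    assume neq: "u * ctransp u \<noteq> - (t * t)"
    then have ln: "l < n" using intertwining_frame_full[OF i _ t(1) u(2)] u(1) l(1) by (cases "l = n") auto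
    obtain v where v: "v \<in> matalg HH n" "v \<noteq> 0" "v * col_proj n {l} = v" "ctransp u * v = 0"
      "t * (v - t * v * ?\<iota>) = (v - t * v * ?\<iota>) * ?\<iota>" "ctransp u * (v - t * v * ?\<iota>) = 0"
      using intertwining_step[OF i u(1) t u(2) neq ln] by metis
    have icomm: "?\<iota> * col_proj n {l} = col_proj n {l} * ?\<iota>"
      unfolding signed_i_def by (rule diag_mat_commute_col_proj)
    obtain w where w: "w \<in> matalg HH n" "w \<noteq> 0" "w * col_proj n {l} = w" "ctransp u * w = 0"
      "t * w = w * ?\<iota>"
    proof (cases "v - t * v * ?\<iota> = 0")
      case False
      have "t * v * ?\<iota> * col_proj n {l} = t * (v * col_proj n {l}) * ?\<iota>"
        by (simp add: mult.assoc icomm)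
      then have "(v - t * v * ?\<iota>) * col_proj n {l} = v - t * v * ?\<iota>"
        by (simp add: left_diff_distrib v(3))
      then show thesis using that[OF _ False _ v(6,5)] v(1,3) t(1) M.S0_facts(1)[OF i]
        by (simp add: M.closed)
    next
      case True
      \<comment> \<open>Here \<open>v\<close> satisfies \<open>t * v = - (v * ?\<iota>)\<close>; as
        j anticommutes with i, multiplying by it on the right corrects the sign.\<close>
      define \<kappa> where "\<kappa> = diag_mat n (\<lambda>_. qj)"
      have k: "\<kappa> \<in> matalg HH n" unfolding \<kappa>_def by (rule diag_mat_in_matalg) simp
      have kk: "\<kappa> * \<kappa> = - idm n" "?\<iota> * \<kappa> = - (\<kappa> * ?\<iota>)"
        "\<kappa> * col_proj n {l} = col_proj n {l} * \<kappa>"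
        by (auto simp: \<kappa>_def fmat_eq_iff signed_i_def ent_diag_mat idm_diag_mat diag_mat_mult
            qi_relations col_proj_def)
      have "v * ?\<iota> = t * v * (?\<iota> * ?\<iota>)" using True by (simp add: mult.assoc[symmetric])
      also have "\<dots> = - (t * v)" using M.S0_facts[OF i] t(1) v(1) by (simp add: M.closed)
      finally have tv: "t * v = - (v * ?\<iota>)" by simp
      have "t * (v * \<kappa>) = - (v * ?\<iota>) * \<kappa>" by (simp add: tv mult.assoc[symmetric])
      also have "\<dots> = v * \<kappa> * ?\<iota>" by (simp add: mult.assoc kk)
      finally have "t * (v * \<kappa>) = v * \<kappa> * ?\<iota>" .
      moreover have "v * \<kappa> \<noteq> 0"
      proof
        assume "v * \<kappa> = 0"
        then have "v * (\<kappa> * \<kappa>) = 0" by (simp add: mult.assoc[symmetric])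
        then show False using kk v(1,2) by simp
      qed
      moreover have "v * \<kappa> * col_proj n {l} = v * \<kappa>"
        using v(3) by (metis kk(3) mult.assoc)
      moreover have "ctransp u * (v * \<kappa>) = 0" using v(4) by (simp add: mult.assoc[symmetric])
      ultimately show thesis using that[of "v * \<kappa>"] v(1) k by (simp add: M.closed)
    qed
    obtain c where c: "c > 0" "ctransp w * w = c *\<^sub>R col_proj n {l}"
      using column_gram[OF w(1,3,2) ln] by blast
    have "frame HH n ({..<l} \<union> {l}) (u + (1 / sqrt c) *\<^sub>R w)"
      using frame_union[OF u(1) w(1,4) c(2,1)] by simp
    moreover have "{..<l} \<union> {l} = {..<Suc l}" by auto
    moreover have "t * (u + (1 / sqrt c) *\<^sub>R w) = (u + (1 / sqrt c) *\<^sub>R w) * ?\<iota>"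
      using u(2) w(5) by (simp add: algebra_simps)
    ultimately show False using l(3)[OF ln] by auto
  qed
  then show thesis using that[OF _ u] l(1) by auto
qed

text \<open>Real scalars contain no imaginary unit, so each step adds the pair of columns that
  \<open>symplectic m\<close> exchanges.\<close>

lemma ex_intertwining_frame_RR:
  assumes t: "t \<in> matalg RR (2 * m)" "ctransp t = - t" "t * (t * t) = - t"
  obtains X u where "X \<subseteq> {..<2 * m}" "frame RR (2 * m) X u" "t * u = u * symplectic m"
    "u * ctransp u = - (t * t)" "symplectic m * col_proj (2 * m) X = col_proj (2 * m) X * symplectic m"
proof -
  interpret M: star_algebra "matalg RR (2 * m)" "idm (2 * m)" ctransp by (rule star_algebra_matalg)
  let ?J = "symplectic m" and ?n = "2 * m"
  \<comment> \<open>These positions are stable under \<open>symplectic m\<close>, which pairs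
    \<open>k\<close> with \<open>m + k\<close>.\<close>
  let ?X = "\<lambda>l. {..<l} \<union> {m..<m + l}"
  have J0: "?J \<in> S0 (matalg RR ?n) (idm ?n)" by (rule symplectic_in_S0)
  note J = M.S0_facts[OF J0]
  let ?\<Phi> = "\<lambda>l. \<exists>u. frame RR ?n (?X l) u \<and> t * u = u * ?J"
  obtain l where l: "l \<le> m" "?\<Phi> l" "l < m \<Longrightarrow> \<not> ?\<Phi> (Suc l)"
    by (rule ex_greatest_bounded[of ?\<Phi> m]) (use frame_empty in \<open>auto intro!: exI[of _ 0]\<close>)
  then obtain u where u: "frame RR ?n (?X l) u" "t * u = u * ?J" by blast
  have "u * ctransp u = - (t * t)"
  proof (rule ccontr)
    assume neq: "u * ctransp u \<noteq> - (t * t)"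
    have "?X m = {..<?n}" by auto
    then have lm: "l < m"
      using intertwining_frame_full[OF J0 _ t(1) u(2)] u(1) l(1) neq by (cases "l = m") auto
    then have ln: "l < ?n" by simp
    obtain v where v: "v \<in> matalg RR ?n" "v \<noteq> 0" "v * col_proj ?n {l} = v" "ctransp u * v = 0"
      "t * (t * v) = - v" "t * (v - t * v * ?J) = (v - t * v * ?J) * ?J"
      "ctransp u * (v - t * v * ?J) = 0"
      using intertwining_step[OF J0 u(1) t u(2) neq ln] by metis
    define w where "w = v - t * v * ?J"
    obtain c where c: "c > 0" "ctransp v * v = c *\<^sub>R col_proj ?n {l}"
      using column_gram[OF v(1,3,2) ln] by blast
    \<comment> \<open>This matrix is skew with at most one nonzero entry, on the diagonal; a real
      skew entry there is zero. Hence the two new columns are orthogonal.\<close>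
    have vtv: "ctransp v * (t * v) = 0"
    proof -
      define N where "N = ctransp v * (t * v)"
      have N: "N \<in> matalg RR ?n" using v t by (simp add: N_def M.closed)
      have sN: "ctransp N = - N" using t by (simp add: N_def M.star_simps mult.assoc)
      have Np: "N * col_proj ?n {l} = N" using v(3) by (simp add: N_def mult.assoc)
      have col: "ent N i j = 0" if "j \<noteq> l" for i j
        using that arg_cong[OF Np, of "\<lambda>x. ent x i j"]
        unfolding col_proj_def ent_times_diag_mat[OF matalg_bnd[OF N]] by (auto split: if_splits)
      have eq: "qcnj (ent N j i) = - ent N i j" for i j
        using arg_cong[OF sN, of "\<lambda>x. ent x i j"] by simp
      have "ent N i j = 0" for i j
      proof (cases "j = l \<and> i = l")
        case True
        have "ent N l l \<in> scalars RR" using N by (simp add: matalg_def)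
        then show ?thesis using eq[of l l] True by (simp add: quat_eq_iff)
      next
        case False
        then show ?thesis using col[of j i] col[of i j] eq[of j i] by auto
      qed
      then show ?thesis by (simp add: fmat_eq_iff N_def[symmetric])
    qed
    have Jl: "?J * col_proj ?n {l} = col_proj ?n {m + l} * ?J"
      unfolding fmat_eq_iff ent_symplectic_times
      using lm by (auto simp: col_proj_def ent_diag_mat_times ent_diag_mat symplectic_def)
    have cw: "ctransp w = ctransp v - ?J * (ctransp v * t)"
      using t(2) J(2) by (simp add: w_def M.star_simps mult.assoc)
    have "ctransp w * w = ctransp v * v - (ctransp v * (t * v)) * ?J
        - ?J * (ctransp v * (t * v)) + ?J * (ctransp v * (t * (t * v))) * ?J"
      by (subst cw) (simp add: w_def algebra_simps)
    also have "\<dots> = c *\<^sub>R (col_proj ?n {l} - ?J * col_proj ?n {l} * ?J)"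
      by (simp add: vtv v(5) c(2) algebra_simps)
    also have "?J * col_proj ?n {l} * ?J = - col_proj ?n {m + l}"
      unfolding Jl mult.assoc J(3) using col_proj_in_matalg by simp
    also have "col_proj ?n {l} - - col_proj ?n {m + l} = col_proj ?n {l, m + l}"
      using col_proj_union[of "{l}" "{m + l}" ?n] lm by (simp add: insert_commute)
    finally have gram: "ctransp w * w = c *\<^sub>R col_proj ?n {l, m + l}" .
    have w: "w \<in> matalg RR ?n" "ctransp u * w = 0" "t * w = w * ?J"
      using v t J(1) by (simp_all add: w_def M.closed)
    have "frame RR ?n (?X l \<union> {l, m + l}) (u + (1 / sqrt c) *\<^sub>R w)"
      using frame_union[OF u(1) w(1,2) gram c(1)] lm by auto
    moreover have "?X l \<union> {l, m + l} = ?X (Suc l)" by auto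
    moreover have "t * (u + (1 / sqrt c) *\<^sub>R w) = (u + (1 / sqrt c) *\<^sub>R w) * ?J"
      using u(2) w(3) by (simp add: algebra_simps)
    ultimately show False using l(3)[OF lm] by metis
  qed
  moreover have "?J * col_proj ?n (?X l) = col_proj ?n (?X l) * ?J"
    unfolding fmat_eq_iff ent_symplectic_times
    using l(1) by (auto simp: col_proj_def ent_diag_mat_times ent_diag_mat symplectic_def)
  moreover have "?X l \<subseteq> {..<?n}" using l(1) by auto
  ultimately show thesis using that u by blast
qed

lemma diag_qi_central: "X \<in> matalg CC n \<Longrightarrow> diag_mat n (\<lambda>_. qi) * X = X * diag_mat n (\<lambda>_. qi)"
  by (auto simp: fmat_eq_iff ent_diag_mat_times ent_times_diag_mat matalg_bnd quat_eq_iff matalg_def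
      bnd_def not_le[symmetric])

text \<open>As i is central, \<open>s\<close> is determined by its i-eigenspace; a unitary frame of
  that space conjugates \<open>s\<close> to diagonal form.\<close>

lemma ex_conjugate_CC:
  assumes s: "s \<in> S0 (matalg CC n) (idm n)"
  shows "\<exists>j\<le>n. \<exists>g\<in>unitary_group CC n. s = g * signed_i n j * ctransp g"
proof -
  interpret M: star_algebra "matalg CC n" "idm n" ctransp by (rule star_algebra_matalg)
  note s = M.S0_facts[OF s]
  define i where "i = signed_i n n"
  have i_diag: "i = diag_mat n (\<lambda>_. qi)"
    by (auto simp: i_def signed_i_def fmat_eq_iff ent_diag_mat)
  have "i \<in> S0 (matalg CC n) (idm n)" unfolding i_def by (rule signed_i_in_S0) simp
  note i = M.S0_facts[OF this]
  have ic: "i * X = X * i" if "X \<in> matalg CC n" for X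
    using diag_qi_central[OF that] i_diag by simp
  \<comment> \<open>The projection onto the i-eigenspace of \<open>s\<close>.\<close>
  define P where "P = (1 / 2) *\<^sub>R (idm n - i * s)"
  have "i * s * (i * s) = (i * i) * (s * s)" using ic[OF s(1)] by (metis mult.assoc)
  then have isis: "i * s * (i * s) = idm n" using i s by (simp add: M.closed)
  have "P \<in> matalg CC n" using i s by (simp add: P_def M.closed)
  moreover have "ctransp P = P" using i s ic[OF s(1)] by (simp add: P_def M.star_simps)
  moreover have "P * P = P"
  proof -
    have "(idm n - i * s) * (idm n - i * s) = idm n * idm n - i * s * idm n - idm n * (i * s) + i * s * (i * s)"
      by (simp only: left_diff_distrib right_diff_distrib) simp
    also have "\<dots> = 2 *\<^sub>R (idm n - i * s)"
      unfolding isis using i s by (simp add: M.closed scaleR_2)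
    finally show ?thesis by (simp add: P_def)
  qed
  ultimately obtain l u where l: "l \<le> n" and u: "frame CC n {..<l} u" "u * ctransp u = P"
    by (rule ex_frame_of_projection)
  obtain g where g: "g \<in> unitary_group CC n" "g * col_proj n {..<l} = u"
    using frame_completion[OF u(1)] l by auto
  have g': "g \<in> matalg CC n" "g * ctransp g = idm n" using g by (auto simp: unitary_group_def)
  have "P = g * (col_proj n {..<l} * col_proj n {..<l}) * ctransp g"
    using u(2) g(2) by (metis M.star_mult ctransp_col_proj mult.assoc)
  then have P: "P = g * col_proj n {..<l} * ctransp g" by (simp add: col_proj_mult)
  have sl: "signed_i n l = i * (2 *\<^sub>R col_proj n {..<l} - idm n)"
    by (auto simp: fmat_eq_iff i_diag ent_diag_mat_times signed_i_def ent_diag_mat col_proj_def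
        idm_diag_mat quat_eq_iff)
  have "s = i * (2 *\<^sub>R P - idm n)"
    using i s by (simp add: P_def algebra_simps scaleR_2[symmetric] M.closed)
  also have "2 *\<^sub>R P - idm n = g * (2 *\<^sub>R col_proj n {..<l} - idm n) * ctransp g"
    using g' by (simp add: P algebra_simps)
  also have "i * \<dots> = g * signed_i n l * ctransp g"
    unfolding sl using ic[OF g'(1)] by (simp add: mult.assoc[symmetric])
  finally show ?thesis using l g(1) by blast
qed

text \<open>The equation \<open>s * (t * t) = - t\<close> says that \<open>s\<close> agrees with
  \<open>t\<close> on the support of \<open>t\<close>. Evenness provides the symplectic model in the
  real case.\<close>

lemma ex_complex_structure_extending:
  assumes parity: "D = RR \<Longrightarrow> even n"
    and t: "t \<in> matalg D n" "ctransp t = - t" "t * (t * t) = - t"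
  obtains s where "s \<in> S0 (matalg D n) (idm n)" "s * (t * t) = - t"
proof (cases D)
  case RR
  then obtain m where m: "n = 2 * m" using parity by blast
  obtain X u where u: "X \<subseteq> {..<n}" "frame RR n X u" "t * u = u * symplectic m"
    "u * ctransp u = - (t * t)" "symplectic m * col_proj n X = col_proj n X * symplectic m"
    using ex_intertwining_frame_RR[of t m] t RR m by metis
  have J: "symplectic m \<in> S0 (matalg D n) (idm n)" using symplectic_in_S0 RR m by simp
  show ?thesis
    using frame_conjugation[OF J _ u(1,5) t(1,3) u(3,4)] conj_in_S0[OF _ J] u(2) RR that by blast
next
  case CC
  interpret M: star_algebra "matalg CC n" "idm n" ctransp by (rule star_algebra_matalg)
  define i where "i = signed_i n n"
  have i_diag: "i = diag_mat n (\<lambda>_. qi)"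
    by (auto simp: i_def signed_i_def fmat_eq_iff ent_diag_mat)
  have "i \<in> S0 (matalg CC n) (idm n)" unfolding i_def by (rule signed_i_in_S0) simp
  note i = M.S0_facts[OF this]
  have t1: "t \<in> matalg CC n" using t CC by simp
  \<comment> \<open>The projection onto the kernel of \<open>t\<close>; over the complex numbers
    central i can simply be added there.\<close>
  define Q where "Q = idm n + t * t"
  have Q: "Q \<in> matalg CC n" "ctransp Q = Q" "t * Q = 0" "Q * t = 0"
    using t t1 by (auto simp: Q_def M.closed M.star_simps algebra_simps)
  have "(idm n + t * t) * Q = Q + t * (t * Q)" using Q(1) by (simp add: distrib_right mult.assoc)
  then have QQ: "Q * Q = Q" using Q(3) by (simp add: Q_def)
  have ic: "i * X = X * i" if "X \<in> matalg CC n" for X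
    using diag_qi_central[OF that] i_diag by simp
  define s where "s = t + i * Q"
  have "t * (i * Q) = 0" using ic[OF t1] Q(3) by (metis mult.assoc mult_zero_right)
  moreover have "i * Q * t = 0" using Q(4) by (simp add: mult.assoc)
  moreover have "i * Q * (i * Q) = (i * i) * (Q * Q)" using ic[OF Q(1)] by (metis mult.assoc)
  ultimately have "s * s = t * t - Q" using i Q QQ by (simp add: s_def algebra_simps)
  then have "s * s = - idm n" by (simp add: Q_def)
  moreover have "ctransp s = - s" using i Q t ic[OF Q(1)] by (simp add: s_def M.star_simps)
  moreover have "s \<in> matalg CC n" using i t1 Q by (simp add: s_def M.closed)
  ultimately have "s \<in> S0 (matalg CC n) (idm n)" by (simp add: M.S0_iff)
  moreover have "i * Q * (t * t) = 0" using Q(4) by (simp add: mult.assoc) (simp add: mult.assoc[symmetric])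
  then have "s * (t * t) = - t" using t by (simp add: s_def algebra_simps)
  ultimately show ?thesis using that CC by blast
next
  case HH
  obtain X u where u: "X \<subseteq> {..<n}" "frame HH n X u" "t * u = u * signed_i n n"
    "u * ctransp u = - (t * t)"
    using ex_intertwining_frame_HH[of t n] t HH by metis
  have J: "signed_i n n \<in> S0 (matalg D n) (idm n)" using signed_i_in_S0 HH by simp
  have comm: "signed_i n n * col_proj n X = col_proj n X * signed_i n n"
    unfolding signed_i_def by (rule diag_mat_commute_col_proj)
  show ?thesis
    using frame_conjugation[OF J _ u(1) comm t(1,3) u(3,4)] conj_in_S0[OF _ J] u(2) HH that by blast
qed

lemma S0_matalgD:
  assumes "s \<in> S0 (matalg D n) (idm n)"
  shows "s \<in> matalg D n \<and> ctransp s = - s \<and> s * (s * s) = - s \<and> s * s = - idm n"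
proof -
  interpret M: star_algebra "matalg D n" "idm n" ctransp by (rule star_algebra_matalg)
  show ?thesis using M.S0_facts[OF assms] by simp
qed

text \<open>For \<open>t = s\<close> the support \<open>- (s * s)\<close> is the whole space, so
  agreement on the support is equality.\<close>

lemma ex_conjugate_HH:
  assumes "s \<in> S0 (matalg HH n) (idm n)"
  shows "\<exists>g\<in>unitary_group HH n. s = g * signed_i n n * ctransp g"
proof -
  interpret M: star_algebra "matalg HH n" "idm n" ctransp by (rule star_algebra_matalg)
  note s = S0_matalgD[OF assms]
  obtain X u where u: "X \<subseteq> {..<n}" "frame HH n X u" "s * u = u * signed_i n n"
    "u * ctransp u = - (s * s)"
    using ex_intertwining_frame_HH[of s n] s by metis
  have J: "signed_i n n \<in> S0 (matalg HH n) (idm n)" using signed_i_in_S0 by simp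
  have comm: "signed_i n n * col_proj n X = col_proj n X * signed_i n n"
    unfolding signed_i_def by (rule diag_mat_commute_col_proj)
  obtain g where g: "g \<in> unitary_group HH n" "g * signed_i n n * ctransp g * (s * s) = - s"
    using frame_conjugation[OF J u(2,1) comm _ _ u(3,4)] s by blast
  moreover have "g * signed_i n n * ctransp g \<in> matalg HH n"
    using g(1) M.S0_facts(1)[OF J] by (simp add: M.closed unitary_group_def)
  ultimately show ?thesis using s by auto
qed

lemma ex_conjugate_RR:
  assumes "s \<in> S0 (matalg RR (2 * m)) (idm (2 * m))"
  shows "\<exists>g\<in>unitary_group RR (2 * m). s = g * symplectic m * ctransp g"
proof -
  interpret M: star_algebra "matalg RR (2 * m)" "idm (2 * m)" ctransp by (rule star_algebra_matalg)
  note s = S0_matalgD[OF assms]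
  obtain X u where u: "X \<subseteq> {..<2 * m}" "frame RR (2 * m) X u" "s * u = u * symplectic m"
    "u * ctransp u = - (s * s)" "symplectic m * col_proj (2 * m) X = col_proj (2 * m) X * symplectic m"
    using ex_intertwining_frame_RR[of s m] s by metis
  obtain g where g: "g \<in> unitary_group RR (2 * m)" "g * symplectic m * ctransp g * (s * s) = - s"
    using frame_conjugation[OF symplectic_in_S0 u(2,1,5) _ _ u(3,4)] s by blast
  moreover have "g * symplectic m * ctransp g \<in> matalg RR (2 * m)"
    using g(1) M.S0_facts(1)[OF symplectic_in_S0] by (simp add: M.closed unitary_group_def)
  ultimately show ?thesis using s by auto
qed

section \<open>Orbits as homogeneous spaces\<close>

lemma unitary_groupD:
  assumes "g \<in> unitary_group D n"
  shows "g \<in> matalg D n" "ctransp g * g = idm n" "g * ctransp g = idm n"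
    "z \<in> matalg E n \<Longrightarrow> ctransp g * (g * z) = z" "z \<in> matalg E n \<Longrightarrow> g * (ctransp g * z) = z"
  using assms idm_mult(1)[OF matalg_bnd, of z E n]
  by (auto simp: unitary_group_def mult.assoc[symmetric])

lemma unitary_group_mult:
  assumes "g \<in> unitary_group D n" "h \<in> unitary_group D n"
  shows "g * h \<in> unitary_group D n"
proof -
  interpret M: star_algebra "matalg D n" "idm n" ctransp by (rule star_algebra_matalg)
  note g = unitary_groupD[OF assms(1)] and h = unitary_groupD[OF assms(2)]
  have "ctransp (g * h) * (g * h) = idm n" "(g * h) * ctransp (g * h) = idm n"
    using g(4)[of h D] h g(5)[of "ctransp g" D] h(5)[of "ctransp g" D] g
    by (simp_all add: M.star_simps mult.assoc M.closed)
  then show ?thesis using g(1) h(1) by (simp add: unitary_group_def M.closed)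
qed

lemma unitary_group_ctransp:
  "g \<in> unitary_group D n \<Longrightarrow> ctransp g \<in> unitary_group D n"
  by (auto simp: unitary_group_def ctransp_ctransp ctransp_in_matalg)

lemma idm_in_unitary_group: "idm n \<in> unitary_group D n"
proof -
  interpret M: star_algebra "matalg D n" "idm n" ctransp by (rule star_algebra_matalg)
  show ?thesis using M.unit_closed by (simp add: unitary_group_def)
qed

lemma compact_unitary_group: "compact (unitary_group D n)"
proof -
  interpret M: star_algebra "matalg D n" "idm n" ctransp by (rule star_algebra_matalg)
  let ?K = "matalg D n \<inter> cball 0 (norm (idm n))"
  have K: "compact ?K" by (rule findim_compact_Int_cball[OF findim_matalg])
  have nrm: "norm g = norm (idm n)" if "g \<in> unitary_group D n" for g
    using M.inner_unit(1)[of g g] M.inner_unit(1)[of "idm n" "idm n"] unitary_groupD(1,2)[OF that]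
      M.unit_closed
    by (simp add: norm_eq_sqrt_inner)
  have "continuous_on ?K (\<lambda>g. (ctransp g * g, g * ctransp g))"
    using continuous_on_subset[OF M.continuous_on_star] by (intro continuous_intros) auto
  then have "closed {g \<in> ?K. (ctransp g * g, g * ctransp g) = (idm n, idm n)}"
    using continuous_closed_preimage_constant compact_imp_closed[OF K] by blast
  then have "compact (?K \<inter> {g \<in> ?K. (ctransp g * g, g * ctransp g) = (idm n, idm n)})"
    using K by (rule compact_Int_closed[rotated])
  also have "?K \<inter> {g \<in> ?K. (ctransp g * g, g * ctransp g) = (idm n, idm n)} = unitary_group D n"
    using nrm by (auto simp: unitary_group_def)
  finally show ?thesis .
qed

definition conj_orbit :: "divalg \<Rightarrow> nat \<Rightarrow> fmat \<Rightarrow> fmat set" where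
  "conj_orbit D n x = (\<lambda>g. g * x * ctransp g) ` unitary_group D n"

lemma continuous_on_conj: "continuous_on (unitary_group D n) (\<lambda>g. g * x * ctransp g)"
proof -
  interpret M: star_algebra "matalg D n" "idm n" ctransp by (rule star_algebra_matalg)
  show ?thesis
    by (intro continuous_intros continuous_on_subset[OF M.continuous_on_star])
      (auto simp: unitary_group_def)
qed

lemma compact_conj_orbit: "compact (conj_orbit D n x)"
  unfolding conj_orbit_def
  by (rule compact_continuous_image[OF continuous_on_conj compact_unitary_group])

text \<open>Two unitary elements give the same conjugate of \<open>x\<close> exactly when they lie
  in one coset of the centraliser; a continuous bijection from a compact to a Hausdorff space is a
  homeomorphism.\<close>

lemma conj_orbit_identified:
  assumes x: "x \<in> matalg D n"
    and K: "K = {g \<in> unitary_group D n. g * x = x * g}"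
  shows "identified_with (conj_orbit D n x) (unitary_group D n) K"
proof -
  interpret M: star_algebra "matalg D n" "idm n" ctransp by (rule star_algebra_matalg)
  let ?G = "unitary_group D n" and ?f = "\<lambda>g. g * x * ctransp g"
  let ?q = "\<lambda>g. (*) g ` K"
  define F where "F = (\<lambda>C. ?f (SOME g. g \<in> ?G \<and> ?q g = C))"
  have eK: "idm n \<in> K" using idm_in_unitary_group x by (simp add: K)
  have fK: "?f (g * k) = ?f g" if "g \<in> ?G" "k \<in> K" for g k
  proof -
    have k: "k \<in> ?G" "k * x = x * k" using that by (auto simp: K)
    have "?f (g * k) = g * (k * x) * ctransp k * ctransp g"
      by (simp add: M.star_simps mult.assoc)
    also have "\<dots> = g * x * (k * (ctransp k * ctransp g))" by (simp add: k(2) mult.assoc)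
    also have "\<dots> = ?f g"
      using unitary_groupD(5)[OF k(1), of "ctransp g" D] unitary_groupD(1)[OF that(1)]
      by (simp add: M.closed)
    finally show ?thesis .
  qed
  have coset_eq: "?f g = ?f h" if g: "g \<in> ?G" and h: "h \<in> ?G" and eq: "?q g = ?q h" for g h
  proof -
    have "g \<in> ?q g" using eK unitary_groupD(1)[OF g] by (intro image_eqI[of _ _ "idm n"]) auto
    then obtain k where "k \<in> K" "g = h * k" using eq by auto
    then show ?thesis using fK[OF h] by simp
  qed
  have Fq: "F (?q g) = ?f g" if "g \<in> ?G" for g
  proof -
    have "\<exists>h. h \<in> ?G \<and> ?q h = ?q g" using that by blast
    from someI_ex[OF this] show ?thesis unfolding F_def using coset_eq[OF _ that] by blast
  qed
  have inj: "?q g = ?q h" if g: "g \<in> ?G" and h: "h \<in> ?G" and eq: "?f g = ?f h" for g h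
  proof -
    have sub: "?q g \<subseteq> ?q h" if g: "g \<in> ?G" and h: "h \<in> ?G" and eq: "?f g = ?f h" for g h
    proof
      fix y assume "y \<in> ?q g"
      then obtain k where k: "k \<in> K" "y = g * k" by blast
      \<comment> \<open>If \<open>g\<close> and \<open>h\<close> conjugate \<open>x\<close> alike,
        this quotient commutes with \<open>x\<close> and so lies in \<open>K\<close>.\<close>
      define d where "d = ctransp h * g"
      have dG: "d \<in> ?G" unfolding d_def by (intro unitary_group_mult unitary_group_ctransp g h)
      have gh: "g \<in> matalg D n" "h \<in> matalg D n" using g h unitary_groupD by auto
      have "d * x = ctransp h * (?f g * g)"
        using unitary_groupD[OF g] gh x by (simp add: d_def mult.assoc M.closed)
      also have "\<dots> = (ctransp h * h) * x * ctransp h * g" unfolding eq by (simp only: mult.assoc)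
      also have "\<dots> = x * d" using unitary_groupD[OF h] x by (simp add: d_def mult.assoc)
      finally have "d \<in> K" using dG by (simp add: K)
      then have "d * k \<in> K" using k(1) dG unitary_group_mult by (auto simp: K) (metis mult.assoc)
      moreover have "y = h * (d * k)"
        using k unitary_groupD(5)[OF h, of g D] gh
        by (simp add: d_def flip: mult.assoc)
      ultimately show "y \<in> ?q h" by blast
    qed
    show ?thesis using sub[OF g h eq] sub[OF h g eq[symmetric]] by blast
  qed
  have q: "quotient_map (top_of_set ?G) (coset_topology ?G K) ?q"
    by (rule quotient_map_coset_topology)
  have top: "topspace (coset_topology ?G K) = ?q ` ?G"
    using quotient_imp_surjective_map[OF q] by simp
  have "homeomorphic_map (coset_topology ?G K) (top_of_set (conj_orbit D n x)) F"
  proof (rule continuous_imp_homeomorphic_map)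
    have "continuous_map (top_of_set ?G) (top_of_set (conj_orbit D n x)) ?f"
      using continuous_on_conj by (auto simp: continuous_map_in_subtopology conj_orbit_def)
    then have "continuous_map (top_of_set ?G) (top_of_set (conj_orbit D n x)) (F \<circ> ?q)"
      using Fq by (subst continuous_map_eq[of _ _ ?f]) auto
    then show "continuous_map (coset_topology ?G K) (top_of_set (conj_orbit D n x)) F"
      by (rule continuous_compose_quotient_map[OF q])
    have "compactin (top_of_set ?G) ?G"
      using compact_unitary_group by (simp add: compactin_subtopology)
    then have "compactin (coset_topology ?G K) (?q ` ?G)"
      using image_compactin quotient_imp_continuous_map[OF q] by blast
    then show "compact_space (coset_topology ?G K)" by (simp add: compact_space_def top)
    show "Hausdorff_space (top_of_set (conj_orbit D n x))"
      by (intro Hausdorff_space_subtopology Hausdorff_space_euclidean)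
    show "F ` topspace (coset_topology ?G K) = topspace (top_of_set (conj_orbit D n x))"
      using Fq by (auto simp: top conj_orbit_def image_iff)
    show "inj_on F (topspace (coset_topology ?G K))"
      unfolding top
    proof (rule inj_onI)
      fix C C' assume "C \<in> ?q ` ?G" "C' \<in> ?q ` ?G" and eq: "F C = F C'"
      then obtain g h where "g \<in> ?G" "C = ?q g" "h \<in> ?G" "C' = ?q h" by blast
      then show "C = C'" using eq Fq inj by metis
    qed
  qed
  moreover have "F ((*) g ` C) = g * F C * ctransp g" if g: "g \<in> ?G" and C: "C \<in> left_cosets ?G K" for g C
  proof -
    obtain h where h: "h \<in> ?G" "C = ?q h" using C by (auto simp: left_cosets_def)
    have "(*) g ` C = ?q (g * h)" by (simp add: h image_image mult.assoc)
    then have "F ((*) g ` C) = ?f (g * h)" using Fq[OF unitary_group_mult[OF g h(1)]] by simp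
    also have "\<dots> = g * F C * ctransp g" using Fq[OF h(1)] h(2) by (simp add: M.star_simps mult.assoc)
    finally show ?thesis .
  qed
  ultimately show ?thesis unfolding identified_with_def by blast
qed

section \<open>The isotropy groups\<close>

lemma sum_lessThan_add: "(\<Sum>k<a + b. f k) = (\<Sum>k<a. f k) + (\<Sum>k<b. f (k + a))"
  for f :: "nat \<Rightarrow> 'a::comm_monoid_add"
  by (induction b) (simp_all add: add_ac)

text \<open>Indices in the second block are written as \<open>a + j\<close>, the form in which the
  entry lemmas for block matrices rewrite.\<close>

lemma fmat_eq_blocksI:
  assumes "bnd (j + k) X" "bnd (j + k) Y"
    and "\<And>a b. a < j \<Longrightarrow> b < j \<Longrightarrow> ent X a b = ent Y a b"
    and "\<And>a b. a < j \<Longrightarrow> b < k \<Longrightarrow> ent X a (b + j) = ent Y a (b + j)"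
    and "\<And>a b. a < k \<Longrightarrow> b < j \<Longrightarrow> ent X (a + j) b = ent Y (a + j) b"
    and "\<And>a b. a < k \<Longrightarrow> b < k \<Longrightarrow> ent X (a + j) (b + j) = ent Y (a + j) (b + j)"
  shows "X = Y"
proof (rule fmat_eqI)
  fix a b
  show "ent X a b = ent Y a b"
  proof (cases "a < j + k \<and> b < j + k")
    case False
    then show ?thesis using assms(1,2) by (auto simp: bnd_def not_less)
  next
    case True
    then show ?thesis
      using assms(3)[of a b] assms(4)[of a "b - j"] assms(5)[of "a - j" b] assms(6)[of "a - j" "b - j"]
      by (cases "a < j"; cases "b < j") auto
  qed
qed

section \<open>The unitary group inside the orthogonal group\<close>

lemma of_real_quat_sel [simp]:
  "Q0 (of_real r) = r" "Q1 (of_real r) = 0" "Q2 (of_real r) = 0" "Q3 (of_real r) = 0"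
  by (simp_all add: of_real_def)

lemma ent_realify:
  assumes "a < m" "b < m"
  shows "ent (realify m X) a b = of_real (Q0 (ent X a b))"
    "ent (realify m X) a (b + m) = of_real (- Q1 (ent X a b))"
    "ent (realify m X) (a + m) b = of_real (Q1 (ent X a b))"
    "ent (realify m X) (a + m) (b + m) = of_real (Q0 (ent X a b))"
  using assms by (simp_all add: realify_def)

lemma bnd_realify: "bnd (m + m) (realify m X)"
  unfolding realify_def mult_2 by (rule bnd_mk)

lemma realify_in_matalg: "realify m X \<in> matalg RR (2 * m)"
  unfolding realify_def by (rule mk_in_matalg) (simp add: Let_def)

lemma CC_entries: "X \<in> matalg CC n \<Longrightarrow> Q2 (ent X a b) = 0 \<and> Q3 (ent X a b) = 0"
  by (auto simp: matalg_def)

lemma realify_mult: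
  assumes X: "X \<in> matalg CC m" and Y: "Y \<in> matalg CC m"
  shows "realify m (X * Y) = realify m X * realify m Y"
  by (rule fmat_eq_blocksI[OF bnd_realify bnd_times[OF bnd_realify bnd_realify]])
    (simp_all add: ent_realify ent_times[OF bnd_realify] ent_times[OF matalg_bnd[OF X]]
      sum_lessThan_add quat_eq_iff Q_sum CC_entries[OF X] CC_entries[OF Y] sum_subtractf sum.distrib
      sum_negf)

lemma realify_ctransp: "realify m (ctransp X) = ctransp (realify m X)"
  by (rule fmat_eq_blocksI[OF bnd_realify bnd_ctransp[OF bnd_realify]])
    (simp_all add: ent_realify quat_eq_iff)

lemma realify_idm: "realify m (idm m) = idm (2 * m)"
proof -
  have "bnd (m + m) (idm (2 * m))" unfolding idm_def mult_2 by (rule bnd_mk)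
  then show ?thesis
    by (intro fmat_eq_blocksI[OF bnd_realify]) (auto simp: ent_realify idm_diag_mat ent_diag_mat)
qed

lemma realify_inj:
  assumes X: "X \<in> matalg CC m" and Y: "Y \<in> matalg CC m" and eq: "realify m X = realify m Y"
  shows "X = Y"
proof (rule fmat_eqI)
  fix a b
  show "ent X a b = ent Y a b"
  proof (cases "a < m \<and> b < m")
    case True
    then have "of_real (Q0 (ent X a b)) = (of_real (Q0 (ent Y a b)) :: quat)"
      "of_real (Q1 (ent X a b)) = (of_real (Q1 (ent Y a b)) :: quat)"
      using ent_realify(1,3)[of a m b X] ent_realify(1,3)[of a m b Y] eq by auto
    then show ?thesis using CC_entries[OF X] CC_entries[OF Y] by (simp add: quat_eq_iff)
  next
    case False
    then show ?thesis using matalg_bnd[OF X] matalg_bnd[OF Y] by (auto simp: bnd_def not_less)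
  qed
qed

text \<open>A real matrix commuting with the standard complex structure is complex linear, which
  fixes its second block column in terms of the first.\<close>

lemma U_in_O_eq:
  "U_in_O m = {g \<in> unitary_group RR (2 * m). g * symplectic m = symplectic m * g}"
proof (intro subset_antisym subsetI)
  fix g assume "g \<in> U_in_O m"
  then obtain X where X: "X \<in> unitary_group CC m" "g = realify m X" by (auto simp: U_in_O_def)
  note X' = unitary_groupD[OF X(1)]
  have "ctransp g * g = realify m (ctransp X * X)" "g * ctransp g = realify m (X * ctransp X)"
    using realify_mult[OF ctransp_in_matalg[OF X'(1)] X'(1)]
      realify_mult[OF X'(1) ctransp_in_matalg[OF X'(1)]]
    by (simp_all add: X(2) realify_ctransp)
  then have "g \<in> unitary_group RR (2 * m)"
    using X'(2,3) realify_in_matalg X(2) by (simp add: unitary_group_def realify_idm)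
  moreover have "g * symplectic m = symplectic m * g"
  proof (rule fmat_eq_blocksI[where j = m and k = m])
    have b: "bnd (m + m) g" "bnd (m + m) (symplectic m)" "bnd (2 * m) g"
      using X(2) bnd_realify by (auto simp: symplectic_def mult_2 bnd_mk)
    show "bnd (m + m) (g * symplectic m)" "bnd (m + m) (symplectic m * g)"
      using b by (auto intro: bnd_times)
  qed (simp_all add: ent_symplectic_times ent_times_symplectic[OF matalg_bnd[OF realify_in_matalg]]
      X(2) ent_realify)
  ultimately show "g \<in> {g \<in> unitary_group RR (2 * m). g * symplectic m = symplectic m * g}" by blast
next
  fix g assume "g \<in> {g \<in> unitary_group RR (2 * m). g * symplectic m = symplectic m * g}"
  then have g: "g \<in> unitary_group RR (2 * m)" "g * symplectic m = symplectic m * g" by auto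
  note g' = unitary_groupD[OF g(1)]
  have comm: "ent g a (b + m) = - ent g (a + m) b" "ent g (a + m) (b + m) = ent g a b"
    if "a < m" "b < m" for a b
    using that arg_cong[OF g(2), of "\<lambda>x. ent x a b"] arg_cong[OF g(2), of "\<lambda>x. ent x (a + m) b"]
    by (simp_all add: ent_symplectic_times ent_times_symplectic[OF matalg_bnd[OF g'(1)]])
  have real: "of_real (Q0 (ent g a b)) = ent g a b" for a b
    using g'(1) by (auto simp: matalg_def quat_eq_iff)
  \<comment> \<open>Real and imaginary parts are read off from the first block column of
    \<open>g\<close>.\<close>
  define X where "X = mk m (\<lambda>a b. Quat (Q0 (ent g a b)) (Q0 (ent g (a + m) b)) 0 0)"
  have X: "X \<in> matalg CC m" unfolding X_def by (rule mk_in_matalg) simp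
  have gX: "realify m X = g"
  proof (rule fmat_eq_blocksI[OF bnd_realify])
    show "bnd (m + m) g" using matalg_bnd[OF g'(1)] by (simp add: mult_2)
  qed (simp_all add: ent_realify X_def comm real)
  have r: "realify m (ctransp X * X) = realify m (idm m)" "realify m (X * ctransp X) = realify m (idm m)"
    using g' X by (simp_all add: realify_mult ctransp_in_matalg realify_ctransp gX realify_idm)
  have i: "idm m \<in> matalg CC m" using idm_in_unitary_group unitary_groupD(1) by blast
  have "X \<in> unitary_group CC m"
    using X realify_inj[OF _ i r(1)] realify_inj[OF _ i r(2)]
    by (simp add: unitary_group_def matalg_times ctransp_in_matalg)
  then show "g \<in> U_in_O m" using gX by (auto simp: U_in_O_def)
qed

section \<open>Block-diagonal unitary groups\<close>

lemma ent_block_diag: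
  "a < j \<Longrightarrow> b < j \<Longrightarrow> ent (block_diag j k X Y) a b = ent X a b"
  "a < j \<Longrightarrow> b < k \<Longrightarrow> ent (block_diag j k X Y) a (b + j) = 0"
  "a < k \<Longrightarrow> b < j \<Longrightarrow> ent (block_diag j k X Y) (a + j) b = 0"
  "a < k \<Longrightarrow> b < k \<Longrightarrow> ent (block_diag j k X Y) (a + j) (b + j) = ent Y a b"
  by (auto simp: block_diag_def)

lemma bnd_block_diag: "bnd (j + k) (block_diag j k X Y)"
  unfolding block_diag_def by (rule bnd_mk)

lemma block_diag_mult:
  assumes "bnd j X" "bnd k Y"
  shows "block_diag j k X Y * block_diag j k X' Y' = block_diag j k (X * X') (Y * Y')"
  by (rule fmat_eq_blocksI[OF bnd_times[OF bnd_block_diag bnd_block_diag] bnd_block_diag])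
    (simp_all add: ent_times[OF bnd_block_diag] ent_times[OF assms(1)] ent_times[OF assms(2)]
      sum_lessThan_add ent_block_diag)

lemma ctransp_block_diag:
  "ctransp (block_diag j k X Y) = block_diag j k (ctransp X) (ctransp Y)"
  by (rule fmat_eq_blocksI[OF bnd_ctransp[OF bnd_block_diag] bnd_block_diag])
    (simp_all add: ent_block_diag)

lemma idm_block_diag: "block_diag j k (idm j) (idm k) = idm (j + k)"
proof -
  have "bnd (j + k) (idm (j + k))" unfolding idm_def by (rule bnd_mk)
  then show ?thesis
    by (intro fmat_eq_blocksI[OF bnd_block_diag]) (auto simp: ent_block_diag idm_diag_mat ent_diag_mat)
qed

lemma block_diag_inj:
  assumes "bnd j X" "bnd k Y" "bnd j X'" "bnd k Y'" "block_diag j k X Y = block_diag j k X' Y'"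
  shows "X = X'" "Y = Y'"
proof -
  have "ent X a b = ent X' a b" for a b
    using ent_block_diag(1)[of a j b k X Y] ent_block_diag(1)[of a j b k X' Y'] assms
    by (cases "a < j \<and> b < j") (auto simp: bnd_def not_less)
  then show "X = X'" by (rule fmat_eqI)
  have "ent Y a b = ent Y' a b" for a b
    using ent_block_diag(4)[of a k b j X Y] ent_block_diag(4)[of a k b j X' Y'] assms
    by (cases "a < k \<and> b < k") (auto simp: bnd_def not_less)
  then show "Y = Y'" by (rule fmat_eqI)
qed

lemma block_diag_in_matalg:
  assumes "X \<in> matalg D j" "Y \<in> matalg D k"
  shows "block_diag j k X Y \<in> matalg D (j + k)"
  unfolding block_diag_def using assms
  by (intro mk_in_matalg) (auto simp: matalg_def scalars_closed)

text \<open>An off-diagonal entry of a commuting matrix satisfies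
  \<open>z * qi = - (qi * z)\<close>, up to sign, and a complex such \<open>z\<close> is
  zero.\<close>

lemma UxU_eq:
  "UxU j k = {g \<in> unitary_group CC (j + k). g * signed_i (j + k) j = signed_i (j + k) j * g}"
proof (intro subset_antisym subsetI)
  fix g assume "g \<in> UxU j k"
  then obtain X Y where XY: "X \<in> unitary_group CC j" "Y \<in> unitary_group CC k" "g = block_diag j k X Y"
    by (auto simp: UxU_def)
  note X = unitary_groupD[OF XY(1)] and Y = unitary_groupD[OF XY(2)]
  note b = matalg_bnd[OF X(1)] matalg_bnd[OF Y(1)]
  have "ctransp g * g = idm (j + k)" "g * ctransp g = idm (j + k)"
    using X Y b by (simp_all add: XY(3) ctransp_block_diag block_diag_mult bnd_ctransp idm_block_diag)
  then have "g \<in> unitary_group CC (j + k)"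
    using block_diag_in_matalg[OF X(1) Y(1)] XY(3) by (simp add: unitary_group_def)
  moreover have "g * signed_i (j + k) j = signed_i (j + k) j * g"
  proof (rule fmat_eq_blocksI[where j = j and k = k])
    have "bnd (j + k) (signed_i (j + k) j)" unfolding signed_i_def by (rule bnd_diag_mat)
    then show "bnd (j + k) (g * signed_i (j + k) j)" "bnd (j + k) (signed_i (j + k) j * g)"
      unfolding XY(3) by (auto intro: bnd_times bnd_block_diag)
  qed (use CC_entries[OF X(1)] CC_entries[OF Y(1)] in \<open>simp_all add: XY(3) signed_i_def
      ent_diag_mat_times ent_times_diag_mat[OF bnd_block_diag] ent_block_diag quat_eq_iff\<close>)
  ultimately show "g \<in> {g \<in> unitary_group CC (j + k). g * signed_i (j + k) j = signed_i (j + k) j * g}"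
    by blast
next
  fix g assume "g \<in> {g \<in> unitary_group CC (j + k). g * signed_i (j + k) j = signed_i (j + k) j * g}"
  then have g: "g \<in> unitary_group CC (j + k)" "g * signed_i (j + k) j = signed_i (j + k) j * g"
    by auto
  note g' = unitary_groupD[OF g(1)]
  have offdiag: "ent g a (b + j) = 0" if "a < j" "b < k" for a b
    using that arg_cong[OF g(2), of "\<lambda>x. ent x a (b + j)"] CC_entries[OF g'(1), of a "b + j"]
    by (simp add: signed_i_def ent_diag_mat_times ent_times_diag_mat[OF matalg_bnd[OF g'(1)]] quat_eq_iff)
  have offdiag': "ent g (a + j) b = 0" if "a < k" "b < j" for a b
    using that arg_cong[OF g(2), of "\<lambda>x. ent x (a + j) b"] CC_entries[OF g'(1), of "a + j" b]
    by (simp add: signed_i_def ent_diag_mat_times ent_times_diag_mat[OF matalg_bnd[OF g'(1)]] quat_eq_iff)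
  define X where "X = mk j (ent g)"
  define Y where "Y = mk k (\<lambda>a b. ent g (a + j) (b + j))"
  have X: "X \<in> matalg CC j" and Y: "Y \<in> matalg CC k"
    unfolding X_def Y_def
    by (rule mk_in_matalg, use g'(1) in \<open>simp add: matalg_def\<close>)+
  have gXY: "block_diag j k X Y = g"
    by (rule fmat_eq_blocksI[OF bnd_block_diag matalg_bnd[OF g'(1)]])
      (simp_all add: ent_block_diag offdiag offdiag' X_def Y_def)
  note b = matalg_bnd[OF X] matalg_bnd[OF Y]
  have bi: "bnd j (idm j)" "bnd k (idm k)" unfolding idm_def by (rule bnd_mk)+
  have "block_diag j k (ctransp X * X) (ctransp Y * Y) = block_diag j k (idm j) (idm k)"
    "block_diag j k (X * ctransp X) (Y * ctransp Y) = block_diag j k (idm j) (idm k)"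
    using g' b
    by (simp_all add: gXY[symmetric] ctransp_block_diag block_diag_mult bnd_ctransp idm_block_diag)
  from block_diag_inj[OF _ _ _ _ this(1)] block_diag_inj[OF _ _ _ _ this(2)]
  have "X \<in> unitary_group CC j" "Y \<in> unitary_group CC k"
    using X Y b bi by (auto simp: unitary_group_def bnd_times bnd_ctransp)
  then show "g \<in> UxU j k" using gXY by (auto simp: UxU_def)
qed

text \<open>A quaternion commutes with i exactly when it is complex.\<close>

lemma unitary_group_CC_eq:
  "unitary_group CC n = {g \<in> unitary_group HH n. g * signed_i n n = signed_i n n * g}"
proof (intro subset_antisym subsetI)
  have i: "signed_i n n = diag_mat n (\<lambda>_. qi)"
    by (auto simp: signed_i_def fmat_eq_iff ent_diag_mat)
  {
    fix g assume g: "g \<in> unitary_group CC n"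
    then have "g \<in> matalg CC n" by (rule unitary_groupD)
    then show "g \<in> {g \<in> unitary_group HH n. g * signed_i n n = signed_i n n * g}"
      using g diag_qi_central[of g n] matalg_subset_HH by (auto simp: unitary_group_def i)
  next
    fix g assume g: "g \<in> {g \<in> unitary_group HH n. g * signed_i n n = signed_i n n * g}"
    then have gG: "g \<in> unitary_group HH n" by simp
    note g' = unitary_groupD[OF gG]
    have "g \<in> matalg CC n"
    proof (rule matalgI)
      fix a b assume "n \<le> a \<or> n \<le> b"
      then show "ent g a b = 0" using matalg_bnd[OF g'(1)] by (auto simp: bnd_def)
    next
      fix a b assume "a < n" "b < n"
      moreover have "ent (g * signed_i n n) a b = ent (signed_i n n * g) a b" using g by simp
      ultimately show "ent g a b \<in> scalars CC"
        by (simp add: i ent_diag_mat_times ent_times_diag_mat[OF matalg_bnd[OF g'(1)]] quat_eq_iff)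
    qed
    then show "g \<in> unitary_group CC n" using gG by (simp add: unitary_group_def)
  }
qed

lemma S0_RR_identified:
  "identified_with (S0 (matalg RR (2 * m)) (idm (2 * m))) (unitary_group RR (2 * m)) (U_in_O m)"
proof -
  have "S0 (matalg RR (2 * m)) (idm (2 * m)) = conj_orbit RR (2 * m) (symplectic m)"
    using ex_conjugate_RR conj_in_S0[OF _ symplectic_in_S0] by (fastforce simp: conj_orbit_def)
  moreover have "symplectic m \<in> matalg RR (2 * m)"
    using symplectic_in_S0[of m] by (simp add: S0_def Sq_def)
  ultimately show ?thesis using conj_orbit_identified[OF _ U_in_O_eq] by simp
qed

lemma S0_HH_identified:
  "identified_with (S0 (matalg HH n) (idm n)) (unitary_group HH n) (unitary_group CC n)"
proof -
  have i: "signed_i n n \<in> S0 (matalg HH n) (idm n)" by (rule signed_i_in_S0) simp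
  have "S0 (matalg HH n) (idm n) = conj_orbit HH n (signed_i n n)"
    using ex_conjugate_HH conj_in_S0[OF _ i] by (fastforce simp: conj_orbit_def)
  moreover have "signed_i n n \<in> matalg HH n" using i by (simp add: S0_def Sq_def)
  ultimately show ?thesis using conj_orbit_identified[OF _ unitary_group_CC_eq] by simp
qed

text \<open>The trace against the central element \<open>\<i>\<close> separates the orbits.\<close>

lemma inner_conj_orbit_CC:
  assumes j: "j \<le> n" and s: "s \<in> conj_orbit CC n (signed_i n j)"
  shows "inner (signed_i n n) s = 2 * real j - real n"
proof -
  interpret M: star_algebra "matalg CC n" "idm n" ctransp by (rule star_algebra_matalg)
  obtain g where g: "g \<in> unitary_group CC n" "s = g * signed_i n j * ctransp g"
    using s by (auto simp: conj_orbit_def)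
  note g' = unitary_groupD[OF g(1)]
  define i where "i = signed_i n n"
  have i_diag: "i = diag_mat n (\<lambda>_. qi)"
    by (auto simp: i_def signed_i_def fmat_eq_iff ent_diag_mat)
  have i0: "i \<in> S0 (matalg CC n) (idm n)" unfolding i_def by (rule signed_i_in_S0) simp
  note i' = M.S0_facts[OF i0]
  have ig: "i * g = g * i" using diag_qi_central[OF g'(1)] i_diag by simp
  have "signed_i n j = i * (2 *\<^sub>R col_proj n {..<j} - idm n)"
    by (auto simp: fmat_eq_iff i_diag ent_diag_mat_times signed_i_def ent_diag_mat col_proj_def
        idm_diag_mat quat_eq_iff)
  then have si: "ctransp i * signed_i n j = 2 *\<^sub>R col_proj n {..<j} - idm n"
    using i' col_proj_in_matalg[of n "{..<j}" CC] by (simp add: M.closed)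
  have "inner i s = inner (ctransp g * (i * g)) (signed_i n j)"
    unfolding g(2) using inner_fmat_mult(2)[of i g "g * signed_i n j"]
      inner_fmat_mult(1)[of "ctransp g" "i * g" "signed_i n j"] by (simp add: ctransp_ctransp)
  also have "ctransp g * (i * g) = i" unfolding ig using g'(4)[OF i'(1)] .
  also have "inner i (signed_i n j) = inner (idm n) (ctransp i * signed_i n j)"
    using inner_fmat_mult(1)[of i "idm n" "signed_i n j"] i'(1) by simp
  also have "\<dots> = 2 * real j - real n"
    using inner_idm_col_proj[of "{..<j}" n] inner_idm_col_proj[of "{..<n}" n] j
    by (simp add: si inner_diff_right col_proj_full)
  finally show ?thesis by (simp add: i_def)
qed

text \<open>The orbits are finitely many, compact and separated by the trace, so each is the
  complement of a closed set.\<close>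

lemma S0_CC_identified:
  "\<exists>C :: nat \<Rightarrow> fmat set. S0 (matalg CC n) (idm n) = (\<Union>j\<le>n. C j) \<and> disjoint_family_on C {..n} \<and>
    (\<forall>j\<le>n. openin (top_of_set (S0 (matalg CC n) (idm n))) (C j) \<and>
       identified_with (C j) (unitary_group CC n) (UxU j (n - j)))"
proof (intro exI[of _ "\<lambda>j. conj_orbit CC n (signed_i n j)"] conjI allI impI)
  let ?S = "S0 (matalg CC n) (idm n)" and ?C = "\<lambda>j. conj_orbit CC n (signed_i n j)"
  have i: "signed_i n j \<in> ?S" for j by (rule signed_i_in_S0) simp
  show S: "?S = (\<Union>j\<le>n. ?C j)"
    using ex_conjugate_CC[of _ n] conj_in_S0[OF _ i] unfolding conj_orbit_def by fastforce
  have disj: "?C j \<inter> ?C k = {}" if "j \<le> n" "k \<le> n" "j \<noteq> k" for j k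
    using inner_conj_orbit_CC[OF that(1)] inner_conj_orbit_CC[OF that(2)] that(3) by fastforce
  then show "disjoint_family_on ?C {..n}" by (auto simp: disjoint_family_on_def)
  fix j assume j: "j \<le> n"
  have "closed (\<Union>k\<in>{..n} - {j}. ?C k)"
    by (intro closed_UN ballI compact_imp_closed compact_conj_orbit) auto
  then have "openin (top_of_set ?S) (?S \<inter> - (\<Union>k\<in>{..n} - {j}. ?C k))"
    by (intro openin_open_Int open_Compl)
  also have "?S \<inter> - (\<Union>k\<in>{..n} - {j}. ?C k) = ?C j"
    using disj[OF j] j by (subst S) auto
  finally show "openin (top_of_set ?S) (?C j)" .
  show "identified_with (?C j) (unitary_group CC n) (UxU j (n - j))"
    using conj_orbit_identified[OF _ UxU_eq[of j "n - j"]] i[of j] j by (simp add: S0_def Sq_def)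
qed

section \<open>The zero variety\<close>

context star_algebra
begin

text \<open>The second component keeps its sign because the form is bilinear. Uniqueness is tested
  on vectors with one component zero.\<close>

lemma ctranspose_on_clmul:
  assumes a: "a \<in> B" "b \<in> B" and x: "x \<in> B \<times> B"
  shows "ctranspose_on B (clmul (a, b)) x = clmul (star a, star b) x"
proof -
  let ?f = "clmul (a, b)" and ?g = "clmul (star a, star b)"
  let ?P = "\<lambda>g. (\<forall>x\<in>B \<times> B. g x \<in> B \<times> B) \<and>
    (\<forall>x\<in>B \<times> B. \<forall>y\<in>B \<times> B. cform (?f x) y = cform x (g y))"
  have g: "?P ?g"
    using a by (auto simp: closed inner_diff_left inner_diff_right inner_add_left inner_add_right
        inner_mult_left)
  have P: "?P (ctranspose_on B ?f)"
    unfolding ctranspose_on_def by (rule someI[of ?P, OF g])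
  obtain u1 u2 where u: "ctranspose_on B ?f x = (u1, u2)" by force
  obtain v1 v2 where v: "?g x = (v1, v2)" by force
  have "(u1, u2) \<in> B \<times> B" "(v1, v2) \<in> B \<times> B"
    unfolding u[symmetric] v[symmetric] using P g x by blast+
  then have mem: "u1 \<in> B" "u2 \<in> B" "v1 \<in> B" "v2 \<in> B" by auto
  have eq: "cform y (u1, u2) = cform y (v1, v2)" if "y \<in> B \<times> B" for y
    unfolding u[symmetric] v[symmetric] using P g x that by fastforce
  have "u1 - v1 \<in> B" "u2 - v2 \<in> B" using mem by (simp_all add: closed)
  then have "inner (u1 - v1) (u1 - v1) = 0" "inner (u2 - v2) (u2 - v2) = 0"
    using eq[of "(u1 - v1, 0)"] eq[of "(0, u2 - v2)"] closed_ops(1)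
    by (auto simp: inner_diff_right)
  then show ?thesis using u v by simp
qed

text \<open>The composition is left multiplication by the pair \<open>(p, q)\<close> below, and a
  left multiplication vanishes if it kills the unit.\<close>

lemma calZ_iff:
  "(a, b) \<in> calZ B \<longleftrightarrow>
    a \<in> B \<and> b \<in> B \<and> star a * a = star b * b \<and> star a * b + star b * a = 0"
proof (cases "a \<in> B \<and> b \<in> B")
  case True
  define p where "p = star a * a - star b * b"
  define q where "q = star a * b + star b * a"
  have pq: "p \<in> B" "q \<in> B" using True by (simp_all add: p_def q_def closed)
  have eq: "ctranspose_on B (clmul (a, b)) (clmul (a, b) (x, y)) = (p * x - q * y, p * y + q * x)"
    if "x \<in> B" "y \<in> B" for x y
    using True that
    by (subst ctranspose_on_clmul) (auto simp: closed p_def q_def algebra_simps)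
  have "(a, b) \<in> calZ B \<longleftrightarrow> (\<forall>x\<in>B. \<forall>y\<in>B. (p * x - q * y, p * y + q * x) = 0)"
    using True eq by (auto simp: calZ_def)
  also have "\<dots> \<longleftrightarrow> p = 0 \<and> q = 0"
  proof
    assume "\<forall>x\<in>B. \<forall>y\<in>B. (p * x - q * y, p * y + q * x) = 0"
    then have "(p * e - q * 0, p * 0 + q * e) = 0" using unit_closed closed_ops(1) by blast
    then show "p = 0 \<and> q = 0" using pq by (simp add: zero_prod_def)
  qed (simp add: zero_prod_def)
  finally show ?thesis using True by (simp add: p_def q_def)
next
  case False
  then show ?thesis by (auto simp: calZ_def)
qed

lemma adjoint_conditions_iff:
  assumes a: "a \<in> B" "b \<in> B"
  shows "(\<forall>x\<in>B. adjoint_on B (lmul a) (lmul a x) = adjoint_on B (lmul b) (lmul b x)) \<longleftrightarrow>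
      star a * a = star b * b"
    and "(\<forall>x\<in>B. adjoint_on B (lmul a) (lmul b x) + adjoint_on B (lmul b) (lmul a x) = 0) \<longleftrightarrow>
      star a * b + star b * a = 0"
proof -
  have *: "adjoint_on B (lmul c) (lmul d x) = (star c * d) * x" if "c \<in> B" "d \<in> B" "x \<in> B" for c d x
    using adjoint_lmul[of c "lmul d x"] that by (simp add: lmul_def closed mult.assoc)
  have mem: "star a * a \<in> B" "star b * b \<in> B" "star a * b + star b * a \<in> B"
    using a by (simp_all add: closed)
  have "(\<forall>x\<in>B. (star a * a) * x = (star b * b) * x) \<longleftrightarrow> star a * a = star b * b"
    using mem unit_closed unit(2) by metis
  then show "(\<forall>x\<in>B. adjoint_on B (lmul a) (lmul a x) = adjoint_on B (lmul b) (lmul b x)) \<longleftrightarrow>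
      star a * a = star b * b"
    using a * by simp
  have "(\<forall>x\<in>B. (star a * b + star b * a) * x = 0) \<longleftrightarrow> star a * b + star b * a = 0"
    using mem unit_closed unit(2) by (metis mult_zero_left)
  then show "(\<forall>x\<in>B. adjoint_on B (lmul a) (lmul b x) + adjoint_on B (lmul b) (lmul a x) = 0) \<longleftrightarrow>
      star a * b + star b * a = 0"
    using a * by (simp add: distrib_right)
qed

lemma Z0_iff: "(a, b) \<in> Z0 B e \<longleftrightarrow> a \<in> B \<and> b \<in> B \<and> (\<exists>s\<in>S0 B e. a = - (s * b))"
  by (auto simp: Z0_def eq_neg_iff_add_eq_0)

text \<open>The hypothesis \<open>ext\<close> isolates what depends on the division algebra and on
  parity. As \<open>t * (t * b) = - b\<close>, the element \<open>b\<close> lies in the support of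
  \<open>t\<close>, where \<open>s\<close> and \<open>t\<close> agree; so
  \<open>s * b = t * b = - a\<close>.\<close>

lemma Z0_eq_calZ:
  assumes ext: "\<And>t. t \<in> B \<Longrightarrow> star t = - t \<Longrightarrow> t * (t * t) = - t \<Longrightarrow> \<exists>s\<in>S0 B e. s * (t * t) = - t"
  shows "Z0 B e = calZ B"
proof (rule set_eqI)
  fix w :: "'a \<times> 'a"
  obtain a b where w: "w = (a, b)" by force
  show "w \<in> Z0 B e \<longleftrightarrow> w \<in> calZ B"
    unfolding w Z0_iff calZ_iff
  proof (intro iffI; elim conjE bexE)
    fix s assume ab: "a \<in> B" "b \<in> B" and s: "s \<in> S0 B e" and eq: "a = - (s * b)"
    note s = S0_facts[OF s]
    have "star b * (s * (s * b)) = - (star b * b)" using s ab by simp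
    then show "a \<in> B \<and> b \<in> B \<and> star a * a = star b * b \<and> star a * b + star b * a = 0"
      using s ab by (simp add: eq star_simps mult.assoc)
  next
    assume ab: "a \<in> B" "b \<in> B" and "star a * a = star b * b" "star a * b + star b * a = 0"
    then obtain t where t: "t \<in> B" "star t = - t" "t * (t * t) = - t" "t * a = b" "t * b = - a"
      using ex_partial_complex_structure by metis
    obtain s where s: "s \<in> S0 B e" "s * (t * t) = - t" using ext t by blast
    have "t * (t * b) = - b" using t by simp
    then have "b = - (t * t * b)" by (simp add: mult.assoc)
    then have "s * b = - (s * (t * t) * b)" by (metis mult.assoc mult_minus_right)
    then have "a = - (s * b)" using s t by simp
    then show "a \<in> B \<and> b \<in> B \<and> (\<exists>s\<in>S0 B e. a = - (s * b))" using ab s by blast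
  qed
qed

text \<open>Because \<open>s * s = - e\<close>, the equation \<open>a = - (s * b)\<close> is the
  same as \<open>b = s * a\<close>.\<close>

lemma Z0_eq_UN_calW: "Z0 B e = (\<Union>s\<in>S0 B e. calW B (lmul s))"
proof (rule set_eqI)
  fix w :: "'a \<times> 'a"
  obtain a b where w: "w = (a, b)" by force
  have "a \<in> B \<and> b \<in> B \<and> a = - (s * b) \<longleftrightarrow> (a, b) \<in> calW B (lmul s)" if "s \<in> S0 B e" for s
  proof -
    note s = S0_facts[OF that]
    show ?thesis using s by (auto simp: calW_def lmul_def closed)
  qed
  then show "w \<in> Z0 B e \<longleftrightarrow> w \<in> (\<Union>s\<in>S0 B e. calW B (lmul s))"
    unfolding w Z0_iff by blast
qed

text \<open>Real and imaginary part of the form vanish because left multiplication by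
  \<open>s\<close> is orthogonal and skew, respectively.\<close>

lemma calW_isotropic_csubspace:
  assumes s0: "s \<in> S0 B e"
  shows "csubspace_of (calW B (lmul s))"
    and "x \<in> calW B (lmul s) \<Longrightarrow> y \<in> calW B (lmul s) \<Longrightarrow> cform x y = 0"
proof -
  note s = S0_facts[OF s0]
  show "csubspace_of (calW B (lmul s))"
    unfolding csubspace_of_def
  proof (intro conjI ballI allI)
    show "0 \<in> calW B (lmul s)" using closed_ops(1) by (auto simp: calW_def lmul_def zero_prod_def)
    fix x assume "x \<in> calW B (lmul s)"
    then obtain v where v: "v \<in> B" "x = (v, s * v)" by (auto simp: calW_def lmul_def)
    show "x + y \<in> calW B (lmul s)" if "y \<in> calW B (lmul s)" for y
      using that v by (auto simp: calW_def lmul_def closed distrib_left)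
    show "cscale c x \<in> calW B (lmul s)" for c
    proof -
      \<comment> \<open>On this subspace multiplication by the scalar i acts as
        \<open>v \<mapsto> - (s * v)\<close> in the first component.\<close>
      let ?u = "Re c *\<^sub>R v - Im c *\<^sub>R (s * v)"
      have "cscale c x = (?u, s * ?u)" using v s by (simp add: right_diff_distrib)
      moreover have "?u \<in> B" using v s by (simp add: closed)
      ultimately show ?thesis by (auto simp: calW_def lmul_def)
    qed
  qed
  assume "x \<in> calW B (lmul s)" "y \<in> calW B (lmul s)"
  then obtain u v where uv: "u \<in> B" "x = (u, s * u)" "v \<in> B" "y = (v, s * v)"
    by (auto simp: calW_def lmul_def)
  then show "cform x y = 0"
    using s by (simp add: inner_mult_left zero_complex.code complex_eq_iff)
qed

lemma Z0_cscale:
  assumes "w \<in> Z0 B e"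
  shows "cscale c w \<in> Z0 B e"
proof -
  obtain s where s: "s \<in> S0 B e" "w \<in> calW B (lmul s)"
    using assms unfolding Z0_eq_UN_calW by blast
  then have "cscale c w \<in> calW B (lmul s)"
    using calW_isotropic_csubspace(1)[OF s(1)] by (simp add: csubspace_of_def)
  then show ?thesis unfolding Z0_eq_UN_calW using s(1) by blast
qed

text \<open>This is the determinantal property. If \<open>b\<close> kills some \<open>y\<close>, so
  does \<open>a = - (s * b)\<close>; otherwise \<open>b * y = - (s * b)\<close> is solvable and
  \<open>(e, y)\<close> is in the kernel.\<close>

lemma Z0_not_inj:
  assumes e: "e \<noteq> 0" and w: "w \<in> Z0 B e"
  shows "\<not> inj_on (clmul w) (B \<times> B)"
proof -
  obtain a b where ab: "w = (a, b)" by force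
  then obtain s where s: "s \<in> S0 B e" "a \<in> B" "b \<in> B" "a = - (s * b)"
    using w by (auto simp: Z0_iff)
  note s' = S0_facts[OF s(1)]
  have "\<exists>z\<in>B \<times> B. z \<noteq> (0, 0) \<and> clmul w z = (0, 0)"
  proof (cases "\<exists>y\<in>B. y \<noteq> 0 \<and> b * y = 0")
    case True
    then obtain y where "y \<in> B" "y \<noteq> 0" "b * y = 0" by blast
    then show ?thesis
      using closed_ops(1) by (intro bexI[of _ "(0, y)"]) (auto simp: ab s(4) mult.assoc)
  next
    case False
    moreover have "- (s * b) \<in> B" using s s' by (simp add: closed)
    ultimately obtain y where y: "y \<in> B" "b * y = - (s * b)"
      using left_mult_surj[OF s(3)] by metis
    have "s * b * e = s * b" using s s' by (simp add: closed)
    moreover have "s * b * y = b" using y(2) s s' by (simp add: mult.assoc)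
    ultimately have "clmul w (e, y) = (0, 0)" using y s by (simp add: ab)
    then show ?thesis using e y(1) unit_closed by (intro bexI[of _ "(e, y)"]) auto
  qed
  then obtain z where z: "z \<in> B \<times> B" "z \<noteq> (0, 0)" "clmul w z = (0, 0)" by blast
  have "clmul w (0, 0) = (0, 0)" by (simp add: ab)
  then show ?thesis using z closed_ops(1) by (metis SigmaI inj_onD)
qed

end

section \<open>Products\<close>

text \<open>Membership amounts to \<open>s * s = - e\<close> and \<open>s * t = e\<close>, where
  left multiplication by \<open>t\<close> is the adjoint; both equations can be tested component by
  component.\<close>

lemma wedderburn_image_S0:
  fixes A :: "'a::{real_algebra,real_inner} set"
  assumes alg: "findim_algebra A e"
    and wd: "wedderburn_decomposition A e I D n \<phi>"
    and ad: "adapted A I \<phi>"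
  shows "\<phi> ` S0 A e = (\<Pi>\<^sub>E r\<in>I. S0 (matalg (D r) (n r)) (idm (n r)))"
proof -
  let ?P = "\<Pi>\<^sub>E r\<in>I. matalg (D r) (n r)"
  have bij: "bij_betw \<phi> A ?P" using wd by (simp add: wedderburn_decomposition_def)
  have hom: "\<phi> (x * y) r = \<phi> x r * \<phi> y r" if "x \<in> A" "y \<in> A" "r \<in> I" for x y r
    using wd that by (simp add: wedderburn_decomposition_def)
  have scl: "\<phi> (c *\<^sub>R x) r = c *\<^sub>R \<phi> x r" if "x \<in> A" "r \<in> I" for x c r
    using wd that by (simp add: wedderburn_decomposition_def)
  have \<phi>e: "\<phi> e r = idm (n r)" if "r \<in> I" for r
    using wd that by (simp add: wedderburn_decomposition_def)
  have A: "subspace A" "e \<in> A" "\<And>x y. x \<in> A \<Longrightarrow> y \<in> A \<Longrightarrow> x * y \<in> A"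
    "\<And>x. x \<in> A \<Longrightarrow> x * e = x" "\<And>x. x \<in> A \<Longrightarrow> e * x = x"
    using alg findim_subspace by (auto simp: findim_algebra_def)
  have \<phi>P: "\<phi> x \<in> ?P" if "x \<in> A" for x using bij that by (auto simp: bij_betw_def)
  have eqI: "x = y" if "x \<in> A" "y \<in> A" "\<And>r. r \<in> I \<Longrightarrow> \<phi> x r = \<phi> y r" for x y
  proof -
    have "\<phi> x = \<phi> y" by (rule PiE_ext[OF \<phi>P[OF that(1)] \<phi>P[OF that(2)] that(3)])
    then show ?thesis using bij that(1,2) by (auto simp: bij_betw_def inj_on_def)
  qed
  have S0_iff: "s \<in> S0 A e \<longleftrightarrow> (\<forall>r\<in>I. \<phi> s r \<in> S0 (matalg (D r) (n r)) (idm (n r)))"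
    if s: "s \<in> A" for s
  proof -
    have mem: "\<phi> s r \<in> matalg (D r) (n r)" if "r \<in> I" for r using \<phi>P[OF s] that by auto
    have "(\<lambda>r\<in>I. ctransp (\<phi> s r)) \<in> ?P" using mem ctransp_in_matalg by auto
    \<comment> \<open>Adaptedness makes the element with conjugate-transposed components represent
      the adjoint.\<close>
    then obtain t where t: "t \<in> A" "\<phi> t = (\<lambda>r\<in>I. ctransp (\<phi> s r))"
      using bij unfolding bij_betw_def by (metis (no_types, lifting) imageE)
    have "adjoint_on A (lmul s) x = t * x" if "x \<in> A" for x
    proof (rule adjoint_on_eqI[OF A(1) that])
      fix x y assume "x \<in> A" "y \<in> A"
      then show "inner (lmul s x) y = inner x (t * y)"
        using ad s t A(3) by (simp add: adapted_def lmul_def hom inner_fmat_mult(1))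
    qed (use t A in auto)
    then have "s \<in> S0 A e \<longleftrightarrow> s * s = - e \<and> (\<forall>x\<in>A. s * (t * x) = x)"
      using s by (simp add: S0_def Sq_def lmul_def)
    also have "(\<forall>x\<in>A. s * (t * x) = x) \<longleftrightarrow> s * t = e"
      using A s t(1) by (metis mult.assoc)
    also have "s * t = e \<longleftrightarrow> (\<forall>r\<in>I. \<phi> s r * ctransp (\<phi> s r) = idm (n r))"
      using eqI[OF A(3)[OF s t(1)] A(2)] hom[OF s t(1)] \<phi>e t(2) by auto
    also have "s * s = - e \<longleftrightarrow> (\<forall>r\<in>I. \<phi> s r * \<phi> s r = - idm (n r))"
    proof -
      have 1: "\<phi> (- e) r = - idm (n r)" if "r \<in> I" for r
        using scl[OF A(2) that, of "-1"] \<phi>e[OF that] by simp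
      have 2: "- e \<in> A" using A(1,2) by (simp add: subspace_neg)
      show ?thesis
      proof
        assume "s * s = - e"
        then show "\<forall>r\<in>I. \<phi> s r * \<phi> s r = - idm (n r)" using hom[OF s s] 1 by metis
      next
        assume "\<forall>r\<in>I. \<phi> s r * \<phi> s r = - idm (n r)"
        then show "s * s = - e" using hom[OF s s] 1 by (intro eqI[OF A(3)[OF s s] 2]) simp
      qed
    qed
    finally show ?thesis
      using mem star_algebra.S0_iff_unitary[OF star_algebra_matalg] by auto
  qed
  show ?thesis
  proof (intro subset_antisym subsetI)
    fix f assume "f \<in> \<phi> ` S0 A e"
    then obtain s where s: "s \<in> S0 A e" "f = \<phi> s" by blast
    then have "s \<in> A" by (simp add: S0_def Sq_def)
    then show "f \<in> (\<Pi>\<^sub>E r\<in>I. S0 (matalg (D r) (n r)) (idm (n r)))"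
      using S0_iff s \<phi>P[of s] by (auto simp: PiE_iff)
  next
    fix f assume f: "f \<in> (\<Pi>\<^sub>E r\<in>I. S0 (matalg (D r) (n r)) (idm (n r)))"
    then have "f \<in> ?P" by (auto simp: PiE_iff S0_def Sq_def)
    then obtain s where s: "s \<in> A" "f = \<phi> s" using bij unfolding bij_betw_def by blast
    then have "s \<in> S0 A e" using S0_iff f by auto
    then show "f \<in> \<phi> ` S0 A e" using s by blast
  qed
qed

text \<open>Each coordinate of a point selects its own component. An empty factor has no components,
  and then both sides are empty.\<close>

lemma PiE_components:
  assumes "finite I" and "\<And>r. r \<in> I \<Longrightarrow> finite (components (S r))"
  shows "finite (\<Pi>\<^sub>E r\<in>I. components (S r))"
    and "(\<Pi>\<^sub>E r\<in>I. S r) = (\<Union>M\<in>(\<Pi>\<^sub>E r\<in>I. components (S r)). \<Pi>\<^sub>E r\<in>I. M r)"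
proof -
  show "finite (\<Pi>\<^sub>E r\<in>I. components (S r))" using assms by (intro finite_PiE)
  show "(\<Pi>\<^sub>E r\<in>I. S r) = (\<Union>M\<in>(\<Pi>\<^sub>E r\<in>I. components (S r)). \<Pi>\<^sub>E r\<in>I. M r)"
  proof (intro subset_antisym subsetI)
    fix f assume f: "f \<in> (\<Pi>\<^sub>E r\<in>I. S r)"
    define M where "M = (\<lambda>r\<in>I. connected_component_set (S r) (f r))"
    have "M \<in> (\<Pi>\<^sub>E r\<in>I. components (S r))"
      using f by (auto simp: M_def components_def PiE_iff)
    moreover have "f \<in> (\<Pi>\<^sub>E r\<in>I. M r)" using f by (auto simp: M_def PiE_iff)
    ultimately show "f \<in> (\<Union>M\<in>(\<Pi>\<^sub>E r\<in>I. components (S r)). \<Pi>\<^sub>E r\<in>I. M r)" by blast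
  next
    fix f assume "f \<in> (\<Union>M\<in>(\<Pi>\<^sub>E r\<in>I. components (S r)). \<Pi>\<^sub>E r\<in>I. M r)"
    then obtain M where "M \<in> (\<Pi>\<^sub>E r\<in>I. components (S r))" "f \<in> (\<Pi>\<^sub>E r\<in>I. M r)" by blast
    then show "f \<in> (\<Pi>\<^sub>E r\<in>I. S r)"
      using in_components_subset by (auto simp: PiE_iff) blast
  qed
qed

theorem theoremC:
  fixes A :: "'a::{real_algebra,real_inner} set" and e :: 'a
    and I :: "'r set" and D :: "'r \<Rightarrow> divalg" and n :: "'r \<Rightarrow> nat" and \<phi> :: "'a \<Rightarrow> 'r \<Rightarrow> fmat"
  assumes "findim_algebra A e"
    and "semisimple_algebra A"
    and "wedderburn_decomposition A e I D n \<phi>"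
    and "adapted A I \<phi>"
  shows
    "\<phi> ` S0 A e = (\<Pi>\<^sub>E r\<in>I. S0 (matalg (D r) (n r)) (idm (n r))) \<and>
     (\<exists>\<F>. finite \<F> \<and> \<phi> ` S0 A e = (\<Union>M\<in>\<F>. \<Pi>\<^sub>E r\<in>I. M r) \<and>
        (\<forall>M\<in>\<F>. \<forall>r\<in>I. compact_hermitian_symmetric_space (M r))) \<and>
     (\<forall>r\<in>I.
        (\<forall>m. D r = RR \<and> n r = 2 * m \<longrightarrow>
           identified_with (S0 (matalg RR (n r)) (idm (n r)))
             (unitary_group RR (2 * m)) (U_in_O m)) \<and>
        (D r = CC \<longrightarrow>
           (\<exists>C :: nat \<Rightarrow> fmat set.
              S0 (matalg CC (n r)) (idm (n r)) = (\<Union>j\<le>n r. C j) \<and>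
              disjoint_family_on C {..n r} \<and>
              (\<forall>j\<le>n r. openin (top_of_set (S0 (matalg CC (n r)) (idm (n r)))) (C j) \<and>
                 identified_with (C j) (unitary_group CC (n r)) (UxU j (n r - j))))) \<and>
        (D r = HH \<longrightarrow>
           identified_with (S0 (matalg HH (n r)) (idm (n r)))
             (unitary_group HH (n r)) (unitary_group CC (n r)))) \<and>
     (\<forall>K k. 0 < k \<and> (K = RR \<longrightarrow> even k) \<longrightarrow>
        (let B = matalg K k; S = S0 B (idm k); Z = Z0 B (idm k) in
           Z = calZ B \<and>
           Z = {(a, b) | a b. a \<in> B \<and> b \<in> B \<and>
                 (\<forall>x\<in>B. adjoint_on B (lmul a) (lmul a x) = adjoint_on B (lmul b) (lmul b x)) \<and>
                 (\<forall>x\<in>B. adjoint_on B (lmul a) (lmul b x) + adjoint_on B (lmul b) (lmul a x) = 0)} \<and>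
           Z = (\<Union>s\<in>S. calW B (lmul s)) \<and>
           (\<forall>s\<in>S. csubspace_of (calW B (lmul s)) \<and>
              (\<forall>x\<in>calW B (lmul s). \<forall>y\<in>calW B (lmul s). cform x y = 0)) \<and>
           (\<forall>w\<in>Z. \<forall>c. cscale c w \<in> Z) \<and>
           (\<forall>w\<in>Z. \<not> inj_on (clmul w) (B \<times> B))))"
proof (intro conjI)
  let ?S = "\<lambda>r. S0 (matalg (D r) (n r)) (idm (n r))"
  show img: "\<phi> ` S0 A e = (\<Pi>\<^sub>E r\<in>I. ?S r)"
    by (rule wedderburn_image_S0[OF assms(1,3,4)])
  have "finite I" using assms(3) by (simp add: wedderburn_decomposition_def)
  moreover have "finite (components (?S r))" for r
    by (rule star_algebra.finite_components_S0[OF star_algebra_matalg])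
  ultimately have "finite (\<Pi>\<^sub>E r\<in>I. components (?S r))"
    "(\<Pi>\<^sub>E r\<in>I. ?S r) = (\<Union>M\<in>(\<Pi>\<^sub>E r\<in>I. components (?S r)). \<Pi>\<^sub>E r\<in>I. M r)"
    by (rule PiE_components)+
  moreover have "compact_hermitian_symmetric_space (M r)"
    if "M \<in> (\<Pi>\<^sub>E r\<in>I. components (?S r))" "r \<in> I" for M r
    using star_algebra.compact_hermitian_symmetric_component[OF star_algebra_matalg] that
    by (auto simp: PiE_iff)
  ultimately show "\<exists>\<F>. finite \<F> \<and> \<phi> ` S0 A e = (\<Union>M\<in>\<F>. \<Pi>\<^sub>E r\<in>I. M r) \<and>
        (\<forall>M\<in>\<F>. \<forall>r\<in>I. compact_hermitian_symmetric_space (M r))"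
    unfolding img by (intro exI[of _ "\<Pi>\<^sub>E r\<in>I. components (?S r)"] conjI ballI) simp_all
next
  show "\<forall>r\<in>I.
        (\<forall>m. D r = RR \<and> n r = 2 * m \<longrightarrow>
           identified_with (S0 (matalg RR (n r)) (idm (n r)))
             (unitary_group RR (2 * m)) (U_in_O m)) \<and>
        (D r = CC \<longrightarrow>
           (\<exists>C :: nat \<Rightarrow> fmat set.
              S0 (matalg CC (n r)) (idm (n r)) = (\<Union>j\<le>n r. C j) \<and>
              disjoint_family_on C {..n r} \<and>
              (\<forall>j\<le>n r. openin (top_of_set (S0 (matalg CC (n r)) (idm (n r)))) (C j) \<and>
                 identified_with (C j) (unitary_group CC (n r)) (UxU j (n r - j))))) \<and>
        (D r = HH \<longrightarrow>
           identified_with (S0 (matalg HH (n r)) (idm (n r)))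
             (unitary_group HH (n r)) (unitary_group CC (n r)))"
    using S0_RR_identified S0_CC_identified S0_HH_identified by simp
next
  show "\<forall>K k. 0 < k \<and> (K = RR \<longrightarrow> even k) \<longrightarrow>
        (let B = matalg K k; S = S0 B (idm k); Z = Z0 B (idm k) in
           Z = calZ B \<and>
           Z = {(a, b) | a b. a \<in> B \<and> b \<in> B \<and>
                 (\<forall>x\<in>B. adjoint_on B (lmul a) (lmul a x) = adjoint_on B (lmul b) (lmul b x)) \<and>
                 (\<forall>x\<in>B. adjoint_on B (lmul a) (lmul b x) + adjoint_on B (lmul b) (lmul a x) = 0)} \<and>
           Z = (\<Union>s\<in>S. calW B (lmul s)) \<and>
           (\<forall>s\<in>S. csubspace_of (calW B (lmul s)) \<and>
              (\<forall>x\<in>calW B (lmul s). \<forall>y\<in>calW B (lmul s). cform x y = 0)) \<and>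
           (\<forall>w\<in>Z. \<forall>c. cscale c w \<in> Z) \<and>
           (\<forall>w\<in>Z. \<not> inj_on (clmul w) (B \<times> B)))"
    unfolding Let_def
  proof (intro allI impI conjI ballI)
    fix K :: divalg and k :: nat
    assume K: "0 < k \<and> (K = RR \<longrightarrow> even k)"
    interpret M: star_algebra "matalg K k" "idm k" ctransp by (rule star_algebra_matalg)
    let ?B = "matalg K k"
    have "\<exists>s\<in>S0 ?B (idm k). s * (t * t) = - t"
      if "t \<in> ?B" "ctransp t = - t" "t * (t * t) = - t" for t
      using ex_complex_structure_extending[OF _ that] K by blast
    then show Z: "Z0 ?B (idm k) = calZ ?B" by (rule M.Z0_eq_calZ)
    show "Z0 ?B (idm k) = {(a, b) | a b. a \<in> ?B \<and> b \<in> ?B \<and>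
                 (\<forall>x\<in>?B. adjoint_on ?B (lmul a) (lmul a x) = adjoint_on ?B (lmul b) (lmul b x)) \<and>
                 (\<forall>x\<in>?B. adjoint_on ?B (lmul a) (lmul b x) + adjoint_on ?B (lmul b) (lmul a x) = 0)}"
    proof (rule set_eqI)
      fix w :: "fmat \<times> fmat"
      obtain a b where "w = (a, b)" by force
      then show "w \<in> Z0 ?B (idm k) \<longleftrightarrow> w \<in> {(a, b) | a b. a \<in> ?B \<and> b \<in> ?B \<and>
                 (\<forall>x\<in>?B. adjoint_on ?B (lmul a) (lmul a x) = adjoint_on ?B (lmul b) (lmul b x)) \<and>
                 (\<forall>x\<in>?B. adjoint_on ?B (lmul a) (lmul b x) + adjoint_on ?B (lmul b) (lmul a x) = 0)}"
        unfolding Z using M.calZ_iff[of a b] M.adjoint_conditions_iff[of a b] by auto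
    qed
    show "Z0 ?B (idm k) = (\<Union>s\<in>S0 ?B (idm k). calW ?B (lmul s))" by (rule M.Z0_eq_UN_calW)
    show "csubspace_of (calW ?B (lmul s))" if "s \<in> S0 ?B (idm k)" for s
      by (rule M.calW_isotropic_csubspace(1)[OF that])
    show "cform x y = 0"
      if "s \<in> S0 ?B (idm k)" "x \<in> calW ?B (lmul s)" "y \<in> calW ?B (lmul s)" for s x y
      by (rule M.calW_isotropic_csubspace(2)[OF that])
    show "cscale c w \<in> Z0 ?B (idm k)" if "w \<in> Z0 ?B (idm k)" for w c
      by (rule M.Z0_cscale[OF that])
    \<comment> \<open>Positivity of \<open>k\<close> enters here: for size zero the unit would be
      zero.\<close>
    have "ent (idm k) 0 0 \<noteq> 0" using K by (simp add: idm_diag_mat ent_diag_mat)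
    then have "idm k \<noteq> 0" by auto
    then show "\<not> inj_on (clmul w) (?B \<times> ?B)" if "w \<in> Z0 ?B (idm k)" for w
      by (rule M.Z0_not_inj[OF _ that])
  qed
qed

end
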